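(* Let $\Omega\subset\mathbb{R}^d$ be bounded open with Lebesgue measure $m$, and let $W$ satisfy Assumption B. For every $\boldsymbol{\mu}\in\mathcal{M}_{\pi_1\to m}(\Omega\times\mathbb{R}^q)$, $$\mathcal{T}_{E,\mathrm{Eul}}(\boldsymbol{\mu})=\sup_\varphi\Big\{-\int_{\Omega\times\mathbb{R}^q}\big(\nabla_x\cdot\varphi+W^*(\nabla_y\varphi)\big)\,d\boldsymbol{\mu}\ :\ \varphi\in C^1_c(\Omega\times\mathbb{R}^q,\mathbb{R}^d),\ W^*(\nabla_y\varphi)<+\infty\text{ on }\Omega\times\mathbb{R}^q\Big\}.$$
   Context: Assumption B: $W:\mathbb{R}^{qd}\to[0,+\infty)$ (on $q\times d$ matrices) is convex, finite everywhere, and $W(v)\ge C_1|v|^p-C_2$ for some $p\in[1,\infty)$, $C_1>0$, $C_2\ge0$ and some norm $|\cdot|$. $W'_\infty(v)=\lim_{t\to\infty}W(tv)/t$ is its recession function and $W^*(r)=\sup_v(r\cdot v-W(v))$ its Legendre transform ($\cdot$ is the Frobenius scalar product). $\mathcal{M}_{\pi_1\to m}(\Omega\times\mathbb{R}^q)$ is the set of non-negative finite Borel measures on $\Omega\times\mathbb{R}^q$ with first marginal $m$. For $\boldsymbol{\mu}\ge0$ and $J\in\mathcal{M}(\Omega\times\mathbb{R}^q)^{qd}$ with Radon–Nikodym decomposition $J=v\boldsymbol{\mu}+J^\perp$: $\mathcal{B}_W(\boldsymbol{\mu},J)=\int W(v)\,d\boldsymbol{\mu}+\int W'_\infty(dJ^\perp/d|J^\perp|)\,d|J^\perp|$.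 $\mathcal{T}_{E,\mathrm{Eul}}(\boldsymbol{\mu})=\inf\{\mathcal{B}_W(\boldsymbol{\mu},J):J\in\mathcal{M}(\Omega\times\mathbb{R}^q)^{qd},\ \nabla_x\boldsymbol{\mu}+\nabla_y\cdot J=0\}$, where the equation means $\int\nabla_x\cdot\varphi\,d\boldsymbol{\mu}+\int\nabla_y\varphi\cdot dJ=0$ for all smooth compactly supported $\varphi:\Omega\times\mathbb{R}^q\to\mathbb{R}^d$. Here $\nabla_x\cdot\varphi=\sum_{j=1}^d\partial_{x_j}\varphi_j$ and $\nabla_y\varphi$ denotes the $q\times d$ matrix $(\partial_{y_i}\varphi_j)_{1\le i\le q,1\le j\le d}$. *)

theory Defs
  imports "HOL-Analysis.Analysis"
begin

text \<open>Points of Omega x R^q are pairs (x,y) with x :: real^'d, y :: real^'q.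
  q x d matrices are elements of real^'d^'q (row index in 'q, column index in 'd);
  the inner product on this type is the Frobenius scalar product and its norm is
  the Frobenius norm.\<close>

definition is_norm :: "('a::real_vector \<Rightarrow> real) \<Rightarrow> bool" where
  "is_norm N \<longleftrightarrow> (\<forall>x. N x = 0 \<longleftrightarrow> x = 0) \<and> (\<forall>a x. N (a *\<^sub>R x) = \<bar>a\<bar> * N x)
     \<and> (\<forall>x y. N (x + y) \<le> N x + N y)"

definition assumptionB :: "(real^'d^'q \<Rightarrow> real) \<Rightarrow> bool" where
  "assumptionB W \<longleftrightarrow> convex_on UNIV W \<and> (\<forall>v. 0 \<le> W v) \<and>
     (\<exists>p C1 C2 N. 1 \<le> p \<and> C1 > 0 \<and> C2 \<ge> 0 \<and> is_norm N \<and>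
        (\<forall>v. W v \<ge> C1 * N v powr p - C2))"

definition recession :: "(real^'d^'q \<Rightarrow> real) \<Rightarrow> real^'d^'q \<Rightarrow> ennreal" where
  "recession W v = (THE l. ((\<lambda>t. ennreal (W (t *\<^sub>R v) / t)) \<longlongrightarrow> l) at_top)"

definition legendre :: "(real^'d^'q \<Rightarrow> real) \<Rightarrow> real^'d^'q \<Rightarrow> ereal" where
  "legendre W r = (SUP v. ereal (r \<bullet> v - W v))"

definition ereal_integral :: "'a measure \<Rightarrow> ('a \<Rightarrow> ereal) \<Rightarrow> ereal" where
  "ereal_integral M f = enn2ereal (\<integral>\<^sup>+ x. e2ennreal (f x) \<partial>M)
                          - enn2ereal (\<integral>\<^sup>+ x. e2ennreal (- f x) \<partial>M)"

type_synonym ('d,'q) pt = "(real^'d) \<times> (real^'q)"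

definition div_x :: "(('d::finite,'q::finite) pt \<Rightarrow> real^'d) \<Rightarrow> ('d,'q) pt \<Rightarrow> real" where
  "div_x \<phi> z = (\<Sum>j\<in>UNIV. (frechet_derivative \<phi> (at z) (axis j 1, 0)) $ j)"

definition grad_y :: "(('d::finite,'q::finite) pt \<Rightarrow> real^'d) \<Rightarrow> ('d,'q) pt \<Rightarrow> real^'d^'q" where
  "grad_y \<phi> z = (\<chi> i j. (frechet_derivative \<phi> (at z) (0, axis i 1)) $ j)"

definition csupport :: "('a::topological_space \<Rightarrow> 'b::zero) \<Rightarrow> 'a set" where
  "csupport f = closure {z. f z \<noteq> 0}"

definition C1c :: "('a::euclidean_space) set \<Rightarrow> ('a \<Rightarrow> 'b::euclidean_space) \<Rightarrow> bool" where
  "C1c U f \<longleftrightarrow> (\<forall>z. f differentiable at z) \<and>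
     (\<forall>v. continuous_on UNIV (\<lambda>z. frechet_derivative f (at z) v)) \<and>
     compact (csupport f) \<and> csupport f \<subseteq> U"

primrec iter_deriv :: "('a::real_normed_vector \<Rightarrow> 'b::real_normed_vector) \<Rightarrow> 'a list \<Rightarrow> 'a \<Rightarrow> 'b" where
  "iter_deriv f [] = f"
| "iter_deriv f (v # vs) = (\<lambda>z. frechet_derivative (iter_deriv f vs) (at z) v)"

definition Cinf_c :: "('a::euclidean_space) set \<Rightarrow> ('a \<Rightarrow> 'b::euclidean_space) \<Rightarrow> bool" where
  "Cinf_c U f \<longleftrightarrow> (\<forall>vs z. iter_deriv f vs differentiable at z) \<and>
     compact (csupport f) \<and> csupport f \<subseteq> U"

text \<open>mu in M_{pi_1 -> m}(Omega x R^q): finite Borel measure on the product space,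
  concentrated on Omega x R^q, whose first marginal is Lebesgue measure on Omega.\<close>
definition marginal_measures :: "(real^'d) set \<Rightarrow> (('d::finite,'q::finite) pt) measure set" where
  "marginal_measures \<Omega> = {\<mu>. sets \<mu> = sets borel \<and> finite_measure \<mu> \<and>
       (\<forall>A\<in>sets borel. emeasure \<mu> (A \<times> UNIV) = emeasure lborel (A \<inter> \<Omega>))}"

text \<open>A matrix-valued finite measure J on Omega x R^q, given through its
  Radon-Nikodym decomposition with respect to mu and the polar decomposition of
  its singular part: J = v mu + J_perp, J_perp = h |J_perp|, with nu = |J_perp|
  singular to mu and |h| = 1 nu-a.e.  Such a triple (v, nu, h) corresponds to
  exactly one J and conversely.\<close>
definition decomp_ok :: "(real^'d) set \<Rightarrow> (('d::finite,'q::finite) pt) measure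
     \<Rightarrow> (('d,'q) pt \<Rightarrow> real^'d^'q) \<Rightarrow> (('d,'q) pt) measure \<Rightarrow> (('d,'q) pt \<Rightarrow> real^'d^'q) \<Rightarrow> bool" where
  "decomp_ok \<Omega> \<mu> v \<nu> h \<longleftrightarrow> integrable \<mu> v \<and>
     sets \<nu> = sets borel \<and> finite_measure \<nu> \<and> emeasure \<nu> (UNIV - \<Omega> \<times> UNIV) = 0 \<and>
     (\<exists>N\<in>sets borel. emeasure \<mu> N = 0 \<and> emeasure \<nu> (UNIV - N) = 0) \<and>
     h \<in> borel_measurable borel \<and> (AE z in \<nu>. norm (h z) = 1)"

definition BW :: "(real^'d^'q \<Rightarrow> real) \<Rightarrow> (('d::finite,'q::finite) pt) measure
     \<Rightarrow> (('d,'q) pt \<Rightarrow> real^'d^'q) \<Rightarrow> (('d,'q) pt) measure \<Rightarrow> (('d,'q) pt \<Rightarrow> real^'d^'q) \<Rightarrow> ennreal" where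
  "BW W \<mu> v \<nu> h = (\<integral>\<^sup>+ z. ennreal (W (v z)) \<partial>\<mu>) + (\<integral>\<^sup>+ z. recession W (h z) \<partial>\<nu>)"

text \<open>The distributional equation  grad_x mu + div_y J = 0  on Omega x R^q.\<close>
definition continuity_eq :: "(real^'d) set \<Rightarrow> (('d::finite,'q::finite) pt) measure
     \<Rightarrow> (('d,'q) pt \<Rightarrow> real^'d^'q) \<Rightarrow> (('d,'q) pt) measure \<Rightarrow> (('d,'q) pt \<Rightarrow> real^'d^'q) \<Rightarrow> bool" where
  "continuity_eq \<Omega> \<mu> v \<nu> h \<longleftrightarrow> (\<forall>\<phi>. Cinf_c (\<Omega> \<times> UNIV) \<phi> \<longrightarrow>
      (\<integral>z. div_x \<phi> z \<partial>\<mu>) + (\<integral>z. grad_y \<phi> z \<bullet> v z \<partial>\<mu>) + (\<integral>z. grad_y \<phi> z \<bullet> h z \<partial>\<nu>) = 0)"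

definition T_Eul :: "(real^'d^'q \<Rightarrow> real) \<Rightarrow> (real^'d) set \<Rightarrow> (('d::finite,'q::finite) pt) measure \<Rightarrow> ennreal" where
  "T_Eul W \<Omega> \<mu> = (INF (v, \<nu>, h) \<in> {(v, \<nu>, h). decomp_ok \<Omega> \<mu> v \<nu> h \<and> continuity_eq \<Omega> \<mu> v \<nu> h}.
                     BW W \<mu> v \<nu> h)"

definition dual_admissible :: "(real^'d^'q \<Rightarrow> real) \<Rightarrow> (real^'d) set \<Rightarrow> (('d::finite,'q::finite) pt \<Rightarrow> real^'d) set" where
  "dual_admissible W \<Omega> = {\<phi>. C1c (\<Omega> \<times> UNIV) \<phi> \<and> (\<forall>z\<in>\<Omega> \<times> UNIV. legendre W (grad_y \<phi> z) < \<infinity>)}"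

definition dual_value :: "(real^'d^'q \<Rightarrow> real) \<Rightarrow> (real^'d) set \<Rightarrow> (('d::finite,'q::finite) pt) measure \<Rightarrow> ereal" where
  "dual_value W \<Omega> \<mu> = (SUP \<phi>\<in>dual_admissible W \<Omega>.
       - ereal_integral \<mu> (\<lambda>z. ereal (div_x \<phi> z) + legendre W (grad_y \<phi> z)))"

end

theory Submission
  imports Defs
begin

text \<open>
  Let \<open>Aff\<close> be the epigraph of the Legendre transform of \<open>W\<close>, i.e. the set of pairs \<open>(r, c)\<close> with
  \<open>r \<bullet> v - c \<le> W v\<close> for all \<open>v\<close>. Weak duality is the Fenchel inequality tested against the continuity
  equation, which extends from smooth to continuously differentiable test fields by mollification.

  For the converse, let \<open>D\<close> be a real upper bound of the dual values. The set of all pairs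
  \<open>(\<psi> + grad_y \<phi>, \<integral> c d\<mu> + D - \<integral> div_x \<phi> d\<mu>)\<close> with \<open>(\<psi> z, c z) \<in> Aff\<close> pointwise is convex, absorbing
  because \<open>W\<close> grows at least linearly, and lies in the upper half space over \<open>0\<close> by the choice of \<open>D\<close>.
  Hahn-Banach yields a bounded linear functional \<open>L\<close> on bounded continuous matrix fields with
  \<open>L (grad_y \<phi>) = - \<integral> div_x \<phi> d\<mu>\<close> and \<open>L \<psi> \<le> \<integral> c d\<mu> + D\<close>. By the Riesz representation theorem \<open>L\<close> is
  integration against \<open>H \<tau>\<close>, where \<open>\<tau>\<close> may be chosen with \<open>\<mu> = k \<tau>\<close>. Since \<open>W\<close> is the supremum of its
  affine minorants, and its recession function the supremum of their linear parts, testing \<open>L\<close> with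
  continuous approximations of step fields with values in a countable dense subset of \<open>Aff\<close> bounds the
  integral of the perspective function \<open>k W (H / k)\<close>, which is the cost of the flux \<open>H \<tau>\<close>, by \<open>D\<close>.
\<close>

section \<open>Linear minorants of convex sets\<close>

text \<open>When the dual value is finite, the separating functional itself becomes an optimal flux,
  so no compactness of minimising sequences enters. It lives on all bounded continuous fields
  because there a whole sup-norm ball of fields admits the same constant \<open>c\<close>,
  integrable since \<open>\<mu>\<close> is finite; this makes the separated set absorbing. Such a
  functional may also charge infinity or the boundary, but every field on which it is evaluated in
  the end has compact support in \<open>\<Omega> \<times> UNIV\<close>, and there it is a measure.
  The obstacle is that the cost has two integrands, one for the absolutely continuous and one for
  the singular part. Over a common dominating measure both become the supremum of
  \<open>r \<bullet> H - k * c\<close> over pairs \<open>(r, c)\<close>: for \<open>k > 0\<close>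
  this is the perspective of \<open>W\<close>, for \<open>k = 0\<close> the recession function.
  Fields built from finitely many pairs must stay compactly supported, so their weights cannot sum
  to 1 everywhere. Here \<open>W \<ge> 0\<close> helps: it puts \<open>(0, 0)\<close> into the
  epigraph, and this pair takes up the missing weight.\<close>

definition sublinear :: "('a::real_vector \<Rightarrow> real) \<Rightarrow> bool" where
  "sublinear p \<longleftrightarrow> (\<forall>x y. p (x + y) \<le> p x + p y) \<and> (\<forall>c>0. \<forall>x. p (c *\<^sub>R x) = c * p x)"

text \<open>The assumed inequality with factor \<open>1/c\<close> at the point
  \<open>c *\<^sub>R x\<close> is the reverse inequality for \<open>c\<close> at
  \<open>x\<close>.\<close>

lemma sublinearI:
  assumes "\<And>x y. p (x + y) \<le> p x + p y" and le: "\<And>c x. 0 < c \<Longrightarrow> p (c *\<^sub>R x) \<le> c * p x"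
  shows "sublinear p"
proof -
  have "c * p x \<le> p (c *\<^sub>R x)" if "0 < c" for c x
    using le[of "1/c" "c *\<^sub>R x"] that by (simp add: field_simps)
  with assms show ?thesis
    unfolding sublinear_def by (meson antisym)
qed

lemma sublinear_add: "sublinear p \<Longrightarrow> p (x + y) \<le> p x + p y"
  and sublinear_scale: "sublinear p \<Longrightarrow> 0 < c \<Longrightarrow> p (c *\<^sub>R x) = c * p x"
  by (auto simp: sublinear_def)

lemma sublinear_0: "sublinear p \<Longrightarrow> p 0 = 0"
  using sublinear_scale[of p 2 0] by simp

lemma sublinear_minus: "sublinear p \<Longrightarrow> - p (- x) \<le> p x"
  using sublinear_add[of p x "- x"] sublinear_0[of p] by simp

text \<open>Hahn-Banach without partial functionals: a pointwise minimal sublinear functional is linear.\<close>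

lemma linear_minorant_sublinear:
  fixes p :: "'a::real_vector \<Rightarrow> real"
  assumes p: "sublinear p"
  shows "\<exists>L. linear L \<and> (\<forall>x. L x \<le> p x)"
proof -
  define A where "A = {q. sublinear q \<and> q \<le> p}"
  define P where "P = (\<lambda>a b :: 'a \<Rightarrow> real. b \<le> a)"
  \<comment> \<open>This common lower bound keeps the pointwise infimum over a chain finite.\<close>
  have low: "- p (- x) \<le> q x" if "q \<in> A" for q x
    using sublinear_minus[of q x] that le_funD[of q p "- x"] unfolding A_def by fastforce
  have "\<exists>m\<in>A. \<forall>a\<in>A. P m a \<longrightarrow> a = m"
  proof (rule predicate_Zorn)
    show "partial_order_on A (relation_of P A)"
      by (auto simp: partial_order_on_def preorder_on_def refl_on_def trans_def antisym_def
          relation_of_def P_def intro: order_trans)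
  next
    fix C assume C: "C \<in> Chains (relation_of P A)"
    then have tot: "a \<le> b \<or> b \<le> a" if "a \<in> C" "b \<in> C" for a b
      using that by (auto simp: Chains_def relation_of_def P_def)
    have CA: "C \<subseteq> A"
      using C by (auto simp: Chains_def relation_of_def P_def)
    show "\<exists>u\<in>A. \<forall>a\<in>C. P a u"
    proof (cases "C = {}")
      case True
      then show ?thesis using p by (auto simp: A_def)
    next
      case False
      define u where "u x = (INF q\<in>C. q x)" for x
      have bdd: "bdd_below ((\<lambda>q. q x) ` C)" for x
        using low CA by (intro bdd_belowI[of _ "- p (- x)"]) auto
      have ule: "u x \<le> q x" if "q \<in> C" for q x
        unfolding u_def by (rule cINF_lower[OF bdd that])
      have "u (x + y) \<le> u x + u y" for x y
      proof -
        \<comment> \<open>A chain has one member \<open>q\<close> below both \<open>a\<close> and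
          \<open>b\<close>; subadditivity of that single \<open>q\<close> lets the two infima be
          taken independently.\<close>
        have *: "u (x + y) \<le> a x + b y" if ab: "a \<in> C" "b \<in> C" for a b
        proof -
          obtain q where q: "q \<in> C" "q \<le> a" "q \<le> b"
            using tot[OF ab] ab by blast
          then have "sublinear q" using CA by (auto simp: A_def)
          then have "u (x + y) \<le> q x + q y"
            using ule[OF q(1), of "x + y"] sublinear_add[of q x y] by linarith
          then show ?thesis
            using le_funD[OF q(2), of x] le_funD[OF q(3), of y] by linarith
        qed
        have "u (x + y) - a x \<le> u y" if "a \<in> C" for a
          unfolding u_def[of y] using *[OF that] False by (intro cINF_greatest) (auto simp: algebra_simps)
        then have "u (x + y) - u y \<le> u x"
          unfolding u_def[of x] using False by (intro cINF_greatest) (auto simp: algebra_simps)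
        then show ?thesis by simp
      qed
      moreover have "u (c *\<^sub>R x) \<le> c * u x" if c: "0 < c" for c x
      proof -
        have "u (c *\<^sub>R x) / c \<le> q x" if "q \<in> C" for q
        proof -
          have "sublinear q" using CA that by (auto simp: A_def)
          then show ?thesis
            using ule[OF that, of "c *\<^sub>R x"] c by (simp add: sublinear_scale field_simps)
        qed
        then have "u (c *\<^sub>R x) / c \<le> u x"
          unfolding u_def[of x] using False by (intro cINF_greatest) auto
        then show ?thesis using c by (simp add: field_simps)
      qed
      ultimately have "sublinear u" by (rule sublinearI)
      moreover have "u \<le> p"
      proof -
        obtain q where "q \<in> C" using False by blast
        then have "u \<le> q" "q \<le> p" using ule CA by (auto simp: A_def le_fun_def)
        then show ?thesis by (rule order_trans)
      qed
      ultimately have "u \<in> A" by (simp add: A_def)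
      with ule show ?thesis by (auto simp: P_def le_fun_def)
    qed
  qed
  then obtain q where qA: "q \<in> A" and qmin: "\<And>a. a \<in> A \<Longrightarrow> a \<le> q \<Longrightarrow> a = q"
    by (auto simp: P_def)
  then have q: "sublinear q" by (simp add: A_def)
  \<comment> \<open>For fixed \<open>y\<close> the sublinear functional \<open>inf t\<ge>0. q (x + t y) - t q y\<close> lies below \<open>q\<close>, hence equals it.\<close>
  have super: "q x + q y \<le> q (x + y)" for x y
  proof -
    define r where "r x = (INF t\<in>{0..}. q (x + t *\<^sub>R y) - t * q y)" for x
    have qt: "q (t *\<^sub>R y) = t * q y" if "0 \<le> t" for t
      using that sublinear_scale[OF q, of t y] sublinear_0[OF q] by (cases "t = 0") auto
    have bdd: "bdd_below ((\<lambda>t. q (x + t *\<^sub>R y) - t * q y) ` {0..})" for x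
    proof (rule bdd_belowI[of _ "- q (- x)"])
      fix z assume "z \<in> (\<lambda>t. q (x + t *\<^sub>R y) - t * q y) ` {0..}"
      then obtain t where "0 \<le> t" "z = q (x + t *\<^sub>R y) - t * q y" by auto
      then show "- q (- x) \<le> z"
        using sublinear_add[OF q, of "x + t *\<^sub>R y" "- x"] qt[of t] by simp
    qed
    have rle: "r x \<le> q (x + t *\<^sub>R y) - t * q y" if "0 \<le> t" for x t
      unfolding r_def by (rule cINF_lower[OF bdd]) (use that in auto)
    have "r (x + z) \<le> r x + r z" for x z
    proof -
      have *: "r (x + z) \<le> (q (x + s *\<^sub>R y) - s * q y) + (q (z + t *\<^sub>R y) - t * q y)"
        if "0 \<le> s" "0 \<le> t" for s t
        using rle[of "s + t" "x + z"] that sublinear_add[OF q, of "x + s *\<^sub>R y" "z + t *\<^sub>R y"]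
        by (simp add: algebra_simps)
      have "r (x + z) - (q (x + s *\<^sub>R y) - s * q y) \<le> r z" if "0 \<le> s" for s
        unfolding r_def[of z]
      proof (intro cINF_greatest)
        fix t :: real assume "t \<in> {0..}"
        then show "r (x + z) - (q (x + s *\<^sub>R y) - s * q y) \<le> q (z + t *\<^sub>R y) - t * q y"
          using *[of s t] that by simp
      qed simp
      then have "r (x + z) - r z \<le> r x"
        unfolding r_def[of x] by (intro cINF_greatest) (auto simp: algebra_simps)
      then show ?thesis by simp
    qed
    moreover have "r (c *\<^sub>R x) \<le> c * r x" if c: "0 < c" for c x
    proof -
      have "r (c *\<^sub>R x) / c \<le> r x"
        unfolding r_def[of x]
      proof (intro cINF_greatest)
        fix t :: real assume "t \<in> {0..}"
        then show "r (c *\<^sub>R x) / c \<le> q (x + t *\<^sub>R y) - t * q y"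
          using rle[of "c * t" "c *\<^sub>R x"] sublinear_scale[OF q c, of "x + t *\<^sub>R y"] c
          by (simp add: field_simps)
      qed simp
      then show ?thesis using c by (simp add: field_simps)
    qed
    ultimately have "sublinear r" by (rule sublinearI)
    moreover have rq: "r \<le> q" using rle[of 0] by (auto simp: le_fun_def)
    moreover have "q \<le> p" using qA by (simp add: A_def)
    ultimately have "r = q" using qmin[of r] by (auto simp: A_def)
    \<comment> \<open>With \<open>r = q\<close>, the term \<open>t = 1\<close> of the infimum reads
      \<open>q x \<le> q (x + y) - q y\<close>.\<close>
    then show ?thesis using rle[of 1 x] by simp
  qed
  have add: "q (x + y) = q x + q y" for x y
    using super[of x y] sublinear_add[OF q, of x y] by linarith
  have neg: "q (- x) = - q x" for x
    using add[of x "- x"] sublinear_0[OF q] by simp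
  have "q (c *\<^sub>R x) = c * q x" for c x
  proof (cases c "0::real" rule: linorder_cases)
    case less
    then show ?thesis using sublinear_scale[OF q, of "- c" x] neg[of "c *\<^sub>R x"] by simp
  qed (use sublinear_scale[OF q] sublinear_0[OF q] in auto)
  with add have "linear q" by (auto intro!: linearI)
  with qA show ?thesis by (auto simp: A_def le_fun_def)
qed

text \<open>The gauge-like functional \<open>p x\<close>, the infimum of \<open>a / t\<close> over
  points \<open>(t *\<^sub>R x, a)\<close> of \<open>C\<close> with \<open>t > 0\<close>, is
  sublinear, and a linear functional below it lies below \<open>C\<close> (take
  \<open>t = 1\<close>). Absorption makes the infimum range over a nonempty set, and the hypothesis
  over 0 bounds it from below.\<close>

lemma linear_minorant_convex_set:
  fixes C :: "('a::real_vector \<times> real) set"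
  assumes "convex C"
    and absorb: "\<And>x. \<exists>t>0. \<exists>a. (t *\<^sub>R x, a) \<in> C"
    and nonneg: "\<And>a. (0, a) \<in> C \<Longrightarrow> 0 \<le> a"
  shows "\<exists>L. linear L \<and> (\<forall>(x, a)\<in>C. L x \<le> a)"
proof -
  define S where "S x = {a / t |a t. t > 0 \<and> (t *\<^sub>R x, a) \<in> C}" for x
  define p where "p x = Inf (S x)" for x
  \<comment> \<open>The weights \<open>s / (s + t)\<close> and \<open>t / (s + t)\<close> bring
    \<open>t *\<^sub>R x\<close> and \<open>s *\<^sub>R y\<close> to the same multiple of
    \<open>x\<close> and \<open>y\<close>.\<close>
  have comb: "((s * t / (s + t)) *\<^sub>R (x + y), (s * a + t * b) / (s + t)) \<in> C"
    if "t > 0" "(t *\<^sub>R x, a) \<in> C" "s > 0" "(s *\<^sub>R y, b) \<in> C" for s t x y a b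
  proof -
    have "(s / (s + t)) *\<^sub>R (t *\<^sub>R x, a) + (t / (s + t)) *\<^sub>R (s *\<^sub>R y, b) \<in> C"
      using that by (intro convexD[OF \<open>convex C\<close>]) (auto simp: add_divide_distrib[symmetric])
    moreover have "(s / (s + t)) *\<^sub>R (t *\<^sub>R x, a) + (t / (s + t)) *\<^sub>R (s *\<^sub>R y, b)
        = ((s * t / (s + t)) *\<^sub>R (x + y), (s * a + t * b) / (s + t))"
      by (simp add: scaleR_add_right add_divide_distrib mult.commute)
    ultimately show ?thesis by simp
  qed
  have ne: "S x \<noteq> {}" for x
    using absorb[of x] by (auto simp: S_def)
  have bdd: "bdd_below (S x)" for x
  proof -
    \<comment> \<open>A point over a positive multiple of \<open>- x\<close> combines with any point
      over a positive multiple of \<open>x\<close> to a point over 0, whose height is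
      nonnegative.\<close>
    obtain s b where sb: "s > 0" "(s *\<^sub>R (- x), b) \<in> C" using absorb by blast
    have "- b / s \<le> a / t" if "t > 0" "(t *\<^sub>R x, a) \<in> C" for a t
    proof -
      have "(0, (s * a + t * b) / (s + t)) \<in> C"
        using comb[OF that sb] by simp
      then have "0 \<le> (s * a + t * b) / (s + t)" by (rule nonneg)
      then show ?thesis using sb(1) that(1) by (simp add: field_simps zero_le_divide_iff)
    qed
    then show ?thesis by (intro bdd_belowI[of _ "- b / s"]) (auto simp: S_def)
  qed
  have ple: "p x \<le> a / t" if "t > 0" "(t *\<^sub>R x, a) \<in> C" for x a t
    unfolding p_def using that by (intro cInf_lower[OF _ bdd]) (auto simp: S_def)
  have pge: "m \<le> p x" if "\<And>a t. t > 0 \<Longrightarrow> (t *\<^sub>R x, a) \<in> C \<Longrightarrow> m \<le> a / t" for x m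
    unfolding p_def using that by (intro cInf_greatest[OF ne]) (auto simp: S_def)
  have "sublinear p"
  proof (rule sublinearI)
    fix x y
    have *: "p (x + y) \<le> a / t + b / s"
      if h: "t > 0" "(t *\<^sub>R x, a) \<in> C" "s > 0" "(s *\<^sub>R y, b) \<in> C" for s t a b
    proof -
      have "p (x + y) \<le> ((s * a + t * b) / (s + t)) / (s * t / (s + t))"
        using h by (intro ple[OF _ comb[OF h]]) auto
      also have "\<dots> = (s * a + t * b) / (s * t)"
        using h by simp
      also have "\<dots> = a / t + b / s"
        using h by (simp add: add_divide_distrib)
      finally show ?thesis .
    qed
    have "p (x + y) - a / t \<le> p y" if "t > 0" "(t *\<^sub>R x, a) \<in> C" for a t
      using *[OF that] by (intro pge) (simp add: algebra_simps)
    then have "p (x + y) - p y \<le> p x"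
      by (intro pge) (simp add: algebra_simps)
    then show "p (x + y) \<le> p x + p y" by simp
  next
    fix c :: real and x assume c: "0 < c"
    have "p (c *\<^sub>R x) / c \<le> p x"
    proof (rule pge)
      fix a t :: real assume "t > 0" "(t *\<^sub>R x, a) \<in> C"
      then show "p (c *\<^sub>R x) / c \<le> a / t"
        using ple[of "t / c" "c *\<^sub>R x" a] c by (simp add: field_simps)
    qed
    then show "p (c *\<^sub>R x) \<le> c * p x" using c by (simp add: field_simps)
  qed
  from linear_minorant_sublinear[OF this] obtain L where "linear L" "\<And>x. L x \<le> p x" by blast
  moreover have "p x \<le> a" if "(x, a) \<in> C" for x a
    using ple[of 1 x a] that by simp
  ultimately show ?thesis
    by (intro exI[of _ L]) (auto intro: order_trans)
qed

section \<open>Riesz representation\<close>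

definition Cc :: "'a::euclidean_space set \<Rightarrow> ('a \<Rightarrow> 'b::real_normed_vector) set" where
  "Cc U = {f. continuous_on UNIV f \<and> compact (csupport f) \<and> csupport f \<subseteq> U}"

lemma zero_outside_csupport: "z \<notin> csupport f \<Longrightarrow> f z = 0"
  using closure_subset[of "{z. f z \<noteq> 0}"] by (auto simp: csupport_def)

lemma compact_csupportI:
  fixes f :: "'a::t2_space \<Rightarrow> 'b::zero"
  assumes "compact K" "K \<subseteq> U" "\<And>z. z \<notin> K \<Longrightarrow> f z = 0"
  shows "compact (csupport f)" "csupport f \<subseteq> U"
proof -
  have "csupport f \<subseteq> K"
    unfolding csupport_def using assms by (intro closure_minimal) (auto simp: compact_imp_closed)
  moreover have "closed (csupport f)" by (simp add: csupport_def)
  ultimately show "compact (csupport f)" "csupport f \<subseteq> U"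
    using assms compact_Int_closed[of K "csupport f"] by (auto simp: Int_absorb1)
qed

lemma CcI:
  assumes "continuous_on UNIV f" "compact K" "K \<subseteq> U" "\<And>z. z \<notin> K \<Longrightarrow> f z = 0"
  shows "f \<in> Cc U"
  using assms compact_csupportI[of K U f] by (auto simp: Cc_def)

lemma CcD: "f \<in> Cc U \<Longrightarrow> continuous_on UNIV f" "f \<in> Cc U \<Longrightarrow> compact (csupport f)"
  "f \<in> Cc U \<Longrightarrow> csupport f \<subseteq> U"
  by (auto simp: Cc_def)

lemma Cc_zero: "(\<lambda>x. 0) \<in> Cc U"
  by (rule CcI[of _ "{}"]) auto

text \<open>The union of the two supports is a compact set outside which \<open>h\<close> vanishes;
  sums, lattice operations and multiples are all instances.\<close>

lemma Cc_combine:
  assumes "f \<in> Cc U" "g \<in> Cc U" "continuous_on UNIV h" "\<And>z. f z = 0 \<Longrightarrow> g z = 0 \<Longrightarrow> h z = 0"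
  shows "h \<in> Cc U"
  using assms by (intro CcI[of _ "csupport f \<union> csupport g"])
    (auto simp: Cc_def zero_outside_csupport)

lemma Cc_compose:
  assumes "f \<in> Cc U" "continuous_on UNIV h" "\<And>z. f z = 0 \<Longrightarrow> h z = 0"
  shows "h \<in> Cc U"
  using Cc_combine[OF assms(1) assms(1)] assms by blast

lemma
  fixes f g :: "'a::euclidean_space \<Rightarrow> real"
  assumes f: "f \<in> Cc U" and g: "g \<in> Cc U"
  shows Cc_add: "(\<lambda>x. f x + g x) \<in> Cc U"
    and Cc_diff: "(\<lambda>x. f x - g x) \<in> Cc U"
    and Cc_min: "(\<lambda>x. min (f x) (g x)) \<in> Cc U"
    and Cc_max: "(\<lambda>x. max (f x) (g x)) \<in> Cc U"
    and Cc_scale: "(\<lambda>x. c * f x) \<in> Cc U"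
  by (rule Cc_combine[OF f g]; (intro continuous_intros CcD(1)[OF f] CcD(1)[OF g])?; simp)+

lemma Cc_sum:
  fixes f :: "'i \<Rightarrow> 'a::euclidean_space \<Rightarrow> real"
  assumes "\<And>i. i \<in> I \<Longrightarrow> f i \<in> Cc U"
  shows "(\<lambda>x. \<Sum>i\<in>I. f i x) \<in> Cc U"
  using assms by (induction I rule: infinite_finite_induct) (auto intro: Cc_add Cc_zero)

lemma bounded_range_Cc:
  assumes "f \<in> Cc U"
  shows "bounded (range f)"
proof -
  have "bounded (f ` csupport f)"
    using assms by (intro compact_imp_bounded compact_continuous_image)
      (auto simp: Cc_def intro: continuous_on_subset)
  then have "bounded (insert 0 (f ` csupport f))" by simp
  then show ?thesis
    by (rule bounded_subset) (use zero_outside_csupport in fastforce)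
qed

lemma Cc_bcontfun: "f \<in> Cc U \<Longrightarrow> f \<in> bcontfun"
  using bounded_range_Cc[of f U] by (auto simp: bcontfun_def Cc_def)

lemma integrable_bcontfun:
  fixes f :: "'a::euclidean_space \<Rightarrow> 'b::euclidean_space"
  assumes "f \<in> bcontfun" "finite_measure M" "sets M = sets borel"
  shows "integrable M f"
proof -
  interpret finite_measure M by fact
  obtain B where "\<And>x. norm (f x) \<le> B"
    using assms(1) by (auto simp: bcontfun_def bounded_iff)
  moreover have "f \<in> borel_measurable M"
    using assms(1) borel_measurable_continuous_onI[of f] measurable_cong_sets[OF assms(3) refl, of borel]
    by (auto simp: bcontfun_def)
  ultimately show ?thesis by (intro integrable_const_bound[of f B]) auto
qed

lemma integrable_Cc:
  fixes f :: "'a::euclidean_space \<Rightarrow> 'b::euclidean_space"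
  assumes "f \<in> Cc U" "finite_measure M" "sets M = sets borel"
  shows "integrable M f"
  using integrable_bcontfun[OF Cc_bcontfun[OF assms(1)] assms(2,3)] .

text \<open>The functions are cut-offs of the distance to the complement and of the norm:
  \<open>f n\<close> vanishes unless \<open>x\<close> has distance at least
  \<open>1 / (n + 1)\<close> from the complement and norm at most \<open>n + 1\<close>. The value 1
  is attained at a finite index, not only in the limit, so that half-open regions under the
  functions exhaust a slab.\<close>

lemma Cc_approx_open:
  fixes V :: "'a::euclidean_space set"
  assumes "open V"
  obtains f :: "nat \<Rightarrow> 'a \<Rightarrow> real" where "\<And>n. f n \<in> Cc V" "\<And>n x. 0 \<le> f n x" "\<And>n x. f n x \<le> 1"
    "\<And>m n x. m \<le> n \<Longrightarrow> f m x \<le> f n x" "\<And>x. x \<in> V \<Longrightarrow> \<exists>n. f n x = 1"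
proof -
  \<comment> \<open>\<open>infdist\<close> to the empty set is 0 by convention, so the whole space
    is given the constant distance 1.\<close>
  define d where "d x = (if V = UNIV then 1 else infdist x (- V))" for x
  have d0: "0 \<le> d x" for x by (simp add: d_def infdist_nonneg)
  have cd: "continuous_on UNIV d"
    unfolding d_def by (cases "V = UNIV") (auto intro!: continuous_intros)
  have dV: "x \<in> V" if "0 < d x" for x
    using that by (cases "V = UNIV") (auto simp: d_def split: if_splits)
  have Vd: "0 < d x" if "x \<in> V" for x
  proof (cases "V = UNIV")
    case False
    then have "infdist x (- V) \<noteq> 0"
      using in_closed_iff_infdist_zero[of "- V" x] that assms by auto
    then show ?thesis using False by (simp add: d_def infdist_nonneg less_le)
  qed (simp add: d_def)
  define f where "f n x = max 0 (min 1 (min (real (Suc n) * d x - 1) (real (Suc n) - norm x)))" for n x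
  show thesis
  proof (rule that)
    show "f n \<in> Cc V" for n
    proof (rule CcI)
      show "continuous_on UNIV (f n)"
        unfolding f_def by (intro continuous_intros cd)
      show "compact ({x. 1 \<le> real (Suc n) * d x} \<inter> cball 0 (real (Suc n)))"
        by (intro closed_Int_compact closed_Collect_le continuous_intros cd) auto
      have "0 < d x" if "1 \<le> real (Suc n) * d x" for x
        using that d0[of x] by (cases "d x = 0") auto
      then show "{x. 1 \<le> real (Suc n) * d x} \<inter> cball 0 (real (Suc n)) \<subseteq> V"
        using dV by blast
    qed (auto simp: f_def max_def min_def split: if_splits)
    show "f m x \<le> f n x" if "m \<le> n" for m n x
    proof -
      have "real (Suc m) * d x \<le> real (Suc n) * d x"
        using that d0 by (intro mult_right_mono) auto
      then show ?thesis
        unfolding f_def using that by (intro max.mono min.mono) auto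
    qed
    show "\<exists>n. f n x = 1" if "x \<in> V" for x
    proof -
      obtain n where n: "max (2 / d x) (norm x + 1) \<le> real n"
        using real_arch_simple by blast
      then have "2 / d x \<le> real (Suc n)" by simp
      then have "2 \<le> real (Suc n) * d x" using Vd[OF that] by (simp add: pos_divide_le_eq)
      then show ?thesis using n by (intro exI[of _ n]) (auto simp: f_def)
    qed
  qed (auto simp: f_def)
qed

text \<open>Dini's theorem. The support of \<open>R 0\<close> is the compact set on which it is
  applied, since every later \<open>R n\<close> lies between 0 and \<open>R 0\<close>.\<close>

lemma decseq_Cc_uniform:
  fixes R :: "nat \<Rightarrow> 'a::euclidean_space \<Rightarrow> real"
  assumes R: "\<And>n. R n \<in> Cc U" and nonneg: "\<And>n x. 0 \<le> R n x"
    and dec: "\<And>m n x. m \<le> n \<Longrightarrow> R n x \<le> R m x"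
    and lim: "\<And>x. (\<lambda>n. R n x) \<longlonglongrightarrow> 0" and e: "0 < e"
  shows "\<exists>N. \<forall>n\<ge>N. \<forall>x. R n x \<le> e"
proof -
  let ?K = "csupport (R 0)"
  have "?K \<subseteq> (\<Union>n. {x. R n x < e})"
  proof
    fix x
    have "\<forall>\<^sub>F n in sequentially. R n x < e" using order_tendstoD(2)[OF lim e] .
    then show "x \<in> (\<Union>n. {x. R n x < e})" by (auto simp: eventually_sequentially)
  qed
  moreover have "open {x. R n x < e}" for n
    using CcD(1)[OF R] by (intro open_Collect_less) auto
  ultimately obtain J where J: "finite J" "?K \<subseteq> (\<Union>n\<in>J. {x. R n x < e})"
    using CcD(2)[OF R[of 0]] compactE_image[of ?K UNIV "\<lambda>n. {x. R n x < e}"] by metis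
  obtain N where N: "\<And>n. n \<in> J \<Longrightarrow> n \<le> N" using J(1) by (metis finite_nat_set_iff_bounded_le)
  have "R n x \<le> e" if "n \<ge> N" for n x
  proof (cases "x \<in> ?K")
    case True
    then obtain j where "j \<in> J" "R j x < e" using J by auto
    then show ?thesis using dec[of j n x] N[of j] that by fastforce
  next
    case False
    then show ?thesis using dec[of 0 n x] zero_outside_csupport[OF False] e by simp
  qed
  then show ?thesis by blast
qed

text \<open>Countable additivity of Lebesgue measure on a single vertical line, the source of
  countable additivity for graph regions. Empty intervals, with \<open>a n = b n\<close>, are
  allowed because graph regions may have empty slices.\<close>

lemma sums_length_half_open:
  fixes a b :: "nat \<Rightarrow> real"
  assumes "\<And>n. a n \<le> b n" "c \<le> d" "disjoint_family (\<lambda>n. {a n..<b n})" "(\<Union>n. {a n..<b n}) = {c..<d}"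
  shows "(\<lambda>n. b n - a n) sums (d - c)"
proof -
  have "range (\<lambda>n. {a n..<b n}) \<subseteq> sets lborel" by auto
  from suminf_emeasure[OF this assms(3)]
  have "(\<Sum>n. emeasure lborel {a n..<b n}) = emeasure lborel {c..<d}"
    by (simp only: assms(4))
  then have "(\<Sum>n. ennreal (b n - a n)) = ennreal (d - c)"
    using assms(1,2) by simp
  then have "(\<lambda>n. ennreal (b n - a n)) sums ennreal (d - c)"
    by (metis summableI summable_sums)
  then show ?thesis using assms by (subst (asm) sums_ennreal) auto
qed

text \<open>Kindler's proof: \<open>I (g - f)\<close> is a premeasure on the half-open graph regions
  \<open>{(x, t). f x \<le> t < g x}\<close>, which form a semiring; countable additivity is Dini's theorem. The
  extension is a product with Lebesgue measure, and its first factor represents \<open>I\<close>.\<close>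

lemma riesz_positive:
  fixes I :: "('a::euclidean_space \<Rightarrow> real) \<Rightarrow> real"
  assumes U: "open U"
    and add: "\<And>f g. f \<in> Cc U \<Longrightarrow> g \<in> Cc U \<Longrightarrow> (\<And>x. 0 \<le> f x) \<Longrightarrow> (\<And>x. 0 \<le> g x) \<Longrightarrow>
        I (\<lambda>x. f x + g x) = I f + I g"
    and scale: "\<And>f c. f \<in> Cc U \<Longrightarrow> (\<And>x. 0 \<le> f x) \<Longrightarrow> 0 \<le> c \<Longrightarrow> I (\<lambda>x. c * f x) = c * I f"
    and nonneg: "\<And>f. f \<in> Cc U \<Longrightarrow> (\<And>x. 0 \<le> f x) \<Longrightarrow> 0 \<le> I f"
    and bound: "\<And>f c. f \<in> Cc U \<Longrightarrow> (\<And>x. 0 \<le> f x) \<Longrightarrow> (\<And>x. f x \<le> c) \<Longrightarrow> I f \<le> B * c"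
  shows "\<exists>M. sets M = sets borel \<and> finite_measure M \<and> emeasure M (- U) = 0 \<and>
    (\<forall>f\<in>Cc U. (\<forall>x. 0 \<le> f x) \<longrightarrow> integral\<^sup>L M f = I f)"
proof -
  define P where "P f g \<longleftrightarrow> f \<in> Cc U \<and> g \<in> Cc U \<and> (\<forall>x. 0 \<le> f x \<and> f x \<le> g x)"
    for f g :: "'a \<Rightarrow> real"
  define G where "G f g = {(x, t). f x \<le> t \<and> t < g x}" for f g :: "'a \<Rightarrow> real"
  define m where "m f g = ennreal (I (\<lambda>x. g x - f x))" for f g
  define M0 where "M0 = extend_measure UNIV {(a, b). P a b} (\<lambda>(a, b). G a b) (\<lambda>(a, b). m a b)"
  have Pdiff: "(\<lambda>x. g x - f x) \<in> Cc U" "0 \<le> I (\<lambda>x. g x - f x)" if "P f g" for f g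
    using that by (auto simp: P_def intro!: Cc_diff nonneg)
  have I0: "I (\<lambda>x. 0) = 0"
    using scale[of "\<lambda>x. 0" 0] by (simp add: Cc_zero)
  have Isum: "I (\<lambda>x. \<Sum>i\<in>S. f i x) = (\<Sum>i\<in>S. I (f i))"
    if "\<And>i. i \<in> S \<Longrightarrow> f i \<in> Cc U" "\<And>i x. i \<in> S \<Longrightarrow> 0 \<le> f i x" "finite S" for f and S :: "nat set"
    using that(3,1,2)
  proof (induction S rule: finite_induct)
    case (insert i S)
    then show ?case using add[of "f i" "\<lambda>x. \<Sum>i\<in>S. f i x"]
      by (simp add: Cc_sum sum_nonneg)
  qed (simp add: I0)
  have slice: "{t. (x, t) \<in> G f g} = {f x..<g x}" for f g x
    by (auto simp: G_def)
  \<comment> \<open>A region does not determine its pair of functions where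
    \<open>f x = g x\<close>, but it determines the slice lengths, so \<open>m\<close> depends on
    the region only.\<close>
  have inj: "g x - f x = g' x - f' x"
    if "P f g" "P f' g'" "G f g = G f' g'" for f g f' g' x
  proof -
    have "{f x..<g x} = {f' x..<g' x}" using slice that(3) by metis
    then have "emeasure lborel {f x..<g x} = emeasure lborel {f' x..<g' x}" by simp
    then show ?thesis using that(1,2) by (simp add: P_def)
  qed
  have M0: "emeasure M0 (G f g) = m f g" if "P f g" for f g
  proof (rule extend_measure_caratheodory_pair[OF M0_def, of f g])
    show "P f g" by fact
    show "semiring_of_sets UNIV {G a b |a b. P a b}"
    proof (unfold_locales)
      show "{G a b |a b. P a b} \<subseteq> Pow UNIV" by simp
      have "{} = G (\<lambda>x. 0) (\<lambda>x. 0)" "P (\<lambda>x. 0) (\<lambda>x. 0)" by (auto simp: G_def P_def Cc_zero)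
      then show "{} \<in> {G a b |a b. P a b}" by blast
    next
      fix A C assume "A \<in> {G a b |a b. P a b}" "C \<in> {G a b |a b. P a b}"
      then obtain f g f' g' where A: "A = G f g" "P f g" and C: "C = G f' g'" "P f' g'" by blast
      \<comment> \<open>The outer \<open>max\<close> makes a slice empty instead of reversed where
        the two intervals do not meet.\<close>
      have "A \<inter> C = G (\<lambda>x. max (f x) (f' x)) (\<lambda>x. max (max (f x) (f' x)) (min (g x) (g' x)))"
        by (auto simp: A C G_def)
      moreover have "P (\<lambda>x. max (f x) (f' x)) (\<lambda>x. max (max (f x) (f' x)) (min (g x) (g' x)))"
        using A C by (auto simp: P_def le_max_iff_disj intro!: Cc_max Cc_min)
      ultimately show "A \<inter> C \<in> {G a b |a b. P a b}" by blast
      \<comment> \<open>The difference consists of the part below \<open>f'\<close> and the part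
        above \<open>g'\<close>, both bounds being clamped into the interval from \<open>f\<close>
        to \<open>g\<close>.\<close>
      let ?A1 = "G f (\<lambda>x. max (f x) (min (g x) (f' x)))" and ?A2 = "G (\<lambda>x. min (g x) (max (f x) (g' x))) g"
      have "P f (\<lambda>x. max (f x) (min (g x) (f' x)))" "P (\<lambda>x. min (g x) (max (f x) (g' x))) g"
        using A C by (auto simp: P_def le_max_iff_disj min_le_iff_disj intro!: Cc_max Cc_min intro: order_trans)
      then have "{?A1, ?A2} \<subseteq> {G a b |a b. P a b}" by blast
      moreover have fg': "f' x \<le> g' x" for x using C by (simp add: P_def)
      have "?A1 \<inter> ?A2 = {}"
      proof -
        have False if "(x, t) \<in> ?A1" "(x, t) \<in> ?A2" for x t
          using that fg'[of x] by (auto simp: G_def min_le_iff_disj less_max_iff_disj)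
        then show ?thesis by auto
      qed
      then have "disjoint {?A1, ?A2}" by (auto simp: disjoint_def)
      moreover have "A - C = \<Union>{?A1, ?A2}"
      proof -
        have "(x, t) \<in> A - C \<longleftrightarrow> (x, t) \<in> ?A1 \<union> ?A2" for x t
          using fg'[of x] by (auto simp: A C G_def min_le_iff_disj less_max_iff_disj)
        then show ?thesis by auto
      qed
      ultimately show "\<exists>D\<subseteq>{G a b |a b. P a b}. finite D \<and> disjoint D \<and> A - C = \<Union>D"
        by (intro exI[of _ "{?A1, ?A2}"]) auto
    qed
  next
    fix f g assume fg: "P f g" and e: "G f g = {}"
    have "g x - f x = 0" for x
    proof -
      have "{f x..<g x} = {}" using slice[of x f g] e by simp
      then show ?thesis using fg by (simp add: P_def order.antisym)
    qed
    then show "m f g = 0" by (simp add: m_def I0)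
  next
    fix f g f' g' assume h: "P f g" "P f' g'" "G f g = G f' g'"
    show "m f g = m f' g'" by (simp add: m_def inj[OF h])
  next
    fix a b :: "nat \<Rightarrow> 'a \<Rightarrow> real" and f g
    assume ab: "\<And>n. P (a n) (b n)" and fg: "P f g" and disj: "disjoint_family (\<lambda>n. G (a n) (b n))"
      and un: "(\<Union>n. G (a n) (b n)) = G f g"
    have sums: "(\<lambda>n. b n x - a n x) sums (g x - f x)" for x
    proof (rule sums_length_half_open)
      show "disjoint_family (\<lambda>n. {a n x..<b n x})"
        unfolding disjoint_family_on_def
      proof (intro ballI impI)
        fix k l :: nat assume "k \<noteq> l"
        then have "G (a k) (b k) \<inter> G (a l) (b l) = {}"
          by (intro disjoint_family_onD[OF disj]) auto
        then have "{t. (x, t) \<in> G (a k) (b k)} \<inter> {t. (x, t) \<in> G (a l) (b l)} = {}" by auto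
        then show "{a k x..<b k x} \<inter> {a l x..<b l x} = {}" by (simp only: slice)
      qed
      have "(\<Union>n. {a n x..<b n x}) = {t. (x, t) \<in> (\<Union>n. G (a n) (b n))}"
        unfolding slice[symmetric] by auto
      then show "(\<Union>n. {a n x..<b n x}) = {f x..<g x}" unfolding un slice .
    qed (use ab fg in \<open>auto simp: P_def\<close>)
    \<comment> \<open>\<open>R n\<close> is the slice length not covered by the first
      \<open>n\<close> regions. Its decrease to 0 is uniform, and \<open>bound\<close> turns uniform
      smallness into smallness of \<open>I (R n)\<close>.\<close>
    define R where "R n x = (g x - f x) - (\<Sum>i<n. b i x - a i x)" for n x
    have R: "R n \<in> Cc U" for n
      unfolding R_def using Pdiff(1)[OF fg] Pdiff(1)[OF ab] by (intro Cc_diff[of _ _ "\<lambda>x. \<Sum>i<n. _ i x"] Cc_sum) auto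
    have step0: "0 \<le> b n x - a n x" for n x using ab by (simp add: P_def)
    have R0: "0 \<le> R n x" for n x
      unfolding R_def using sum_le_suminf[OF sums_summable[OF sums], of "{..<n}" x] step0
      by (simp add: sums_unique[OF sums, symmetric])
    have Rdec: "R n x \<le> R k x" if "k \<le> n" for k n x
      unfolding R_def using that step0 by (auto intro!: sum_mono2)
    have Rlim: "(\<lambda>n. R n x) \<longlonglongrightarrow> 0" for x
      unfolding R_def using tendsto_diff[OF tendsto_const[of "g x - f x"] sums[of x, unfolded sums_def]] by simp
    have split: "I (\<lambda>x. g x - f x) = (\<Sum>i<n. I (\<lambda>x. b i x - a i x)) + I (R n)" for n
    proof -
      have "I (\<lambda>x. g x - f x) = I (\<lambda>x. (\<Sum>i<n. b i x - a i x) + R n x)"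
        by (simp add: R_def)
      also have "\<dots> = I (\<lambda>x. \<Sum>i<n. b i x - a i x) + I (R n)"
        using Pdiff(1)[OF ab] step0 by (intro add R R0 Cc_sum sum_nonneg) auto
      also have "I (\<lambda>x. \<Sum>i<n. b i x - a i x) = (\<Sum>i<n. I (\<lambda>x. b i x - a i x))"
        using Pdiff(1)[OF ab] step0 by (intro Isum) auto
      finally show ?thesis .
    qed
    have "(\<lambda>n. I (R n)) \<longlonglongrightarrow> 0"
    proof (rule LIMSEQ_I)
      fix e :: real assume e: "0 < e"
      \<comment> \<open>The denominator with \<open>\<bar>B\<bar> + 1\<close> is positive for every
        real \<open>B\<close>.\<close>
      define e' where "e' = e / (2 * (\<bar>B\<bar> + 1))"
      have e': "0 < e'" using e by (simp add: e'_def)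
      obtain N where N: "\<And>n x. n \<ge> N \<Longrightarrow> R n x \<le> e'"
        using decseq_Cc_uniform[OF R R0 Rdec Rlim e'] by blast
      have "B * e' < e"
      proof -
        have "B * e' \<le> \<bar>B\<bar> * e'" using e' by (intro mult_right_mono) auto
        also have "\<dots> \<le> (\<bar>B\<bar> + 1) * e'" using e' by (simp add: algebra_simps)
        also have "\<dots> = e / 2" by (simp add: e'_def field_simps)
        finally show ?thesis using e by simp
      qed
      then show "\<exists>N. \<forall>n\<ge>N. norm (I (R n) - 0) < e"
        using bound[OF R R0 N] nonneg[OF R R0] by (intro exI[of _ N]) fastforce
    qed
    then have "(\<lambda>n. I (\<lambda>x. g x - f x) - I (R n)) \<longlonglongrightarrow> I (\<lambda>x. g x - f x) - 0"
      by (intro tendsto_intros)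
    moreover have "I (\<lambda>x. g x - f x) - I (R n) = (\<Sum>i<n. I (\<lambda>x. b i x - a i x))" for n
      using split[of n] by simp
    ultimately have "(\<lambda>i. I (\<lambda>x. b i x - a i x)) sums I (\<lambda>x. g x - f x)"
      unfolding sums_def by simp
    then show "(\<Sum>n. m (a n) (b n)) = m f g"
      unfolding m_def using Pdiff(2)[OF ab] Pdiff(2)[OF fg]
      by (intro sums_unique[symmetric]) (simp add: sums_ennreal)
  qed (simp add: m_def)
  have G_sets: "G f g \<in> sets M0" if "P f g" for f g
  proof -
    have "G f g \<in> (\<lambda>(a, b). G a b) ` {(a, b). P a b}" using that by auto
    then show ?thesis unfolding M0_def by (subst sets_extend_measure) auto
  qed
  have space_M0: "space M0 = UNIV" by (simp add: M0_def space_extend_measure)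
  \<comment> \<open>Linearity in the height \<open>c\<close> over open bases is the product
    structure with Lebesgue measure that the layer estimate below uses.\<close>
  have slab: "V \<times> {0..<c} \<in> sets M0"
    "emeasure M0 (V \<times> {0..<c}) = ennreal c * emeasure M0 (V \<times> {0..<1})"
    "emeasure M0 (V \<times> {0..<1}) \<le> ennreal B" if V: "open V" "V \<subseteq> U" and c: "0 < c" for V c
  proof -
    obtain f :: "nat \<Rightarrow> 'a \<Rightarrow> real" where f: "\<And>n. f n \<in> Cc V" "\<And>n x. 0 \<le> f n x" "\<And>n x. f n x \<le> 1"
      "\<And>m n x. m \<le> n \<Longrightarrow> f m x \<le> f n x" "\<And>x. x \<in> V \<Longrightarrow> \<exists>n. f n x = 1"
      using Cc_approx_open[OF V(1)] by blast
    have fU: "f n \<in> Cc U" for n using f(1)[of n] V(2) by (auto simp: Cc_def)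
    have P: "P (\<lambda>x. 0) (\<lambda>x. c * f n x)" if "0 < c" for n c
      using that f fU by (auto simp: P_def Cc_zero intro!: Cc_scale[OF fU fU])
    have un: "V \<times> {0..<c} = (\<Union>n. G (\<lambda>x. 0) (\<lambda>x. c * f n x))" if c: "0 < c" for c
    proof (intro equalityI subsetI)
      fix z assume "z \<in> V \<times> {0..<c}"
      then obtain x t where z: "z = (x, t)" "x \<in> V" "0 \<le> t" "t < c" by auto
      obtain n where "f n x = 1" using f(5) z by blast
      with z show "z \<in> (\<Union>n. G (\<lambda>x. 0) (\<lambda>x. c * f n x))" by (auto simp: G_def intro!: exI[of _ n])
    next
      fix z assume "z \<in> (\<Union>n. G (\<lambda>x. 0) (\<lambda>x. c * f n x))"
      then obtain x t n where z: "z = (x, t)" "0 \<le> t" "t < c * f n x" by (auto simp: G_def)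
      then have "c * f n x > 0" by linarith
      then have "f n x \<noteq> 0" by auto
      then have "x \<in> V" using f(1)[of n] zero_outside_csupport[of x "f n"] by (auto simp: Cc_def)
      moreover have "c * f n x \<le> c" using f(3)[of n x] c by simp
      ultimately show "z \<in> V \<times> {0..<c}" using z by auto
    qed
    show "V \<times> {0..<c} \<in> sets M0" unfolding un[OF c] using G_sets[OF P[OF c]] by auto
    have val: "emeasure M0 (V \<times> {0..<c}) = (SUP n. ennreal (c * I (f n)))" if c: "0 < c" for c
    proof -
      have "incseq (\<lambda>n. G (\<lambda>x. 0) (\<lambda>x. c * f n x))"
      proof (rule incseq_SucI)
        fix n
        have "c * f n x \<le> c * f (Suc n) x" for x using f(4)[of n "Suc n" x] c by simp
        then show "G (\<lambda>x. 0) (\<lambda>x. c * f n x) \<subseteq> G (\<lambda>x. 0) (\<lambda>x. c * f (Suc n) x)"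
          unfolding G_def by (auto intro: less_le_trans)
      qed
      then have "emeasure M0 (V \<times> {0..<c}) = (SUP n. emeasure M0 (G (\<lambda>x. 0) (\<lambda>x. c * f n x)))"
        unfolding un[OF c] using G_sets[OF P[OF c]] by (subst SUP_emeasure_incseq) auto
      also have "\<dots> = (SUP n. ennreal (c * I (f n)))"
        using M0[OF P[OF c]] scale[OF fU] f(2) c by (simp add: m_def)
      finally show ?thesis .
    qed
    show "emeasure M0 (V \<times> {0..<c}) = ennreal c * emeasure M0 (V \<times> {0..<1})"
      using c unfolding val[OF c] val[OF zero_less_one]
      by (simp add: ennreal_mult' SUP_mult_left_ennreal)
    show "emeasure M0 (V \<times> {0..<1}) \<le> ennreal B"
      unfolding val[OF zero_less_one] using bound[OF fU f(2) f(3)] by (auto intro!: SUP_least ennreal_leI)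
  qed
  have rect: "(A \<inter> U) \<times> {0..<1::real} \<in> sets M0" if "A \<in> sets borel" for A
  proof -
    have "A \<in> sigma_sets UNIV {S. open S}" using that by (simp add: borel_def)
    then show ?thesis
    proof induction
      case (Basic A)
      then show ?case using slab(1)[of "A \<inter> U" 1] U by auto
    next
      case (Compl A)
      have "((UNIV - A) \<inter> U) \<times> {0..<1::real} = U \<times> {0..<1} - (A \<inter> U) \<times> {0..<1}" by auto
      then show ?case using Compl slab(1)[of U 1] U by auto
    next
      case (Union A)
      have "(\<Union>(range A) \<inter> U) \<times> {0..<1::real} = (\<Union>i. (A i \<inter> U) \<times> {0..<1})" by auto
      then show ?case using Union by auto
    qed simp
  qed
  \<comment> \<open>Restricting to heights in \<open>[0, 1)\<close> and projecting to the first
    factor removes the Lebesgue factor of the product.\<close>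
  define N where "N = restrict_space M0 (U \<times> {0..<1::real})"
  define M where "M = distr N borel fst"
  have Us: "U \<times> {0..<1::real} \<in> sets M0" using slab(1)[of U 1] U by simp
  have meas: "fst \<in> measurable N borel"
  proof (rule measurableI)
    fix A :: "'a set" assume "A \<in> sets borel"
    then have "(A \<inter> U) \<times> {0..<1::real} \<in> sets M0" by (rule rect)
    moreover have "fst -` A \<inter> space N = (A \<inter> U) \<times> {0..<1}"
      by (auto simp: N_def space_restrict_space space_M0)
    ultimately show "fst -` A \<inter> space N \<in> sets N"
      using Us by (auto simp: N_def sets_restrict_space_iff space_M0)
  qed simp
  have M: "emeasure M A = emeasure M0 ((A \<inter> U) \<times> {0..<1})" if "A \<in> sets borel" for A
  proof -
    have "fst -` A \<inter> space N = (A \<inter> U) \<times> {0..<1}"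
      by (auto simp: N_def space_restrict_space space_M0)
    then show ?thesis
      unfolding M_def using meas that Us rect[OF that]
      by (subst emeasure_distr) (auto simp: N_def space_M0 intro!: emeasure_restrict_space)
  qed
  have sM: "sets M = sets borel" by (simp add: M_def)
  then have spM: "space M = UNIV" using sets_eq_imp_space_eq[of M borel] by simp
  have "emeasure M UNIV \<noteq> \<infinity>"
    using slab(3)[of U 1] U M[of UNIV] by (auto simp: top_unique)
  then have fin: "finite_measure M" by (intro finite_measureI) (simp add: spM)
  interpret M: finite_measure M by fact
  have out: "emeasure M (- U) = 0" using M[of "- U"] U by simp
  have open_val: "ennreal (c * measure M V) = emeasure M0 (V \<times> {0..<c})"
    if "open V" "V \<subseteq> U" "0 < c" for V c
    using slab(2)[OF that] M[of V] that
    by (simp add: ennreal_mult' M.emeasure_eq_measure[symmetric] Int_absorb2)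
  have Ih: "ennreal (I h) = emeasure M0 (G (\<lambda>x. 0) h)" "G (\<lambda>x. 0) h \<in> sets M0"
    if "h \<in> Cc U" "\<And>x. 0 \<le> h x" for h
    using M0[of "\<lambda>x. 0" h] G_sets[of "\<lambda>x. 0" h] that by (auto simp: P_def m_def Cc_zero)
  have "integral\<^sup>L M f = I f" if f: "f \<in> Cc U" and f0: "\<And>x. 0 \<le> f x" for f
  proof -
    have int: "integrable M h" if "h \<in> Cc U" for h :: "'a \<Rightarrow> real"
      by (rule integrable_Cc[OF that fin sM])
    \<comment> \<open>Cut \<open>f\<close> into layers \<open>h k\<close> between the heights
      \<open>k * e\<close> and \<open>(k + 1) * e\<close>. Both \<open>I (h k)\<close> and the
      integral of \<open>h k\<close> lie between \<open>e * measure M (V (Suc k))\<close> and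
      \<open>e * measure M (V k)\<close>, so the total discrepancy telescopes to at most one layer
      of height \<open>e\<close> over \<open>U\<close>.\<close>
    have close: "\<bar>integral\<^sup>L M f - I f\<bar> \<le> e * measure M U" if e: "0 < e" for e
    proof -
      obtain b where b: "\<And>x. f x \<le> b"
        using bounded_range_Cc[OF f] by (auto simp: bounded_iff intro: order_trans[OF abs_ge_self])
      obtain n :: nat where n: "b / e \<le> n" using real_arch_simple by blast
      have fn: "f x \<le> real n * e" for x
        using b[of x] n e by (simp add: pos_divide_le_eq)
      define h where "h k x = min (max (f x - real k * e) 0) e" for k x
      define V where "V k = {x. real k * e < f x}" for k
      have hC: "h k \<in> Cc U" for k
        using f0 e CcD(1)[OF f] unfolding h_def
        by (intro Cc_compose[OF f] continuous_intros) (auto simp: max_def)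
      have h0: "0 \<le> h k x" for k x using e by (simp add: h_def)
      have part: "(\<Sum>i<k. h i x) = min (f x) (real k * e)" for k x
      proof (induction k)
        case 0 then show ?case using f0[of x] by simp
      next
        case (Suc k)
        then show ?case using e by (auto simp: h_def min_def max_def algebra_simps)
      qed
      have fsum: "f = (\<lambda>x. \<Sum>i<n. h i x)" using part[where k=n] fn by (simp add: min_absorb1)
      have Vo: "open (V k)" for k
        unfolding V_def using CcD(1)[OF f] by (intro open_Collect_less continuous_intros) auto
      have VU: "V k \<subseteq> U" for k
      proof
        fix x assume "x \<in> V k"
        moreover have "0 \<le> real k * e" using e by simp
        ultimately have "f x \<noteq> 0" by (auto simp: V_def)
        then show "x \<in> U" using f zero_outside_csupport[of x f] by (auto simp: Cc_def)
      qed
      have up: "h k x \<le> e * indicator (V k) x" for k x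
        using e by (auto simp: h_def V_def indicator_def)
      have lo: "e * indicator (V (Suc k)) x \<le> h k x" for k x
        using e by (auto simp: h_def V_def indicator_def algebra_simps)
      have I_up: "I (h k) \<le> e * measure M (V k)" for k
      proof -
        have "t < e" "x \<in> V k" if "0 \<le> t" "t < h k x" for x t
          using that up[of k x] by (cases "x \<in> V k"; simp)+
        then have "G (\<lambda>x. 0) (h k) \<subseteq> V k \<times> {0..<e}" by (auto simp: G_def)
        then have "ennreal (I (h k)) \<le> ennreal (e * measure M (V k))"
          unfolding Ih(1)[OF hC h0] open_val[OF Vo VU e]
          using slab(1)[OF Vo VU e] by (intro emeasure_mono) auto
        then show ?thesis using e by (subst (asm) ennreal_le_iff) auto
      qed
      have I_lo: "e * measure M (V (Suc k)) \<le> I (h k)" for k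
      proof -
        have "t < h k x" if "x \<in> V (Suc k)" "t < e" for x t
          using that lo[of k x] by (auto simp: indicator_def)
        then have "V (Suc k) \<times> {0..<e} \<subseteq> G (\<lambda>x. 0) (h k)" by (auto simp: G_def)
        then have "ennreal (e * measure M (V (Suc k))) \<le> ennreal (I (h k))"
          unfolding Ih(1)[OF hC h0] open_val[OF Vo VU e]
          using Ih(2)[OF hC h0] by (intro emeasure_mono) auto
        then show ?thesis using nonneg[OF hC h0] by (subst (asm) ennreal_le_iff) auto
      qed
      have V_int: "integrable M (\<lambda>x. e * indicator (V k) x)" for k
        using Vo[of k] sM by (auto intro!: integrable_real_indicator simp: M.emeasure_finite less_top[symmetric])
      have V_val: "(\<integral>x. e * indicator (V k) x \<partial>M) = e * measure M (V k)" for k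
        using Vo[of k] sM by (simp add: spM)
      have int_up: "integral\<^sup>L M (h k) \<le> e * measure M (V k)" for k
        unfolding V_val[symmetric] by (intro integral_mono int hC V_int up)
      have int_lo: "e * measure M (V (Suc k)) \<le> integral\<^sup>L M (h k)" for k
        unfolding V_val[symmetric] by (intro integral_mono int hC V_int lo)
      have "I f = (\<Sum>k<n. I (h k))"
        unfolding fsum by (intro Isum) (auto simp: hC h0)
      moreover have "integral\<^sup>L M f = (\<Sum>k<n. integral\<^sup>L M (h k))"
        unfolding fsum by (intro Bochner_Integration.integral_sum int hC)
      ultimately have "\<bar>integral\<^sup>L M f - I f\<bar> = \<bar>\<Sum>k<n. integral\<^sup>L M (h k) - I (h k)\<bar>"
        by (simp add: sum_subtractf)
      also have "\<dots> \<le> (\<Sum>k<n. \<bar>integral\<^sup>L M (h k) - I (h k)\<bar>)" by (rule sum_abs)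
      also have "\<dots> \<le> (\<Sum>k<n. e * measure M (V k) - e * measure M (V (Suc k)))"
      proof (rule sum_mono)
        fix k show "\<bar>integral\<^sup>L M (h k) - I (h k)\<bar> \<le> e * measure M (V k) - e * measure M (V (Suc k))"
          using I_up[of k] I_lo[of k] int_up[of k] int_lo[of k] by linarith
      qed
      also have "\<dots> = e * measure M (V 0) - e * measure M (V n)"
        by (rule sum_lessThan_telescope')
      also have "\<dots> \<le> e * measure M (V 0)" using e by simp
      also have "\<dots> \<le> e * measure M U"
        using e U VU sM by (intro mult_left_mono M.finite_measure_mono) auto
      finally show ?thesis .
    qed
    have "\<bar>integral\<^sup>L M f - I f\<bar> \<le> 0"
    proof (rule field_le_epsilon)
      fix e :: real assume e: "0 < e"
      have p: "0 < measure M U + 1" using measure_nonneg[of M U] by linarith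
      have "e / (measure M U + 1) * measure M U \<le> e"
        using e p by (simp add: pos_divide_le_eq algebra_simps)
      moreover have "0 < e / (measure M U + 1)" using e p by (rule divide_pos_pos)
      ultimately show "\<bar>integral\<^sup>L M f - I f\<bar> \<le> 0 + e" using close[of "e / (measure M U + 1)"] by linarith
    qed
    then show ?thesis by simp
  qed
  then show ?thesis using sM fin out by blast
qed

text \<open>Jordan decomposition at the level of functionals: \<open>I f\<close>, the supremum of
  \<open>l g\<close> over \<open>0 \<le> g \<le> f\<close>, is the positive part of
  \<open>l\<close>, and \<open>J = I - l\<close> is the negative part. Both satisfy the hypotheses
  of the positive case.\<close>

lemma riesz_signed:
  fixes l :: "('a::euclidean_space \<Rightarrow> real) \<Rightarrow> real"
  assumes U: "open U"
    and add: "\<And>f g. f \<in> Cc U \<Longrightarrow> g \<in> Cc U \<Longrightarrow> l (\<lambda>x. f x + g x) = l f + l g"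
    and scale: "\<And>f c. f \<in> Cc U \<Longrightarrow> l (\<lambda>x. c * f x) = c * l f"
    and bound: "\<And>f c. f \<in> Cc U \<Longrightarrow> (\<And>x. \<bar>f x\<bar> \<le> c) \<Longrightarrow> l f \<le> B * c"
  shows "\<exists>M N. sets M = sets borel \<and> finite_measure M \<and> emeasure M (- U) = 0 \<and>
    sets N = sets borel \<and> finite_measure N \<and> emeasure N (- U) = 0 \<and>
    (\<forall>f\<in>Cc U. l f = integral\<^sup>L M f - integral\<^sup>L N f)"
proof -
  define S where "S f = {l g |g. g \<in> Cc U \<and> (\<forall>x. 0 \<le> g x \<and> g x \<le> f x)}" for f
  define I where "I f = Sup (S f)" for f
  have l0: "l (\<lambda>x. 0) = 0" using scale[of "\<lambda>x. 0" 0] by (simp add: Cc_zero)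
  have diff: "l (\<lambda>x. f x - g x) = l f - l g" if "f \<in> Cc U" "g \<in> Cc U" for f g
    using add[OF Cc_diff[OF that] that(2)] by simp
  have S_le: "y \<le> B * c" if "f \<in> Cc U" and fc: "\<And>x. f x \<le> c" and y: "y \<in> S f" for f c y
  proof -
    obtain g where g: "y = l g" "g \<in> Cc U" "\<And>x. 0 \<le> g x" "\<And>x. g x \<le> f x"
      using y by (auto simp: S_def)
    have "\<bar>g x\<bar> \<le> c" for x using g(3,4)[of x] fc[of x] by linarith
    then show ?thesis using bound[OF g(2)] g(1) by simp
  qed
  have bdd: "bdd_above (S f)" if f: "f \<in> Cc U" for f
  proof -
    obtain c where "\<And>x. f x \<le> c"
      using bounded_range_Cc[OF f] by (auto simp: bounded_iff intro: order_trans[OF abs_ge_self])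
    then show ?thesis using S_le[OF f] by (intro bdd_aboveI[of _ "B * c"]) auto
  qed
  have ne: "l (\<lambda>x. 0) \<in> S f" if "\<And>x. 0 \<le> f x" for f
    using that by (auto simp: S_def Cc_zero)
  have I_ge: "l g \<le> I f" if "f \<in> Cc U" "g \<in> Cc U" "\<And>x. 0 \<le> g x" "\<And>x. g x \<le> f x" for f g
    unfolding I_def using that by (intro cSup_upper bdd) (auto simp: S_def)
  have I_le: "I f \<le> m" if "\<And>x. 0 \<le> f x"
    "\<And>g. g \<in> Cc U \<Longrightarrow> (\<And>x. 0 \<le> g x) \<Longrightarrow> (\<And>x. g x \<le> f x) \<Longrightarrow> l g \<le> m" for f m
    unfolding I_def using ne[of f] that by (intro cSup_least) (auto simp: S_def)
  have I_add: "I (\<lambda>x. f x + g x) = I f + I g"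
    if f: "f \<in> Cc U" "\<And>x. 0 \<le> f x" and g: "g \<in> Cc U" "\<And>x. 0 \<le> g x" for f g
  proof (rule antisym)
    show "I (\<lambda>x. f x + g x) \<le> I f + I g"
    proof (rule I_le)
      fix h assume h: "h \<in> Cc U" "\<And>x. 0 \<le> h x" "\<And>x. h x \<le> f x + g x"
      \<comment> \<open>Riesz decomposition: a function between 0 and \<open>f + g\<close> is the
        sum of \<open>min h f\<close>, below \<open>f\<close>, and the rest, below
        \<open>g\<close>.\<close>
      have m: "(\<lambda>x. min (h x) (f x)) \<in> Cc U" by (intro Cc_min h f)
      have "l h = l (\<lambda>x. min (h x) (f x)) + l (\<lambda>x. h x - min (h x) (f x))"
        using diff[OF h(1) m] by simp
      moreover have "l (\<lambda>x. min (h x) (f x)) \<le> I f" by (intro I_ge m f) (use h f in auto)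
      moreover have "l (\<lambda>x. h x - min (h x) (f x)) \<le> I g"
      proof (intro I_ge g Cc_diff h(1) m)
        show "h x - min (h x) (f x) \<le> g x" for x using h(3)[of x] g(2)[of x] by linarith
      qed auto
      ultimately show "l h \<le> I f + I g" by linarith
    qed (use f g in \<open>simp add: add_nonneg_nonneg\<close>)
    have "l h \<le> I (\<lambda>x. f x + g x) - l k"
      if h: "h \<in> Cc U" "\<And>x. 0 \<le> h x" "\<And>x. h x \<le> f x" and k: "k \<in> Cc U" "\<And>x. 0 \<le> k x" "\<And>x. k x \<le> g x" for h k
      using I_ge[OF Cc_add[OF f(1) g(1)] Cc_add[OF h(1) k(1)]] h k add[OF h(1) k(1)]
      by (simp add: add_mono)
    then have "I f \<le> I (\<lambda>x. f x + g x) - l k"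
      if "k \<in> Cc U" "\<And>x. 0 \<le> k x" "\<And>x. k x \<le> g x" for k
      using that by (intro I_le f(2)) blast
    then have "I g \<le> I (\<lambda>x. f x + g x) - I f"
      by (intro I_le g(2)) (simp add: algebra_simps)
    then show "I f + I g \<le> I (\<lambda>x. f x + g x)" by simp
  qed
  have I0: "I (\<lambda>x. 0) = 0"
  proof -
    have "S (\<lambda>x. 0) = {0}"
    proof -
      have "g = (\<lambda>x. 0)" if "\<forall>x. 0 \<le> g x \<and> g x \<le> 0" for g :: "'a \<Rightarrow> real"
        using that by (auto intro: antisym)
      then show ?thesis using l0 ne[of "\<lambda>x. 0"] by (auto simp: S_def)
    qed
    then show ?thesis by (simp add: I_def)
  qed
  have I_scale: "I (\<lambda>x. c * f x) = c * I f"
    if f: "f \<in> Cc U" "\<And>x. 0 \<le> f x" and c: "0 \<le> c" for f c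
  proof (cases "c = 0")
    case False
    then have c: "0 < c" using c by simp
    have le: "I (\<lambda>x. c * f x) \<le> c * I f"
      if f: "f \<in> Cc U" "\<And>x. 0 \<le> f x" and c: "0 < c" for f c
    proof (rule I_le)
      fix h assume h: "h \<in> Cc U" "\<And>x. 0 \<le> h x" "\<And>x. h x \<le> c * f x"
      have "l (\<lambda>x. (1/c) * h x) \<le> I f"
        using h c by (intro I_ge f(1) Cc_scale[OF h(1) h(1)]) (auto simp: divide_le_eq mult.commute)
      then have "l h / c \<le> I f" using scale[OF h(1), of "1/c"] by simp
      then show "l h \<le> c * I f" using c by (simp add: pos_divide_le_eq mult.commute)
    qed (use f c in simp)
    have "I (\<lambda>x. (1/c) * (c * f x)) \<le> (1/c) * I (\<lambda>x. c * f x)"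
      using c f by (intro le Cc_scale[OF f(1) f(1)]) auto
    then show ?thesis using le[OF f c] c by (simp add: field_simps)
  qed (use I0 in simp)
  have I_nonneg: "0 \<le> I f" if "f \<in> Cc U" "\<And>x. 0 \<le> f x" for f
    using I_ge[OF that(1) Cc_zero] that l0 by simp
  have I_bound: "I f \<le> B * c" if "f \<in> Cc U" "\<And>x. 0 \<le> f x" "\<And>x. f x \<le> c" for f c
    unfolding I_def using ne[of f] S_le[OF that(1,3)] that(2) by (intro cSup_least) auto
  define J where "J f = I f - l f" for f
  have "\<exists>M. sets M = sets borel \<and> finite_measure M \<and> emeasure M (- U) = 0 \<and>
    (\<forall>f\<in>Cc U. (\<forall>x. 0 \<le> f x) \<longrightarrow> integral\<^sup>L M f = I f)"
    by (rule riesz_positive[OF U I_add I_scale I_nonneg I_bound])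
  then obtain M where M: "sets M = sets borel" "finite_measure M" "emeasure M (- U) = 0"
    "\<And>f. f \<in> Cc U \<Longrightarrow> (\<And>x. 0 \<le> f x) \<Longrightarrow> integral\<^sup>L M f = I f" by blast
  have "\<exists>M. sets M = sets borel \<and> finite_measure M \<and> emeasure M (- U) = 0 \<and>
    (\<forall>f\<in>Cc U. (\<forall>x. 0 \<le> f x) \<longrightarrow> integral\<^sup>L M f = J f)"
  \<comment> \<open>The constant doubles because \<open>I f\<close> and \<open>- l f\<close> are
    each at most \<open>B * c\<close>.\<close>
  proof (rule riesz_positive[OF U, of J "2 * B"])
    fix f :: "'a \<Rightarrow> real" assume f: "f \<in> Cc U" "\<And>x. 0 \<le> f x"
    show "0 \<le> J f" using I_ge[OF f(1) f] by (simp add: J_def)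
    fix c assume c: "\<And>x. f x \<le> c"
    have m: "(\<lambda>x. - 1 * f x) \<in> Cc U" by (rule Cc_scale[OF f(1) f(1)])
    have "\<bar>- 1 * f x\<bar> \<le> c" for x using f(2)[of x] c[of x] by simp
    then have "l (\<lambda>x. - 1 * f x) \<le> B * c" by (rule bound[OF m])
    then show "J f \<le> 2 * B * c"
      using I_bound[OF f c] scale[OF f(1), of "- 1"] by (simp add: J_def)
  qed (simp_all add: J_def I_add I_scale add scale algebra_simps)
  then obtain N where N: "sets N = sets borel" "finite_measure N" "emeasure N (- U) = 0"
    "\<And>f. f \<in> Cc U \<Longrightarrow> (\<And>x. 0 \<le> f x) \<Longrightarrow> integral\<^sup>L N f = J f" by blast
  have "l f = integral\<^sup>L M f - integral\<^sup>L N f" if f: "f \<in> Cc U" for f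
  proof -
    let ?p = "\<lambda>x. max (f x) 0" and ?n = "\<lambda>x. max (f x) 0 - f x"
    have p: "?p \<in> Cc U" by (rule Cc_max[OF f Cc_zero])
    have n: "?n \<in> Cc U" by (rule Cc_diff[OF p f])
    have pos: "l g = integral\<^sup>L M g - integral\<^sup>L N g" if "g \<in> Cc U" "\<And>x. 0 \<le> g x" for g
      using M(4)[OF that] N(4)[OF that] by (simp add: J_def)
    have "l f = l ?p - l ?n" using diff[OF p n] by simp
    moreover have "integral\<^sup>L Q f = integral\<^sup>L Q ?p - integral\<^sup>L Q ?n"
      if "finite_measure Q" "sets Q = sets borel" for Q
      using Bochner_Integration.integral_diff[OF integrable_Cc[OF p that] integrable_Cc[OF n that]] by simp
    ultimately show ?thesis
      using pos[OF p] pos[OF n] M(1,2) N(1,2) by simp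
  qed
  then show ?thesis using M(1-3) N(1-3) by blast
qed

text \<open>The sum of the measures. The clause on common null sets is what keeps the dominating
  measure concentrated on \<open>U\<close> when all summands are.\<close>

lemma dominating_finite_measure:
  fixes M :: "'i \<Rightarrow> 'a::topological_space measure"
  assumes I: "finite I" and s: "\<And>i. i \<in> I \<Longrightarrow> sets (M i) = sets borel"
    and fin: "\<And>i. i \<in> I \<Longrightarrow> finite_measure (M i)"
  shows "\<exists>T. sets T = sets borel \<and> finite_measure T \<and> (\<forall>i\<in>I. absolutely_continuous T (M i)) \<and>
    (\<forall>A\<in>sets borel. (\<forall>i\<in>I. emeasure (M i) A = 0) \<longrightarrow> emeasure T A = 0)"
proof -
  define T where "T = measure_of UNIV (sets borel) (\<lambda>A. \<Sum>i\<in>I. emeasure (M i) A)"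
  have sT: "sets T = sets borel"
    unfolding T_def using sets.sigma_sets_eq[of borel] by (subst sets_measure_of) auto
  have T: "emeasure T A = (\<Sum>i\<in>I. emeasure (M i) A)" if "A \<in> sets borel" for A
  proof (rule emeasure_measure_of[OF T_def])
    show "positive (sets T) (\<lambda>A. \<Sum>i\<in>I. emeasure (M i) A)"
      by (simp add: positive_def)
    show "countably_additive (sets T) (\<lambda>A. \<Sum>i\<in>I. emeasure (M i) A)"
    proof (rule countably_additiveI)
      fix A :: "nat \<Rightarrow> 'a set" assume A: "range A \<subseteq> sets T" "disjoint_family A"
      have "(\<Sum>n. \<Sum>i\<in>I. emeasure (M i) (A n)) = (\<Sum>i\<in>I. \<Sum>n. emeasure (M i) (A n))"
        by (rule suminf_sum) simp
      also have "\<dots> = (\<Sum>i\<in>I. emeasure (M i) (\<Union>(range A)))"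
        using A s sT by (intro sum.cong refl suminf_emeasure) auto
      finally show "(\<Sum>n. \<Sum>i\<in>I. emeasure (M i) (A n)) = (\<Sum>i\<in>I. emeasure (M i) (\<Union>(range A)))" .
    qed
  qed (use that sT in auto)
  have "space T = UNIV" using sets_eq_imp_space_eq[OF sT] by simp
  moreover have "emeasure T UNIV \<noteq> \<infinity>"
    using T[of UNIV] fin I by (auto simp: finite_measure.emeasure_finite)
  ultimately have "finite_measure T" by (intro finite_measureI) simp
  moreover have "absolutely_continuous T (M i)" if "i \<in> I" for i
    unfolding absolutely_continuous_def
  proof
    fix A assume "A \<in> null_sets T"
    then have A: "A \<in> sets borel" "emeasure T A = 0" using sT by (auto simp: null_sets_def)
    then have "(\<Sum>i\<in>I. emeasure (M i) A) = 0" using T by simp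
    then show "A \<in> null_sets (M i)" using A that I s[OF that] by (auto simp: null_sets_def)
  qed
  ultimately show ?thesis using sT T by (intro exI[of _ T]) auto
qed

lemma real_density_exists:
  assumes T: "finite_measure T" "sets T = sets borel" and N: "finite_measure N" "sets N = sets borel"
    and ac: "absolutely_continuous T N"
  obtains D :: "'a::euclidean_space \<Rightarrow> real" where "D \<in> borel_measurable borel" "\<And>x. 0 \<le> D x"
    "N = density T (\<lambda>x. ennreal (D x))" "integrable T D"
proof -
  interpret T: finite_measure T by fact
  interpret N: finite_measure N by fact
  obtain D where D: "D \<in> borel_measurable T" "AE x in T. RN_deriv T N x = ennreal (D x)" "\<And>x. 0 \<le> D x"
    using T.real_RN_deriv[OF N(1) ac] T N by metis
  have "N = density T (RN_deriv T N)" using T.density_RN_deriv[OF ac] T N by simp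
  also have "\<dots> = density T (\<lambda>x. ennreal (D x))"
    using D by (intro density_cong) auto
  finally have eq: "N = density T (\<lambda>x. ennreal (D x))" .
  have "(\<integral>\<^sup>+x. ennreal (D x) \<partial>T) = emeasure N (space T)"
    unfolding eq using D by (subst emeasure_density) (auto intro!: nn_integral_cong)
  also have "\<dots> < \<infinity>" by (metis N.emeasure_finite infinity_ennreal_def top.not_eq_extremum)
  finally have "integrable T D" using D by (intro integrableI_nonneg) auto
  moreover have "D \<in> borel_measurable borel"
    using D(1) measurable_cong_sets[OF T(2) refl, of borel] by auto
  ultimately show thesis using that D eq by blast
qed

text \<open>Each coordinate of \<open>L\<close> is a difference of two finite measures. Adding
  \<open>\<mu>\<close> to this finite family before choosing a dominating \<open>T\<close> yields
  densities for the flux and for \<open>\<mu>\<close> with respect to the same measure, so that they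
  can be compared pointwise. The representation is confined to fields with compact support in
  \<open>U\<close>, since on other bounded fields \<open>L\<close> may see behaviour at infinity or
  at the boundary.\<close>

lemma riesz_vector:
  fixes L :: "('a::euclidean_space \<Rightarrow>\<^sub>C 'b::euclidean_space) \<Rightarrow> real" and \<mu> :: "'a measure"
  assumes U: "open U" and L: "linear L" and bound: "\<And>\<psi>. L \<psi> \<le> B * norm \<psi>"
    and \<mu>: "sets \<mu> = sets borel" "finite_measure \<mu>" "emeasure \<mu> (- U) = 0"
  obtains T k H where "sets T = sets borel" "finite_measure T" "emeasure T (- U) = 0"
    "k \<in> borel_measurable borel" "\<And>z. 0 \<le> k z" "integrable T k" "\<mu> = density T (\<lambda>z. ennreal (k z))"
    "H \<in> borel_measurable borel" "integrable T H"
    "\<And>\<psi>. apply_bcontfun \<psi> \<in> Cc U \<Longrightarrow> L \<psi> = (\<integral>z. \<psi> z \<bullet> H z \<partial>T)"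
proof -
  define emb where "emb b f = Bcontfun (\<lambda>z. f z *\<^sub>R b)" for b :: 'b and f :: "'a \<Rightarrow> real"
  have emb: "apply_bcontfun (emb b f) z = f z *\<^sub>R b" if "f \<in> Cc U" for b f z
  proof -
    have "(\<lambda>z. f z *\<^sub>R b) \<in> Cc U"
      by (rule Cc_compose[OF that]) (auto intro!: continuous_intros CcD(1)[OF that])
    then show ?thesis unfolding emb_def by (simp add: Bcontfun_inverse Cc_bcontfun)
  qed
  define Q where "Q b M N \<longleftrightarrow> sets M = sets borel \<and> finite_measure M \<and> emeasure M (- U) = 0 \<and>
    sets N = sets borel \<and> finite_measure N \<and> emeasure N (- U) = 0 \<and>
    (\<forall>f\<in>Cc U. L (emb b f) = integral\<^sup>L M f - integral\<^sup>L N f)" for b M N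
  have "\<exists>M N. Q b M N" if b: "b \<in> Basis" for b
    unfolding Q_def
  proof (rule riesz_signed[OF U, of "\<lambda>f. L (emb b f)" "\<bar>B\<bar>"])
    fix f g :: "'a \<Rightarrow> real" assume fg: "f \<in> Cc U" "g \<in> Cc U"
    have "emb b (\<lambda>x. f x + g x) = emb b f + emb b g"
      by (rule bcontfun_eqI) (simp add: emb fg Cc_add algebra_simps)
    then show "L (emb b (\<lambda>x. f x + g x)) = L (emb b f) + L (emb b g)"
      by (simp add: linear_add[OF L])
  next
    fix f :: "'a \<Rightarrow> real" and c :: real assume f: "f \<in> Cc U"
    have "emb b (\<lambda>x. c * f x) = c *\<^sub>R emb b f"
      by (rule bcontfun_eqI) (simp add: emb f Cc_scale[OF f f])
    then show "L (emb b (\<lambda>x. c * f x)) = c * L (emb b f)"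
      by (simp add: linear_scale[OF L])
    assume c: "\<And>x. \<bar>f x\<bar> \<le> c"
    have n: "norm (emb b f) \<le> c"
      by (rule norm_bound) (use c b in \<open>simp add: emb f\<close>)
    have "L (emb b f) \<le> \<bar>B\<bar> * norm (emb b f)"
      using bound[of "emb b f"] mult_right_mono[OF abs_ge_self norm_ge_zero, of B "emb b f"] by linarith
    also have "\<dots> \<le> \<bar>B\<bar> * c" using n by (intro mult_left_mono) auto
    finally show "L (emb b f) \<le> \<bar>B\<bar> * c" .
  qed
  then obtain M N where "\<And>b. b \<in> Basis \<Longrightarrow> Q b (M b) (N b)" by metis
  then have MN: "sets (M b) = sets borel" "finite_measure (M b)" "emeasure (M b) (- U) = 0"
    "sets (N b) = sets borel" "finite_measure (N b)" "emeasure (N b) (- U) = 0"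
    "\<And>f. f \<in> Cc U \<Longrightarrow> L (emb b f) = integral\<^sup>L (M b) f - integral\<^sup>L (N b) f" if "b \<in> Basis" for b
    using that by (simp_all add: Q_def)
  \<comment> \<open>The index \<open>None\<close> stands for \<open>\<mu>\<close>;
    \<open>Some (b, s)\<close> stands for the positive or negative measure of the coordinate
    \<open>b\<close>.\<close>
  define F where "F i = (case i of None \<Rightarrow> \<mu> | Some (b, s) \<Rightarrow> if s then M b else N b)" for i
  define IX :: "('b \<times> bool) option set" where "IX = insert None (Some ` (Basis \<times> UNIV))"
  have Fs: "sets (F i) = sets borel" "finite_measure (F i)" "emeasure (F i) (- U) = 0" if "i \<in> IX" for i
    using that MN(1-6) \<mu> by (force simp: IX_def F_def split: if_splits)+
  have "finite IX" by (simp add: IX_def)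
  obtain T where T: "sets T = sets borel" "finite_measure T"
    "\<And>i. i \<in> IX \<Longrightarrow> absolutely_continuous T (F i)" "emeasure T (- U) = 0"
    using dominating_finite_measure[of IX F, OF \<open>finite IX\<close> Fs(1,2)] U Fs(3)
    by (metis borel_closed closed_Compl)
  have IXin: "None \<in> IX" "b \<in> Basis \<Longrightarrow> Some (b, s) \<in> IX" for b s by (auto simp: IX_def)
  obtain k where k: "k \<in> borel_measurable borel" "\<And>x. 0 \<le> k x" "\<mu> = density T (\<lambda>x. ennreal (k x))"
    "integrable T k"
    using real_density_exists[OF T(2,1) \<mu>(2,1)] T(3)[OF IXin(1)] by (auto simp: F_def)
  have "\<exists>D :: 'a \<Rightarrow> real. D \<in> borel_measurable borel \<and> (\<forall>x. 0 \<le> D x) \<and> F i = density T (\<lambda>x. ennreal (D x)) \<and> integrable T D"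
    if "i \<in> IX" for i
    using real_density_exists[OF T(2,1) Fs(2,1) T(3), OF that that that] by metis
  then obtain D where D: "\<And>i. i \<in> IX \<Longrightarrow> D i \<in> borel_measurable borel" "\<And>i x. i \<in> IX \<Longrightarrow> 0 \<le> D i x"
    "\<And>i. i \<in> IX \<Longrightarrow> F i = density T (\<lambda>x. ennreal (D i x))" "\<And>i. i \<in> IX \<Longrightarrow> integrable T (D i)"
    by metis
  define H where "H z = (\<Sum>b\<in>Basis. (D (Some (b, True)) z - D (Some (b, False)) z) *\<^sub>R b)" for z
  have H: "H \<in> borel_measurable borel" "integrable T H"
    unfolding H_def using D(1,4) IXin(2)
    by (auto intro!: borel_measurable_sum borel_measurable_scaleR borel_measurable_diff
        Bochner_Integration.integrable_sum integrable_scaleR_left Bochner_Integration.integrable_diff)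
  have rep: "L \<psi> = (\<integral>z. \<psi> z \<bullet> H z \<partial>T)" if \<psi>: "apply_bcontfun \<psi> \<in> Cc U" for \<psi>
  proof -
    have c: "(\<lambda>z. \<psi> z \<bullet> b) \<in> Cc U" for b
      by (rule Cc_compose[OF \<psi>]) (auto intro!: continuous_intros CcD(1)[OF \<psi>])
    have "\<psi> = (\<Sum>b\<in>Basis. emb b (\<lambda>z. \<psi> z \<bullet> b))"
    proof (rule bcontfun_eqI)
      fix z
      have "apply_bcontfun (\<Sum>b\<in>S. emb b (\<lambda>z. \<psi> z \<bullet> b)) z = (\<Sum>b\<in>S. (\<psi> z \<bullet> b) *\<^sub>R b)" for S
        by (induction S rule: infinite_finite_induct) (auto simp: emb[OF c])
      then show "\<psi> z = apply_bcontfun (\<Sum>b\<in>Basis. emb b (\<lambda>z. \<psi> z \<bullet> b)) z"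
        by (simp add: euclidean_representation)
    qed
    then have "L \<psi> = (\<Sum>b\<in>Basis. L (emb b (\<lambda>z. \<psi> z \<bullet> b)))"
      using linear_sum[OF L] by metis
    also have "\<dots> = (\<Sum>b\<in>Basis. \<integral>z. (\<psi> z \<bullet> b) * (H z \<bullet> b) \<partial>T)"
    proof (rule sum.cong[OF refl])
      fix b :: 'b assume b: "b \<in> Basis"
      have val: "integral\<^sup>L (F i) f = (\<integral>z. D i z * f z \<partial>T)" "integrable T (\<lambda>z. D i z * f z)"
        if i: "i \<in> IX" and f: "f \<in> Cc U" for i f
      proof -
        have fm: "f \<in> borel_measurable T" "D i \<in> borel_measurable T"
          using borel_measurable_continuous_onI[OF CcD(1)[OF f]] D(1)[OF i] measurable_cong_sets[OF T(1) refl, of borel]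
          by auto
        show "integral\<^sup>L (F i) f = (\<integral>z. D i z * f z \<partial>T)"
          unfolding D(3)[OF i] using fm D(2)[OF i] by (subst integral_density) auto
        have "integrable (F i) f" by (rule integrable_Cc[OF f Fs(2,1)[OF i]])
        then show "integrable T (\<lambda>z. D i z * f z)"
          unfolding D(3)[OF i] using fm D(2)[OF i] by (subst (asm) integrable_density) auto
      qed
      have "L (emb b (\<lambda>z. \<psi> z \<bullet> b)) = integral\<^sup>L (F (Some (b, True))) (\<lambda>z. \<psi> z \<bullet> b)
          - integral\<^sup>L (F (Some (b, False))) (\<lambda>z. \<psi> z \<bullet> b)"
        using MN(7)[OF b c] by (simp add: F_def)
      also have "\<dots> = (\<integral>z. D (Some (b, True)) z * (\<psi> z \<bullet> b) - D (Some (b, False)) z * (\<psi> z \<bullet> b) \<partial>T)"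
        using val[OF IXin(2)[OF b] c] by simp
      also have "\<dots> = (\<integral>z. (\<psi> z \<bullet> b) * (H z \<bullet> b) \<partial>T)"
      proof (rule Bochner_Integration.integral_cong[OF refl])
        fix z
        have H_b: "H z \<bullet> b = D (Some (b, True)) z - D (Some (b, False)) z"
          unfolding H_def using b by (simp add: inner_sum_left_Basis)
        show "D (Some (b, True)) z * (\<psi> z \<bullet> b) - D (Some (b, False)) z * (\<psi> z \<bullet> b) = (\<psi> z \<bullet> b) * (H z \<bullet> b)"
          unfolding H_b by (simp add: algebra_simps)
      qed
      finally show "L (emb b (\<lambda>z. \<psi> z \<bullet> b)) = (\<integral>z. (\<psi> z \<bullet> b) * (H z \<bullet> b) \<partial>T)" .
    qed
    also have "\<dots> = (\<integral>z. (\<Sum>b\<in>Basis. (\<psi> z \<bullet> b) * (H z \<bullet> b)) \<partial>T)"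
    proof (rule Bochner_Integration.integral_sum[symmetric])
      fix b :: 'b assume b: "b \<in> Basis"
      obtain K where K: "\<And>z. \<bar>\<psi> z \<bullet> b\<bar> \<le> K"
        using bounded_range_Cc[OF c[of b]] by (auto simp: bounded_iff)
      show "integrable T (\<lambda>z. (\<psi> z \<bullet> b) * (H z \<bullet> b))"
      proof (rule Bochner_Integration.integrable_bound)
        show "integrable T (\<lambda>z. K * (H z \<bullet> b))" using H(2) by auto
        show "(\<lambda>z. (\<psi> z \<bullet> b) * (H z \<bullet> b)) \<in> borel_measurable T"
          unfolding measurable_cong_sets[OF T(1) refl]
          by (intro borel_measurable_times borel_measurable_continuous_onI[OF CcD(1)[OF c]]
              borel_measurable_inner[OF H(1)] borel_measurable_const)
        show "AE z in T. norm ((\<psi> z \<bullet> b) * (H z \<bullet> b)) \<le> norm (K * (H z \<bullet> b))"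
        proof (rule AE_I2)
          fix z
          have "\<bar>\<psi> z \<bullet> b\<bar> \<le> \<bar>K\<bar>" using K[of z] by linarith
          then show "norm ((\<psi> z \<bullet> b) * (H z \<bullet> b)) \<le> norm (K * (H z \<bullet> b))"
            by (simp add: abs_mult mult_right_mono)
        qed
      qed
    qed
    also have "\<dots> = (\<integral>z. \<psi> z \<bullet> H z \<partial>T)"
      by (intro Bochner_Integration.integral_cong refl) (rule euclidean_inner[symmetric])
    finally show ?thesis .
  qed
  show thesis by (rule that[OF T(1,2,4) k(1,2,4,3) H rep])
qed

section \<open>Affine minorants and the recession function\<close>

text \<open>Using the epigraph instead of the Legendre transform keeps all quantities real: a slope
  at which the transform is infinite contributes no pair.\<close>

definition affine_minorants :: "('a::real_inner \<Rightarrow> real) \<Rightarrow> ('a \<times> real) set" where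
  "affine_minorants W = {(r, c). \<forall>v. r \<bullet> v - c \<le> W v}"

lemma affine_minorantsD: "(r, c) \<in> affine_minorants W \<Longrightarrow> r \<bullet> v - c \<le> W v"
  by (simp add: affine_minorants_def)

lemma convex_affine_minorants: "convex (affine_minorants W)"
proof (rule convexI)
  fix x y and s t :: real
  assume x: "x \<in> affine_minorants W" and y: "y \<in> affine_minorants W" and st: "0 \<le> s" "0 \<le> t" "s + t = 1"
  have "(s *\<^sub>R fst x + t *\<^sub>R fst y) \<bullet> v - (s * snd x + t * snd y) \<le> W v" for v
  proof -
    have "s * (fst x \<bullet> v - snd x) + t * (fst y \<bullet> v - snd y) \<le> s * W v + t * W v"
      using x y st by (intro add_mono mult_left_mono) (auto simp: affine_minorants_def case_prod_unfold)
    also have "\<dots> = W v" using st(3) by (simp flip: distrib_right)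
    finally show ?thesis by (simp add: inner_add_left algebra_simps)
  qed
  then show "s *\<^sub>R x + t *\<^sub>R y \<in> affine_minorants W"
    by (simp add: affine_minorants_def case_prod_unfold)
qed

text \<open>The point \<open>(v, W v - e)\<close> is strictly separated from the closed convex
  epigraph. The hyperplane cannot be vertical, because the epigraph has a point above the same
  \<open>v\<close>; solving for the last coordinate gives the minorant.\<close>

lemma affine_minorants_approx:
  fixes W :: "'a::euclidean_space \<Rightarrow> real"
  assumes W: "convex_on UNIV W" and e: "0 < e"
  shows "\<exists>(r, c)\<in>affine_minorants W. W v - e < r \<bullet> v - c"
proof -
  have cW: "continuous_on UNIV W" using convex_on_continuous[OF open_UNIV W] .
  have "closed (epigraph UNIV W)"
    unfolding epigraph_def by (auto intro!: closed_Collect_le continuous_intros continuous_on_compose2[OF cW])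
  moreover have "convex (epigraph UNIV W)" using W by (simp add: convex_epigraph)
  moreover have "(v, W v - e) \<notin> epigraph UNIV W" using e by (simp add: epigraph_def)
  ultimately obtain a b where ab: "a \<bullet> (v, W v - e) < b" "\<And>x. x \<in> epigraph UNIV W \<Longrightarrow> b < a \<bullet> x"
    using separating_hyperplane_closed_point by metis
  obtain p s where a: "a = (p, s)" by (cases a)
  have lt: "b < p \<bullet> w + s * W w" for w
    using ab(2)[of "(w, W w)"] by (simp add: a epigraph_def)
  \<comment> \<open>Comparing the two sides of the hyperplane at the same base point
    \<open>v\<close> cancels the term with \<open>p\<close>.\<close>
  have "0 < s * e" using ab(1) lt[of v] by (simp add: a algebra_simps)
  then have s: "0 < s" using e by (simp add: zero_less_mult_iff)
  have "(- (1/s) *\<^sub>R p, - b / s) \<in> affine_minorants W"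
    unfolding affine_minorants_def using s lt by (auto simp: field_simps less_imp_le)
  moreover have "W v - e < (- (1/s) *\<^sub>R p) \<bullet> v - (- b / s)"
    using ab(1) s by (simp add: a field_simps)
  ultimately show ?thesis by blast
qed

lemma affine_minorants_zero: "(\<And>v. 0 \<le> W v) \<Longrightarrow> (0, 0) \<in> affine_minorants W"
  by (simp add: affine_minorants_def)

lemma SUP_ennreal_dense:
  fixes f :: "'a::first_countable_topology \<Rightarrow> real"
  assumes f: "continuous_on UNIV f" and S: "S \<subseteq> A" "A \<subseteq> closure S"
  shows "(SUP a\<in>A. ennreal (f a)) = (SUP a\<in>S. ennreal (f a))"
proof (rule antisym)
  show "(SUP a\<in>A. ennreal (f a)) \<le> (SUP a\<in>S. ennreal (f a))"
  proof (rule SUP_least)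
    fix a assume "a \<in> A"
    then have "a \<in> closure S" using S by auto
    then obtain x where x: "\<And>n. x n \<in> S" "x \<longlonglongrightarrow> a" by (auto simp: closure_sequential)
    have "(\<lambda>n. f (x n)) \<longlonglongrightarrow> f a"
      by (rule continuous_on_tendsto_compose[OF f x(2)]) auto
    then have "(\<lambda>n. ennreal (f (x n))) \<longlonglongrightarrow> ennreal (f a)" by (rule tendsto_ennrealI)
    then show "ennreal (f a) \<le> (SUP a\<in>S. ennreal (f a))"
      by (rule LIMSEQ_le_const2) (auto intro!: exI[of _ 0] SUP_upper x)
  qed
qed (use S in \<open>auto intro!: SUP_subset_mono\<close>)

text \<open>Countability makes the suprema measurable and reachable by finite maxima. Placing
  \<open>(0, 0)\<close> at index 0 makes all these finite maxima nonnegative.\<close>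

lemma countable_affine_minorants:
  fixes W :: "'a::euclidean_space \<Rightarrow> real"
  assumes "\<And>v. 0 \<le> W v"
  obtains s :: "nat \<Rightarrow> 'a \<times> real" where "s 0 = (0, 0)" "range s \<subseteq> affine_minorants W"
    "affine_minorants W \<subseteq> closure (range s)"
proof -
  obtain T where T: "countable T" "T \<subseteq> affine_minorants W" "affine_minorants W \<subseteq> closure T"
    using separable by metis
  have z: "(0, 0) \<in> affine_minorants W" by (rule affine_minorants_zero) (rule assms)
  then have "T \<noteq> {}" using T(3) by auto
  define s where "s n = (case n of 0 \<Rightarrow> (0, 0) | Suc k \<Rightarrow> from_nat_into T k)" for n
  have "range (from_nat_into T) = T" using T(1) \<open>T \<noteq> {}\<close> by (rule range_from_nat_into[rotated])
  then have "T \<subseteq> range s"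
  proof -
    have "t \<in> range s" if "t \<in> T" for t
    proof -
      have "t \<in> range (from_nat_into T)" using \<open>range (from_nat_into T) = T\<close> that by simp
      then obtain k where "t = from_nat_into T k" by blast
      then have "t = s (Suc k)" by (simp add: s_def)
      then show ?thesis by blast
    qed
    then show ?thesis by blast
  qed
  show thesis
  proof (rule that)
    show "s 0 = (0, 0)" by (simp add: s_def)
    show "range s \<subseteq> affine_minorants W"
      using subsetD[OF T(2) from_nat_into[OF \<open>T \<noteq> {}\<close>]] z
      by (intro image_subsetI) (simp add: s_def split: nat.split)
    show "affine_minorants W \<subseteq> closure (range s)"
      using T(3) closure_mono[OF \<open>T \<subseteq> range s\<close>] by (rule order_trans)
  qed
qed

text \<open>Evaluate the affine minorants at \<open>(1/k) *\<^sub>R H\<close> and multiply by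
  \<open>k\<close>. The index set no longer depends on \<open>k\<close>, and the right-hand side
  keeps its meaning at \<open>k = 0\<close>.\<close>

lemma perspective_eq_SUP:
  fixes W :: "'a::euclidean_space \<Rightarrow> real"
  assumes W: "convex_on UNIV W" and k: "0 < k"
  shows "ennreal (k * W ((1/k) *\<^sub>R H)) = (SUP p\<in>affine_minorants W. ennreal (fst p \<bullet> H - k * snd p))"
proof (rule antisym)
  show "ennreal (k * W ((1/k) *\<^sub>R H)) \<le> (SUP p\<in>affine_minorants W. ennreal (fst p \<bullet> H - k * snd p))"
  proof (rule ennreal_le_epsilon)
    fix e :: real assume e: "0 < e"
    obtain r c where rc: "(r, c) \<in> affine_minorants W" "W ((1/k) *\<^sub>R H) - e / k < r \<bullet> ((1/k) *\<^sub>R H) - c"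
      using affine_minorants_approx[OF W, of "e / k"] e k by fastforce
    have "k * (W ((1/k) *\<^sub>R H) - e / k) < k * (r \<bullet> ((1/k) *\<^sub>R H) - c)"
      using rc(2) k by (rule mult_strict_left_mono)
    then have "k * W ((1/k) *\<^sub>R H) \<le> (r \<bullet> H - k * c) + e"
      using k by (simp add: algebra_simps)
    then have "ennreal (k * W ((1/k) *\<^sub>R H)) \<le> ennreal (max 0 (r \<bullet> H - k * c) + e)"
      by (intro ennreal_leI) auto
    also have "\<dots> = ennreal (r \<bullet> H - k * c) + ennreal e"
      using e by (simp add: ennreal_plus max_def ennreal_neg)
    also have "ennreal (r \<bullet> H - k * c) \<le> (SUP p\<in>affine_minorants W. ennreal (fst p \<bullet> H - k * snd p))"
      by (rule SUP_upper2[OF rc(1)]) simp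
    finally show "ennreal (k * W ((1/k) *\<^sub>R H)) \<le> (SUP p\<in>affine_minorants W. ennreal (fst p \<bullet> H - k * snd p)) + ennreal e"
      by (simp add: add_right_mono)
  qed
  show "(SUP p\<in>affine_minorants W. ennreal (fst p \<bullet> H - k * snd p)) \<le> ennreal (k * W ((1/k) *\<^sub>R H))"
  proof (intro SUP_least ennreal_leI)
    fix p assume "p \<in> affine_minorants W"
    then have "fst p \<bullet> ((1/k) *\<^sub>R H) - snd p \<le> W ((1/k) *\<^sub>R H)"
      by (intro affine_minorantsD) simp
    then have "k * (fst p \<bullet> ((1/k) *\<^sub>R H) - snd p) \<le> k * W ((1/k) *\<^sub>R H)"
      using k by (intro mult_left_mono) auto
    then show "fst p \<bullet> H - k * snd p \<le> k * W ((1/k) *\<^sub>R H)"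
      using k by (simp add: algebra_simps)
  qed
qed

text \<open>From below, every minorant gives
  \<open>W (t *\<^sub>R v) / t \<ge> r \<bullet> v - c / t\<close>. From above,
  \<open>W (t *\<^sub>R v) / t\<close> is the perspective at \<open>k = 1/t\<close>, and
  \<open>- c \<le> W 0\<close> (the minorant evaluated at 0) bounds it by the supremum plus
  \<open>W 0 / t\<close>, uniformly over the pairs. This also shows that the limit in the definition
  exists.\<close>

lemma recession_eq_SUP:
  fixes W :: "real^'d::finite^'q::finite \<Rightarrow> real"
  assumes W: "convex_on UNIV W" and W0: "\<And>v. 0 \<le> W v"
  shows "recession W v = (SUP p\<in>affine_minorants W. ennreal (fst p \<bullet> v))"
proof -
  define S where "S = (SUP p\<in>affine_minorants W. ennreal (fst p \<bullet> v))"
  have "((\<lambda>t. ennreal (W (t *\<^sub>R v) / t)) \<longlongrightarrow> S) at_top"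
  proof (rule order_tendstoI)
    fix a assume "a < S"
    then obtain r c where rc: "(r, c) \<in> affine_minorants W" "a < ennreal (r \<bullet> v)"
      unfolding S_def by (force simp: less_SUP_iff)
    have "((\<lambda>t. ennreal (r \<bullet> v - c / t)) \<longlongrightarrow> ennreal (r \<bullet> v - 0)) at_top"
      by (intro tendsto_ennrealI tendsto_diff tendsto_const tendsto_divide_0[OF tendsto_const]
          filterlim_at_top_imp_at_infinity filterlim_ident)
    then have "\<forall>\<^sub>F t in at_top. a < ennreal (r \<bullet> v - c / t)"
      using rc(2) by (intro order_tendstoD) auto
    then show "\<forall>\<^sub>F t in at_top. a < ennreal (W (t *\<^sub>R v) / t)"
      using eventually_gt_at_top[of 0]
    proof eventually_elim
      case (elim t)
      have "r \<bullet> v - c / t \<le> W (t *\<^sub>R v) / t"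
        using divide_right_mono[OF affine_minorantsD[OF rc(1), of "t *\<^sub>R v"], of t] elim
        by (simp add: diff_divide_distrib)
      then show ?case using less_le_trans[OF elim(1) ennreal_leI] by simp
    qed
  next
    fix a assume a: "S < a"
    have "((\<lambda>t. S + ennreal (W 0 / t)) \<longlongrightarrow> S + ennreal 0) at_top"
      by (intro tendsto_ennrealI tendsto_add tendsto_const tendsto_divide_0[OF tendsto_const]
          filterlim_at_top_imp_at_infinity filterlim_ident)
    then have "\<forall>\<^sub>F t in at_top. S + ennreal (W 0 / t) < a"
      using a by (intro order_tendstoD) auto
    then show "\<forall>\<^sub>F t in at_top. ennreal (W (t *\<^sub>R v) / t) < a"
      using eventually_gt_at_top[of 0]
    proof eventually_elim
      case (elim t)
      have "ennreal (W (t *\<^sub>R v) / t) = (SUP p\<in>affine_minorants W. ennreal (fst p \<bullet> v - (1/t) * snd p))"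
        using perspective_eq_SUP[OF W, of "1/t" v] elim by simp
      also have "\<dots> \<le> S + ennreal (W 0 / t)"
      proof (rule SUP_least)
        fix p assume p: "p \<in> affine_minorants W"
        then have "- snd p \<le> W 0" using affine_minorantsD[of "fst p" "snd p" W 0] by simp
        then have "(- snd p) / t \<le> W 0 / t" using elim by (intro divide_right_mono) auto
        then have "ennreal (fst p \<bullet> v - (1/t) * snd p) \<le> ennreal (max 0 (fst p \<bullet> v) + W 0 / t)"
          by (intro ennreal_leI) auto
        also have "\<dots> = ennreal (fst p \<bullet> v) + ennreal (W 0 / t)"
          using elim W0[of 0] by (subst ennreal_plus) (auto simp: max_def ennreal_neg)
        also have "ennreal (fst p \<bullet> v) \<le> S" unfolding S_def by (rule SUP_upper[OF p])
        finally show "ennreal (fst p \<bullet> v - (1/t) * snd p) \<le> S + ennreal (W 0 / t)"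
          by (simp add: add_right_mono)
      qed
      finally show ?case using elim(1) by (rule le_less_trans)
    qed
  qed
  then show ?thesis
    unfolding recession_def S_def[symmetric]
    by (intro the_equality) (auto intro: tendsto_unique[OF trivial_limit_at_top_linorder])
qed

lemma scaled_recession_eq_SUP:
  fixes W :: "real^'d::finite^'q::finite \<Rightarrow> real"
  assumes W: "convex_on UNIV W" and W0: "\<And>v. 0 \<le> W v" and a: "0 < a"
  shows "ennreal a * recession W ((1/a) *\<^sub>R v) = (SUP p\<in>affine_minorants W. ennreal (fst p \<bullet> v))"
proof -
  have "ennreal a * recession W ((1/a) *\<^sub>R v)
      = (SUP p\<in>affine_minorants W. ennreal a * ennreal (fst p \<bullet> ((1/a) *\<^sub>R v)))"
    unfolding recession_eq_SUP[OF W W0] by (rule SUP_mult_left_ennreal)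
  also have "\<dots> = (SUP p\<in>affine_minorants W. ennreal (fst p \<bullet> v))"
    using a by (intro SUP_cong refl) (simp flip: ennreal_mult')
  finally show ?thesis .
qed

text \<open>\<open>N\<close> is convex, hence continuous, and attains a positive minimum on the unit
  sphere; that minimum is the constant.\<close>

lemma is_norm_lower_bound:
  fixes N :: "'a::euclidean_space \<Rightarrow> real"
  assumes N: "is_norm N"
  obtains a where "0 < a" "\<And>v. a * norm v \<le> N v"
proof -
  have hom: "N (c *\<^sub>R x) = \<bar>c\<bar> * N x" and tri: "N (x + y) \<le> N x + N y" and z: "N x = 0 \<longleftrightarrow> x = 0" for c x y
    using N by (auto simp: is_norm_def)
  have nonneg: "0 \<le> N x" for x
    using tri[of x "- x"] hom[of "- 1" x] z[of 0] by simp
  have "convex_on UNIV N"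
  proof (rule convex_onI)
    fix t :: real and x y assume "0 < t" "t < 1"
    then show "N ((1 - t) *\<^sub>R x + t *\<^sub>R y) \<le> (1 - t) * N x + t * N y"
      using tri[of "(1 - t) *\<^sub>R x" "t *\<^sub>R y"] by (simp add: hom)
  qed simp
  then have "continuous_on (sphere 0 1) N"
    using convex_on_continuous[of UNIV N] by (auto intro: continuous_on_subset)
  moreover have "sphere (0::'a) 1 \<noteq> {}" by simp
  ultimately obtain u where u: "u \<in> sphere 0 1" "\<And>x. x \<in> sphere 0 1 \<Longrightarrow> N u \<le> N x"
    using continuous_attains_inf[of "sphere 0 1" N] by (metis compact_sphere)
  have "u \<noteq> 0" using u(1) by auto
  then have "0 < N u" using nonneg[of u] z[of u] by simp
  moreover have "N u * norm v \<le> N v" for v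
  proof (cases "v = 0")
    case False
    then have "N u \<le> N ((1 / norm v) *\<^sub>R v)" by (intro u(2)) simp
    then show ?thesis using False by (simp add: hom field_simps)
  qed (simp add: nonneg)
  ultimately show thesis by (rule that)
qed

text \<open>Linear growth of \<open>W\<close> is boundedness of its Legendre transform near 0. This
  is the only form in which the growth condition enters: it makes the set to be separated absorbing
  and the resulting functional bounded.\<close>

lemma assumptionB_ball:
  fixes W :: "real^'d::finite^'q::finite \<Rightarrow> real"
  assumes "assumptionB W"
  obtains \<delta> K where "0 < \<delta>" "\<And>r. norm r \<le> \<delta> \<Longrightarrow> (r, K) \<in> affine_minorants W"
proof -
  obtain p C1 C2 N where *: "1 \<le> p" "C1 > 0" "C2 \<ge> 0" "is_norm N" "\<And>v. W v \<ge> C1 * N v powr p - C2"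
    using assms by (auto simp: assumptionB_def)
  obtain a where a: "0 < a" "\<And>v. a * norm v \<le> N v" using is_norm_lower_bound[OF *(4)] by blast
  have pw: "x - 1 \<le> x powr p" if "0 \<le> x" for x :: real
  proof (cases "1 \<le> x")
    case True
    then show ?thesis using powr_mono[OF *(1) True] by simp
  next
    case False
    then show ?thesis using powr_ge_zero[of x p] by linarith
  qed
  show thesis
  \<comment> \<open>Since \<open>x - 1 \<le> x powr p\<close>, the growth condition gives
    \<open>W v \<ge> C1 * a * norm v - (C1 + C2)\<close>, which yields both constants.\<close>
  proof (rule that[of "C1 * a" "C1 + C2"])
    fix r :: "real^'d^'q" assume r: "norm r \<le> C1 * a"
    have "r \<bullet> v - (C1 + C2) \<le> W v" for v
    proof -
      have "0 \<le> a * norm v" using a(1) by simp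
      then have nv: "0 \<le> N v" using a(2)[of v] by linarith
      have "r \<bullet> v \<le> norm r * norm v" by (rule norm_cauchy_schwarz)
      also have "\<dots> \<le> C1 * (a * norm v)" using r by (simp add: mult_right_mono flip: mult.assoc)
      also have "\<dots> \<le> C1 * N v" using a(2)[of v] *(2) by simp
      also have "\<dots> \<le> C1 * (N v powr p + 1)" using pw[OF nv] *(2) by (intro mult_left_mono) auto
      also have "\<dots> \<le> W v + C1 + C2" using *(5)[of v] by (simp add: algebra_simps)
      finally show ?thesis by simp
    qed
    then show "(r, C1 + C2) \<in> affine_minorants W" by (simp add: affine_minorants_def)
  qed (use a * in auto)
qed

section \<open>The Legendre transform in terms of affine minorants\<close>

lemma legendre_le_iff: "legendre W r \<le> ereal c \<longleftrightarrow> (r, c) \<in> affine_minorants W"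
  by (simp add: legendre_def SUP_le_iff affine_minorants_def algebra_simps)

lemma legendre_finiteD:
  assumes "legendre W r < \<infinity>"
  shows "\<exists>c. (r, c) \<in> affine_minorants W"
  using assms less_PInf_Ex_of_nat[of "legendre W r"] by (auto simp flip: legendre_le_iff intro: less_imp_le)

lemma legendre_ge: "ereal (r \<bullet> v - W v) \<le> legendre W r"
  by (auto simp: legendre_def intro: SUP_upper)

section \<open>Suprema of measures\<close>

text \<open>By compactness and monotonicity a single approximating function exceeds 1/2 on all of
  \<open>K\<close>; doubling it and cutting at 1 gives the value 1 there.\<close>

lemma Cc_urysohn:
  fixes V :: "'a::euclidean_space set"
  assumes V: "open V" and K: "compact K" "K \<subseteq> V"
  obtains f :: "'a \<Rightarrow> real" where "f \<in> Cc V" "\<And>x. 0 \<le> f x" "\<And>x. x \<in> K \<Longrightarrow> f x = 1"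
proof -
  obtain f :: "nat \<Rightarrow> 'a \<Rightarrow> real" where f: "\<And>n. f n \<in> Cc V" "\<And>n x. 0 \<le> f n x" "\<And>n x. f n x \<le> 1"
    "\<And>m n x. m \<le> n \<Longrightarrow> f m x \<le> f n x" "\<And>x. x \<in> V \<Longrightarrow> \<exists>n. f n x = 1"
    using Cc_approx_open[OF V] by blast
  have "K \<subseteq> (\<Union>n. {x. 1/2 < f n x})"
  proof
    fix x assume "x \<in> K"
    then obtain n where "f n x = 1" using f(5) K(2) by blast
    then have "x \<in> {x. 1/2 < f n x}" by simp
    then show "x \<in> (\<Union>n. {x. 1/2 < f n x})" by blast
  qed
  moreover have "open {x. 1/2 < f n x}" for n
    using CcD(1)[OF f(1)] by (intro open_Collect_less) auto
  ultimately obtain J where J: "finite J" "K \<subseteq> (\<Union>n\<in>J. {x. 1/2 < f n x})"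
    using K(1) compactE_image[of K UNIV "\<lambda>n. {x. 1/2 < f n x}"] by metis
  obtain N where N: "\<And>n. n \<in> J \<Longrightarrow> n \<le> N" using J(1) by (metis finite_nat_set_iff_bounded_le)
  have half: "1/2 < f N x" if x: "x \<in> K" for x
  proof -
    obtain j where "j \<in> J" "1/2 < f j x" using J(2) x by blast
    then show ?thesis using f(4)[OF N, of j x] by linarith
  qed
  show thesis
  proof (rule that[of "\<lambda>x. min 1 (2 * f N x)"])
    show "(\<lambda>x. min 1 (2 * f N x)) \<in> Cc V"
      by (rule Cc_compose[OF f(1)[of N]]) (auto intro!: continuous_on_min continuous_intros CcD(1)[OF f(1)])
    show "min 1 (2 * f N x) = 1" if "x \<in> K" for x using half[OF that] by simp
  qed (use f(2) in auto)
qed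

text \<open>\<open>V i\<close> omits the other compact sets, so the cut-off for \<open>K i\<close>
  vanishes on them. Dividing by the maximum of 1 and the sum bounds the total by 1 and changes
  nothing on the \<open>K j\<close>, where the sum is already 1.\<close>

lemma partition_of_unity_disjoint_compacts:
  fixes K :: "nat \<Rightarrow> 'a::euclidean_space set"
  assumes U: "open U" and K: "\<And>i. i < n \<Longrightarrow> compact (K i)" "\<And>i. i < n \<Longrightarrow> K i \<subseteq> U"
    and disj: "\<And>i j. i < n \<Longrightarrow> j < n \<Longrightarrow> i \<noteq> j \<Longrightarrow> K i \<inter> K j = {}"
  shows "\<exists>\<theta> :: nat \<Rightarrow> 'a \<Rightarrow> real. (\<forall>i<n. \<theta> i \<in> Cc U) \<and> (\<forall>i<n. \<forall>x. 0 \<le> \<theta> i x) \<and> (\<forall>x. (\<Sum>i<n. \<theta> i x) \<le> 1) \<and>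
    (\<forall>i<n. \<forall>j<n. \<forall>x\<in>K j. \<theta> i x = (if i = j then 1 else 0))"
proof -
  define V where "V i = U - (\<Union>j\<in>{..<n} - {i}. K j)" for i
  have Vo: "open (V i)" for i
    unfolding V_def using K(1) U by (intro open_Diff closed_UN) (auto intro: compact_imp_closed)
  have "\<exists>f. f \<in> Cc (V i) \<and> (\<forall>x. 0 \<le> (f x :: real)) \<and> (\<forall>x\<in>K i. f x = 1)" if i: "i < n" for i
  proof -
    have "K i \<subseteq> V i" using K(2)[OF i] disj[OF i] by (auto simp: V_def)
    then show ?thesis using Cc_urysohn[OF Vo K(1)[OF i]] by metis
  qed
  then obtain f :: "nat \<Rightarrow> 'a \<Rightarrow> real" where f: "\<And>i. i < n \<Longrightarrow> f i \<in> Cc (V i)" "\<And>i x. i < n \<Longrightarrow> 0 \<le> f i x"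
    "\<And>i x. i < n \<Longrightarrow> x \<in> K i \<Longrightarrow> f i x = 1"
    by metis
  have f0: "f i x = 0" if "i < n" "j < n" "i \<noteq> j" "x \<in> K j" for i j x
  proof -
    have "x \<notin> V i" using that by (auto simp: V_def)
    then show ?thesis using f(1)[OF that(1)] zero_outside_csupport[of x "f i"] by (auto simp: Cc_def)
  qed
  have fU: "f i \<in> Cc U" if "i < n" for i
    using f(1)[OF that] by (auto simp: Cc_def V_def)
  define s where "s x = max 1 (\<Sum>i<n. f i x)" for x
  have s1: "1 \<le> s x" for x by (simp add: s_def)
  have sc: "continuous_on UNIV s"
    unfolding s_def using CcD(1)[OF fU] by (intro continuous_on_max continuous_on_const continuous_on_sum) auto
  show ?thesis
  proof (intro exI[of _ "\<lambda>i x. f i x / s x"] conjI allI impI ballI)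
    show "(\<lambda>x. f i x / s x) \<in> Cc U" if "i < n" for i
    proof (rule Cc_compose[OF fU[OF that]])
      show "continuous_on UNIV (\<lambda>x. f i x / s x)"
        using s1 by (intro continuous_on_divide sc CcD(1)[OF fU[OF that]]) (metis not_one_le_zero)
    qed simp
    show "0 \<le> f i x / s x" if "i < n" for i x using f(2)[OF that] s1[of x] by simp
    show "(\<Sum>i<n. f i x / s x) \<le> 1" for x
    proof -
      have "(\<Sum>i<n. f i x) \<le> s x" by (simp add: s_def)
      then show ?thesis using s1[of x] by (simp add: sum_divide_distrib[symmetric] divide_le_eq_1)
    qed
    show "f i x / s x = (if i = j then 1 else 0)" if ij: "i < n" "j < n" "x \<in> K j" for i j x
    proof -
      have v: "f k x = (if k = j then 1 else 0)" if "k < n" for k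
        using f(3)[of j x] f0[OF that ij(2) _ ij(3)] ij by auto
      have "(\<Sum>k<n. f k x) = (\<Sum>k<n. if k = j then 1 else 0)" by (rule sum.cong) (auto simp: v)
      also have "\<dots> = 1" using ij(2) by simp
      finally show ?thesis using v[OF ij(1)] by (simp add: s_def)
    qed
  qed
qed

lemma compact_inner_approx:
  fixes R :: "'a::euclidean_space measure"
  assumes R: "sets R = sets borel" "finite_measure R" and E: "E \<in> sets borel" and e: "0 < e"
  obtains K where "compact K" "K \<subseteq> E" "measure R (E - K) \<le> e"
proof -
  interpret finite_measure R by fact
  have reg: "emeasure R E = (SUP K\<in>{K. K \<subseteq> E \<and> compact K}. emeasure R K)"
    by (rule inner_regular[OF R(1) _ E]) simp
  have "\<exists>K. K \<subseteq> E \<and> compact K \<and> measure R E \<le> measure R K + e"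
  proof (rule ccontr)
    assume n: "\<not> ?thesis"
    have *: "measure R K < measure R E - e" if "K \<subseteq> E" "compact K" for K
    proof -
      have "\<not> measure R E \<le> measure R K + e" using n that by blast
      then show ?thesis by linarith
    qed
    have "emeasure R E \<le> ennreal (measure R E - e)"
      unfolding reg
    proof (rule SUP_least)
      fix K assume "K \<in> {K. K \<subseteq> E \<and> compact K}"
      then have "measure R K \<le> measure R E - e" using *[of K] by simp
      then show "emeasure R K \<le> ennreal (measure R E - e)"
        unfolding emeasure_eq_measure by (rule ennreal_leI)
    qed
    moreover have "0 < measure R E - e" using *[of "{}"] by simp
    ultimately have "measure R E \<le> measure R E - e"
      unfolding emeasure_eq_measure by (subst (asm) ennreal_le_iff) auto
    then show False using e by simp
  qed
  then obtain K where K: "K \<subseteq> E" "compact K" "measure R E \<le> measure R K + e" by blast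
  have "measure R (E - K) = measure R E - measure R K"
    using K(1,2) E R(1) by (intro finite_measure_Diff) (auto simp: borel_compact)
  then show thesis using that K by simp
qed

text \<open>The maximum of finitely many \<open>G i\<close> is the sum of the \<open>G i\<close>
  times indicators of disjoint sets. Those indicators are replaced by continuous weights that agree
  with them on large compact subsets; the error is controlled by the integral of the sum of the
  \<open>\<bar>G i\<bar>\<close> over the small remainder. Monotone convergence passes to the full
  supremum.\<close>

lemma nn_integral_SUP_le_of_Cc:
  fixes T :: "'a::euclidean_space measure" and G :: "nat \<Rightarrow> 'a \<Rightarrow> real"
  assumes T: "sets T = sets borel" "finite_measure T" "emeasure T (- U) = 0" and U: "open U"
    and G: "\<And>i. G i \<in> borel_measurable borel" "\<And>i. integrable T (G i)" and G0: "\<And>z. G 0 z = 0"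
    and D: "\<And>n \<theta>. (\<And>i. i < n \<Longrightarrow> \<theta> i \<in> Cc U) \<Longrightarrow> (\<And>i x. i < n \<Longrightarrow> 0 \<le> \<theta> i x) \<Longrightarrow>
      (\<And>x. (\<Sum>i<n. \<theta> i x) \<le> 1) \<Longrightarrow> (\<Sum>i<n. \<integral>z. \<theta> i z * G i z \<partial>T) \<le> D"
  shows "(\<integral>\<^sup>+z. (SUP i. ennreal (G i z)) \<partial>T) \<le> ennreal D"
proof -
  interpret T: finite_measure T by fact
  have mT: "borel_measurable T = (borel_measurable borel :: ('a \<Rightarrow> real) set)"
    by (rule measurable_cong_sets[OF T(1) refl])
  have GT: "G i \<in> borel_measurable T" for i using G(1) by (simp add: mT)
  have AU: "AE z in T. z \<in> U"
  proof -
    have "- U \<in> null_sets T" using T U by (auto simp: null_sets_def)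
    then show ?thesis by (rule AE_I') auto
  qed
  have fin: "(\<integral>\<^sup>+z. (SUP i\<in>{..<n}. ennreal (G i z)) \<partial>T) \<le> ennreal D" if n: "0 < n" for n
  proof -
    \<comment> \<open>\<open>E i\<close> is where \<open>i\<close> is the least index at which the
      maximum is attained; breaking ties this way makes the sets disjoint. Since
      \<open>G 0 = 0\<close> takes part in the maximum, \<open>G i\<close> is nonnegative on
      \<open>E i\<close>.\<close>
    define E where "E i = {z \<in> U. (\<forall>j<n. G j z \<le> G i z) \<and> (\<forall>j<i. G j z < G i z)}" for i
    have Eb: "E i \<in> sets borel" for i
    proof -
      have "{z. G j z \<le> G i z} \<in> sets borel" "{z. G j z < G i z} \<in> sets borel" for j
        using G(1) by measurable
      moreover have "E i = U \<inter> (\<Inter>j\<in>{..<n}. {z. G j z \<le> G i z}) \<inter> (\<Inter>j\<in>{..<i}. {z. G j z < G i z})"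
        by (auto simp: E_def)
      ultimately show ?thesis using U n by (cases "i = 0") (auto intro!: sets.Int sets.finite_INT)
    qed
    have cover: "\<exists>i<n. z \<in> E i" if z: "z \<in> U" for z
    proof -
      define P where "P i \<longleftrightarrow> i < n \<and> (\<forall>j<n. G j z \<le> G i z)" for i
      have "Max ((\<lambda>i. G i z) ` {..<n}) \<in> (\<lambda>i. G i z) ` {..<n}" using n by (intro Max_in) auto
      then obtain k where k: "k < n" "Max ((\<lambda>i. G i z) ` {..<n}) = G k z" by auto
      then have "G j z \<le> G k z" if "j < n" for j
        unfolding k(2)[symmetric] using that by (intro Max_ge) auto
      then have "P k" using k by (simp add: P_def)
      then have L: "P (LEAST i. P i)" by (rule LeastI)
      have "G j z < G (LEAST i. P i) z" if j: "j < (LEAST i. P i)" for j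
      proof (rule ccontr)
        assume "\<not> ?thesis"
        then have "P j" using L j unfolding P_def by (meson less_trans not_less order_trans)
        then show False using not_less_Least[OF j] by simp
      qed
      then have "z \<in> E (LEAST i. P i)" using L z by (auto simp: E_def P_def)
      then show ?thesis using L by (auto simp: P_def)
    qed
    have Edisj: "E i \<inter> E j = {}" if "i < n" "j < n" "i \<noteq> j" for i j
    proof -
      have less: False if "z \<in> E i" "z \<in> E j" "i < j" "j < n" for z i j
      proof -
        have "G i z < G j z" "G j z \<le> G i z" using that by (auto simp: E_def)
        then show False by linarith
      qed
      show ?thesis using that less by (cases i j rule: linorder_cases) blast+
    qed
    have Epos: "0 \<le> G i z" if "z \<in> E i" for i z
      using that n G0 by (auto simp: E_def)
    define F where "F z = (\<Sum>i<n. indicator (E i) z * G i z)" for z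
    have Fterm: "0 \<le> indicator (E i) z * G i z" for i z
      using Epos[of z i] by (cases "z \<in> E i") auto
    have F0: "0 \<le> F z" for z unfolding F_def by (intro sum_nonneg Fterm)
    have SF: "(SUP i\<in>{..<n}. ennreal (G i z)) \<le> ennreal (F z)" if z: "z \<in> U" for z
    proof (intro SUP_least ennreal_leI)
      fix j assume "j \<in> {..<n}"
      obtain i where i: "i < n" "z \<in> E i" using cover[OF z] by blast
      then have "G j z \<le> indicator (E i) z * G i z" using \<open>j \<in> {..<n}\<close> by (auto simp: E_def)
      also have "\<dots> \<le> F z" unfolding F_def using i by (intro member_le_sum Fterm) auto
      finally show "G j z \<le> F z" .
    qed
    have Eint: "integrable T (\<lambda>z. indicator (E i) z * G i z)" for i
      using integrable_mult_indicator[OF _ G(2), of "E i" i] Eb T(1) by simp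
    then have Fint: "integrable T F" unfolding F_def by (intro Bochner_Integration.integrable_sum)
    have "integral\<^sup>L T F \<le> D"
    proof (rule field_le_epsilon)
      fix e :: real assume e: "0 < e"
      define w where "w z = (\<Sum>i<n. \<bar>G i z\<bar>)" for z
      have wint: "integrable T w" unfolding w_def using G(2) by (intro Bochner_Integration.integrable_sum integrable_abs)
      have wm: "w \<in> borel_measurable borel" unfolding w_def using G(1) by (intro borel_measurable_sum borel_measurable_abs)
      have w0: "0 \<le> w z" for z by (auto simp: w_def intro: sum_nonneg)
      \<comment> \<open>Inner regularity is applied to the weighted measure, since the \<open>G i\<close> need not be bounded.\<close>
      define R where "R = density T (\<lambda>z. ennreal (w z))"
      have sR: "sets R = sets borel" by (simp add: R_def T)
      have Rm: "measure R A = (\<integral>z. indicator A z * w z \<partial>T)" "emeasure R A = ennreal (\<integral>z. indicator A z * w z \<partial>T)" if A: "A \<in> sets borel" for A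
      proof -
        have i: "integrable T (\<lambda>z. indicator A z * w z)"
          using integrable_mult_indicator[OF _ wint, of A] A T(1) by simp
        have "emeasure R A = (\<integral>\<^sup>+z. ennreal (w z) * indicator A z \<partial>T)"
          unfolding R_def using wm A mT T(1) by (subst emeasure_density) auto
        also have "\<dots> = (\<integral>\<^sup>+z. ennreal (indicator A z * w z) \<partial>T)"
          by (intro nn_integral_cong) (simp split: split_indicator)
        also have "\<dots> = ennreal (\<integral>z. indicator A z * w z \<partial>T)"
          using i w0 by (intro nn_integral_eq_integral) auto
        finally show em: "emeasure R A = ennreal (\<integral>z. indicator A z * w z \<partial>T)" .
        then show "measure R A = (\<integral>z. indicator A z * w z \<partial>T)"
          using w0 by (simp add: measure_def integral_nonneg_AE)
      qed
      have "space R = UNIV" using sets_eq_imp_space_eq[OF sR] by simp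
      then have fR: "finite_measure R" using Rm(2)[of UNIV] by (intro finite_measureI) simp
      interpret R: finite_measure R by fact
      have en: "0 < e / n" using e n by simp
      have "\<exists>K. compact K \<and> K \<subseteq> E i \<and> measure R (E i - K) \<le> e / n" for i
        using compact_inner_approx[OF sR fR Eb en] by metis
      then obtain K where K: "\<And>i. compact (K i)" "\<And>i. K i \<subseteq> E i" "\<And>i. measure R (E i - K i) \<le> e / n"
        by metis
      have KU: "K i \<subseteq> U" for i using K(2)[of i] by (auto simp: E_def)
      have Kd: "K i \<inter> K j = {}" if "i < n" "j < n" "i \<noteq> j" for i j
        using Edisj[OF that] K(2)[of i] K(2)[of j] by blast
      have "\<exists>\<theta> :: nat \<Rightarrow> 'a \<Rightarrow> real. (\<forall>i<n. \<theta> i \<in> Cc U) \<and> (\<forall>i<n. \<forall>x. 0 \<le> \<theta> i x) \<and> (\<forall>x. (\<Sum>i<n. \<theta> i x) \<le> 1) \<and>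
        (\<forall>i<n. \<forall>j<n. \<forall>x\<in>K j. \<theta> i x = (if i = j then 1 else 0))"
        by (rule partition_of_unity_disjoint_compacts[OF U K(1) KU Kd])
      then obtain \<theta> :: "nat \<Rightarrow> 'a \<Rightarrow> real" where
        H: "(\<forall>i<n. \<theta> i \<in> Cc U) \<and> (\<forall>i<n. \<forall>x. 0 \<le> \<theta> i x) \<and> (\<forall>x. (\<Sum>i<n. \<theta> i x) \<le> 1) \<and>
        (\<forall>i<n. \<forall>j<n. \<forall>x\<in>K j. \<theta> i x = (if i = j then 1 else 0))" by (rule exE)
      have \<theta>: "\<And>i. i < n \<Longrightarrow> \<theta> i \<in> Cc U" "\<And>i x. i < n \<Longrightarrow> 0 \<le> \<theta> i x" "\<And>x. (\<Sum>i<n. \<theta> i x) \<le> 1"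
        "\<And>i j x. i < n \<Longrightarrow> j < n \<Longrightarrow> x \<in> K j \<Longrightarrow> \<theta> i x = (if i = j then 1 else 0)"
        using H by simp_all
      have \<theta>1: "\<theta> i x \<le> 1" if "i < n" for i x
      proof -
        have "\<theta> i x \<le> (\<Sum>i<n. \<theta> i x)" using that \<theta>(2) by (intro member_le_sum) auto
        then show ?thesis using \<theta>(3)[of x] by linarith
      qed
      \<comment> \<open>Outside \<open>B\<close> the weights equal the indicators exactly at points
        of \<open>U\<close>; on \<open>B\<close> each weight differs from its indicator by at most
        1, so the error there is at most \<open>w\<close>.\<close>
      define B where "B = (\<Union>i<n. E i - K i)"
      have Bb: "B \<in> sets borel" unfolding B_def using Eb K(1) by (auto intro!: sets.finite_UN simp: borel_compact)
      have Rsum: "measure R B \<le> (\<Sum>i<n. measure R (E i - K i))"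
        unfolding B_def using Eb K(1) sR by (intro R.finite_measure_subadditive_finite) (auto simp: borel_compact)
      also have "\<dots> \<le> (\<Sum>i<n. e / n)" by (intro sum_mono K)
      also have "\<dots> = e" using n by simp
      finally have RB: "(\<integral>z. indicator B z * w z \<partial>T) \<le> e" using Rm(1)[OF Bb] by simp
      have cint: "integrable T (\<lambda>z. \<theta> i z * G i z)" if i: "i < n" for i
      proof (rule Bochner_Integration.integrable_bound[OF G(2)])
        show "(\<lambda>z. \<theta> i z * G i z) \<in> borel_measurable T"
          unfolding mT by (rule borel_measurable_times[OF borel_measurable_continuous_onI[OF CcD(1)[OF \<theta>(1)[OF i]]] G(1)])
        show "AE z in T. norm (\<theta> i z * G i z) \<le> norm (G i z)"
          using \<theta>(2)[OF i] \<theta>1[OF i] by (auto simp: abs_mult intro!: AE_I2 mult_left_le_one_le)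
      qed
      have Bint: "integrable T (\<lambda>z. indicator B z * w z)"
        using integrable_mult_indicator[OF _ wint, of B] Bb T(1) by simp
      have pt: "F z \<le> (\<Sum>i<n. \<theta> i z * G i z) + indicator B z * w z" if z: "z \<in> U" for z
      proof (cases "z \<in> B")
        case True
        have "indicator (E i) z * G i z \<le> \<theta> i z * G i z + \<bar>G i z\<bar>" if i: "i < n" for i
        proof -
          have "indicator (E i) z * G i z - \<theta> i z * G i z = (indicator (E i) z - \<theta> i z) * G i z" by (simp add: algebra_simps)
          also have "\<dots> \<le> \<bar>(indicator (E i) z - \<theta> i z) * G i z\<bar>" by simp
          also have "\<dots> \<le> 1 * \<bar>G i z\<bar>"
            unfolding abs_mult using \<theta>(2)[OF i, of z] \<theta>1[OF i, of z]
            by (intro mult_right_mono) (auto split: split_indicator)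
          finally show ?thesis by simp
        qed
        then have "F z \<le> (\<Sum>i<n. \<theta> i z * G i z + \<bar>G i z\<bar>)" unfolding F_def by (intro sum_mono) auto
        then show ?thesis using True by (simp add: sum.distrib w_def)
      next
        case False
        obtain j where j: "j < n" "z \<in> E j" using cover[OF z] by blast
        then have zK: "z \<in> K j" using False by (auto simp: B_def)
        have "indicator (E i) z = \<theta> i z" if i: "i < n" for i
        proof (cases "i = j")
          case False
          then have "z \<notin> E i" using Edisj[OF i j(1) False] j(2) by blast
          then show ?thesis using \<theta>(4)[OF i j(1) zK] False by simp
        qed (use \<theta>(4)[OF i j(1) zK] j in simp)
        then have "F z = (\<Sum>i<n. \<theta> i z * G i z)" unfolding F_def by (intro sum.cong) auto
        then show ?thesis using False by simp
      qed
      have "integral\<^sup>L T F \<le> (\<integral>z. (\<Sum>i<n. \<theta> i z * G i z) + indicator B z * w z \<partial>T)"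
        using AU cint Bint pt
        by (intro integral_mono_AE Fint Bochner_Integration.integrable_add Bochner_Integration.integrable_sum) auto
      also have "\<dots> = (\<Sum>i<n. \<integral>z. \<theta> i z * G i z \<partial>T) + (\<integral>z. indicator B z * w z \<partial>T)"
        using cint Bint by (subst Bochner_Integration.integral_add) (auto intro!: Bochner_Integration.integrable_sum Bochner_Integration.integral_sum)
      also have "\<dots> \<le> D + e" using D[OF \<theta>(1-3)] RB by (intro add_mono) auto
      finally show "integral\<^sup>L T F \<le> D + e" .
    qed
    then have FD: "ennreal (integral\<^sup>L T F) \<le> ennreal D" by (rule ennreal_leI)
    have "(\<integral>\<^sup>+z. (SUP i\<in>{..<n}. ennreal (G i z)) \<partial>T) \<le> (\<integral>\<^sup>+z. ennreal (F z) \<partial>T)"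
      using AU SF by (intro nn_integral_mono_AE) auto
    also have "\<dots> = ennreal (integral\<^sup>L T F)" using Fint F0 by (intro nn_integral_eq_integral) auto
    finally show ?thesis using FD by simp
  qed
  \<comment> \<open>\<open>Suc n\<close> keeps index 0, and with it the function 0, in every finite
    maximum.\<close>
  have "(\<integral>\<^sup>+z. (SUP i. ennreal (G i z)) \<partial>T) = (\<integral>\<^sup>+z. (SUP n. SUP i\<in>{..<Suc n}. ennreal (G i z)) \<partial>T)"
  proof (intro nn_integral_cong antisym SUP_least)
    fix z and i :: nat
    show "ennreal (G i z) \<le> (SUP n. SUP i\<in>{..<Suc n}. ennreal (G i z))"
      by (rule SUP_upper2[of i]) (auto intro: SUP_upper)
    show "ennreal (G i z) \<le> (SUP i. ennreal (G i z))" by (auto intro: SUP_upper)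
  qed
  also have "\<dots> = (SUP n. \<integral>\<^sup>+z. (SUP i\<in>{..<Suc n}. ennreal (G i z)) \<partial>T)"
  proof (rule nn_integral_monotone_convergence_SUP)
    show "incseq (\<lambda>n z. SUP i\<in>{..<Suc n}. ennreal (G i z))"
      by (intro incseq_SucI le_funI SUP_subset_mono) auto
    show "(\<lambda>z. SUP i\<in>{..<Suc n}. ennreal (G i z)) \<in> borel_measurable T" for n
      using GT by measurable
  qed
  also have "\<dots> \<le> ennreal D" by (intro SUP_least fin) simp
  finally show ?thesis .
qed

section \<open>Mollification\<close>

lemma has_frechet: "f differentiable at z \<Longrightarrow> (f has_derivative frechet_derivative f (at z)) (at z)"
  by (simp add: frechet_derivative_works)

lemma frechet_derivative_eqI: "(f has_derivative D) (at z) \<Longrightarrow> frechet_derivative f (at z) v = D v"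
  by (metis frechet_derivative_at)

lemma frechet_derivative_zero_outside_csupport:
  assumes "z \<notin> csupport f"
  shows "frechet_derivative f (at z) v = 0"
proof -
  have "(f has_derivative (\<lambda>_. 0)) (at z)"
  proof (rule has_derivative_transform_within_open)
    show "((\<lambda>_. 0) has_derivative (\<lambda>_. 0)) (at z)" by simp
    show "open (- csupport f)" by (simp add: csupport_def open_Compl)
    show "0 = f x" if "x \<in> - csupport f" for x
      using that by (simp add: zero_outside_csupport)
  qed (use assms in simp)
  then show ?thesis by (rule frechet_derivative_eqI)
qed

lemma C1c_Cc: "C1c U f \<Longrightarrow> f \<in> Cc U"
  unfolding C1c_def Cc_def
  by (auto intro!: differentiable_imp_continuous_on simp: differentiable_on_def)

lemma C1c_deriv_Cc:
  assumes "C1c U f"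
  shows "(\<lambda>z. frechet_derivative f (at z) v) \<in> Cc U"
  using assms by (intro CcI[of _ "csupport f"])
    (auto simp: C1c_def frechet_derivative_zero_outside_csupport)

lemma C1c_has_derivative: "C1c U f \<Longrightarrow> (f has_derivative frechet_derivative f (at z)) (at z)"
  by (simp add: C1c_def has_frechet)

lemma integrable_lborel_Cc:
  fixes f :: "'a::euclidean_space \<Rightarrow> 'b::euclidean_space"
  assumes "f \<in> Cc U"
  shows "integrable lborel f"
proof -
  have "integrable lborel (\<lambda>x. indicator (csupport f) x *\<^sub>R f x)"
    using assms by (intro borel_integrable_compact) (auto simp: Cc_def intro: continuous_on_subset)
  moreover have "(\<lambda>x. indicator (csupport f) x *\<^sub>R f x) = f"
    using zero_outside_csupport[of _ f] by (auto simp: indicator_def)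
  ultimately show ?thesis by simp
qed

lemma Cc_bilinear:
  assumes "bounded_bilinear B" "continuous_on UNIV h" "f \<in> Cc U"
  shows "(\<lambda>t. B (h t) (f t)) \<in> Cc U"
  using assms by (intro Cc_compose[OF assms(3)])
    (auto intro!: bounded_bilinear.continuous_on[OF assms(1)] simp: Cc_def bounded_bilinear.zero_right)

text \<open>The bridge between the Lebesgue integral over the whole space and the gauge integral
  over a box containing the support; the Leibniz rule is applied to the latter.\<close>

lemma lborel_integral_bilinear_eq_cbox:
  fixes f :: "'a::euclidean_space \<Rightarrow> 'c::euclidean_space" and B :: "'b::euclidean_space \<Rightarrow> 'c \<Rightarrow> 'd::euclidean_space"
  assumes bl: "bounded_bilinear B" and h: "continuous_on UNIV h" and f: "f \<in> Cc U"
    and ab: "csupport f \<subseteq> cbox a b"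
  shows "(\<integral>t. B (h t) (f t) \<partial>lborel) = integral (cbox a b) (\<lambda>t. B (h t) (f t))"
proof -
  have C: "(\<lambda>t. B (h t) (f t)) \<in> Cc U" by (rule Cc_bilinear[OF bl h f])
  have "(\<lambda>t. B (h t) (f t)) integrable_on cbox a b"
    by (rule integrable_continuous) (rule continuous_on_subset[OF CcD(1)[OF C]], simp)
  then have "((\<lambda>t. B (h t) (f t)) has_integral integral (cbox a b) (\<lambda>t. B (h t) (f t))) (cbox a b)"
    by (rule integrable_integral)
  then have "((\<lambda>t. B (h t) (f t)) has_integral integral (cbox a b) (\<lambda>t. B (h t) (f t))) UNIV"
  proof (rule has_integral_on_superset)
    show "B (h x) (f x) = 0" if "x \<notin> cbox a b" for x
    proof -
      have "f x = 0" using that ab by (intro zero_outside_csupport) auto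
      then show ?thesis by (simp add: bounded_bilinear.zero_right[OF bl])
    qed
  qed simp
  then have "integral UNIV (\<lambda>t. B (h t) (f t)) = integral (cbox a b) (\<lambda>t. B (h t) (f t))"
    by (rule integral_unique)
  then show ?thesis using integral_lborel[OF integrable_lborel_Cc[OF C]] by simp
qed

text \<open>The bilinear form is left general because the lemma is used with both orders of scalar
  multiplication: once with the derivative on the kernel, for smoothness, and once with it on the
  field, for approximation.\<close>

lemma convolution_has_derivative:
  fixes f :: "'a::euclidean_space \<Rightarrow> 'c::euclidean_space" and B :: "'b::euclidean_space \<Rightarrow> 'c \<Rightarrow> 'd::euclidean_space"
  assumes bl: "bounded_bilinear B" and f: "f \<in> Cc U" and g: "C1c V g"
  shows "((\<lambda>z. \<integral>t. B (g (z - t)) (f t) \<partial>lborel) has_derivative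
    (\<lambda>v. \<integral>t. B (frechet_derivative g (at (z - t)) v) (f t) \<partial>lborel)) (at z)"
proof -
  obtain a where a: "csupport f \<subseteq> cbox (- a) a"
    using bounded_subset_cbox_symmetric[OF compact_imp_bounded[OF CcD(2)[OF f]]] by blast
  have cg: "continuous_on UNIV (\<lambda>t. g (z - t))" for z
    by (rule continuous_on_compose2[OF CcD(1)[OF C1c_Cc[OF g]]]) (auto intro!: continuous_intros)
  have cg': "continuous_on UNIV (\<lambda>t. frechet_derivative g (at (z - t)) v)" for z v
    by (rule continuous_on_compose2[OF CcD(1)[OF C1c_deriv_Cc[OF g]]]) (auto intro!: continuous_intros)
  define fx where "fx x t = Blinfun (\<lambda>v. B (frechet_derivative g (at (x - t)) v) (f t))" for x t
  have fx: "blinfun_apply (fx x t) = (\<lambda>v. B (frechet_derivative g (at (x - t)) v) (f t))" for x t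
    unfolding fx_def
    by (rule bounded_linear_Blinfun_apply)
      (rule bounded_linear_compose[OF bounded_bilinear.bounded_linear_left[OF bl]
          has_derivative_bounded_linear[OF C1c_has_derivative[OF g]]])
  have cont: "continuous_on (UNIV \<times> cbox (- a) a) (\<lambda>(x, t). fx x t)"
  proof (rule continuous_on_blinfun_componentwise)
    fix i :: 'a
    have "continuous_on (UNIV \<times> cbox (- a) a) (\<lambda>p. B (frechet_derivative g (at (fst p - snd p)) i) (f (snd p)))"
      by (intro bounded_bilinear.continuous_on[OF bl] continuous_on_compose2[OF CcD(1)[OF C1c_deriv_Cc[OF g]]]
          continuous_on_compose2[OF CcD(1)[OF f]] continuous_intros) auto
    then show "continuous_on (UNIV \<times> cbox (- a) a) (\<lambda>x. blinfun_apply (case x of (x, t) \<Rightarrow> fx x t) i)"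
      by (simp add: fx case_prod_unfold)
  qed
  have *: "((\<lambda>z. integral (cbox (- a) a) (\<lambda>t. B (g (z - t)) (f t))) has_derivative
      blinfun_apply (integral (cbox (- a) a) (fx z))) (at z within UNIV)"
  proof (rule leibniz_rule)
    fix x t :: 'a
    have "((\<lambda>x. x - t) has_derivative (\<lambda>v. v)) (at x)"
      by (auto intro!: derivative_eq_intros)
    then have "((\<lambda>x. g (x - t)) has_derivative (\<lambda>v. frechet_derivative g (at (x - t)) v)) (at x)"
      by (rule has_derivative_compose[OF _ C1c_has_derivative[OF g]])
    then show "((\<lambda>x. B (g (x - t)) (f t)) has_derivative blinfun_apply (fx x t)) (at x within UNIV)"
      unfolding fx by (rule bounded_linear.has_derivative[OF bounded_bilinear.bounded_linear_left[OF bl]])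
    show "(\<lambda>t. B (g (x - t)) (f t)) integrable_on cbox (- a) a"
      by (intro integrable_continuous continuous_on_subset[OF CcD(1)[OF Cc_bilinear[OF bl cg f]]]) auto
  qed (use cont in auto)
  have "blinfun_apply (integral (cbox (- a) a) (fx z)) v
      = (\<integral>t. B (frechet_derivative g (at (z - t)) v) (f t) \<partial>lborel)" for v
  proof -
    have "continuous_on (cbox (- a) a) (\<lambda>t. (\<lambda>(x, t). fx x t) (z, t))"
      by (rule continuous_on_compose2[OF cont]) (auto intro!: continuous_intros)
    then have "fx z integrable_on cbox (- a) a" by (intro integrable_continuous) simp
    then show ?thesis
      using lborel_integral_bilinear_eq_cbox[OF bl cg' f a] by (simp add: blinfun_apply_integral fx)
  qed
  then have "blinfun_apply (integral (cbox (- a) a) (fx z))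
      = (\<lambda>v. \<integral>t. B (frechet_derivative g (at (z - t)) v) (f t) \<partial>lborel)" by (rule ext)
  with * show ?thesis
    using lborel_integral_bilinear_eq_cbox[OF bl cg f a] by simp
qed

lemma lborel_integral_reflect:
  fixes h :: "'a::euclidean_space \<Rightarrow> 'b::euclidean_space"
  assumes "h \<in> borel_measurable borel"
  shows "(\<integral>t. h (z - t) \<partial>lborel) = (\<integral>t. h t \<partial>lborel)"
proof -
  have "lborel = distr lborel borel (\<lambda>x. z - x)"
    using lborel_affine[of "- 1" z] by (simp add: density_1 one_ennreal_def[symmetric])
  then have "(\<integral>t. h t \<partial>lborel) = (\<integral>t. h t \<partial>distr lborel borel (\<lambda>x. z - x))" by simp
  also have "\<dots> = (\<integral>t. h (z - t) \<partial>lborel)" using assms by (intro integral_distr) auto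
  finally show ?thesis by simp
qed

text \<open>Continuity is uniform on the closed 1-neighbourhood of the support. Two points at
  distance below 1 either both lie in it or both lie outside the support, where \<open>f\<close> is
  0.\<close>

lemma Cc_uniformly_continuous:
  fixes f :: "'a::euclidean_space \<Rightarrow> 'b::real_normed_vector"
  assumes f: "f \<in> Cc U" and e: "0 < e"
  shows "\<exists>d>0. \<forall>x y. dist x y < d \<longrightarrow> dist (f x) (f y) < e"
proof -
  define K where "K = {x + y |x y. x \<in> csupport f \<and> y \<in> cball 0 1}"
  have "compact K" unfolding K_def by (intro compact_sums CcD(2)[OF f]) simp
  then have "uniformly_continuous_on K f"
    by (intro compact_uniformly_continuous continuous_on_subset[OF CcD(1)[OF f]]) auto
  then obtain d where d: "0 < d" "\<And>x y. x \<in> K \<Longrightarrow> y \<in> K \<Longrightarrow> dist y x < d \<Longrightarrow> dist (f y) (f x) < e"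
    using e unfolding uniformly_continuous_on_def by metis
  have inK: "y \<in> K" if "x \<in> csupport f" "dist x y < 1" for x y
  proof -
    have "y = x + (y - x)" "y - x \<in> cball 0 1" using that(2) by (auto simp: dist_norm norm_minus_commute)
    then show ?thesis unfolding K_def using that(1) by blast
  qed
  have "dist (f x) (f y) < e" if xy: "dist x y < min d 1" for x y
  proof (cases "x \<in> csupport f \<or> y \<in> csupport f")
    case True
    then have "x \<in> K" "y \<in> K"
      using inK[of x y] inK[of y x] inK[of x x] inK[of y y] xy by (auto simp: dist_commute)
    then show ?thesis using d(2)[of y x] xy by simp
  next
    case False
    then show ?thesis using e by (simp add: zero_outside_csupport)
  qed
  then show ?thesis using d(1) by (intro exI[of _ "min d 1"]) auto
qed

text \<open>The classical flat function divided by powers of \<open>s\<close>, which are the factors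
  that its derivatives produce.\<close>

definition flat_exp :: "nat \<Rightarrow> real \<Rightarrow> real" where
  "flat_exp k s = (if 0 < s then exp (- 1 / s) / s ^ k else 0)"

lemma flat_exp_shift: "flat_exp k s = s * flat_exp (Suc k) s"
  by (simp add: flat_exp_def)

lemma flat_exp_tendsto_0: "(flat_exp k \<longlongrightarrow> 0) (at 0)"
proof -
  have "((\<lambda>s. (inverse s) ^ k / exp (inverse s)) \<longlongrightarrow> (0::real)) (at_right 0)"
    by (rule filterlim_compose[OF tendsto_power_div_exp_0 filterlim_inverse_at_top_right])
  then have "(flat_exp k \<longlongrightarrow> 0) (at_right 0)"
    by (rule Lim_transform_eventually)
      (auto simp: flat_exp_def eventually_at_right_field exp_minus field_simps power_inverse intro!: exI[of _ 1])
  moreover have "(flat_exp k \<longlongrightarrow> 0) (at_left 0)"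
    by (rule Lim_transform_eventually[OF tendsto_const])
      (auto simp: flat_exp_def eventually_at_left_field intro!: exI[of _ "- 1"])
  ultimately show ?thesis by (simp add: filterlim_split_at)
qed

lemma flat_exp_deriv:
  "(flat_exp k has_real_derivative (1 - real k * s) * flat_exp (k + 2) s) (at s)"
proof (cases s "0::real" rule: linorder_cases)
  case less
  have "((\<lambda>_. 0) has_real_derivative 0) (at s)" by simp
  then have "(flat_exp k has_real_derivative 0) (at s)"
    by (rule DERIV_cong_ev[THEN iffD1, rotated 3])
      (use less in \<open>auto simp: flat_exp_def eventually_nhds intro!: exI[of _ "{..<0}"]\<close>)
  then show ?thesis using less by (simp add: flat_exp_def)
next
  case equal
  have "((\<lambda>h. (flat_exp k (0 + h) - flat_exp k 0) / h) \<longlongrightarrow> 0) (at 0)"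
  proof (rule Lim_transform_eventually[OF flat_exp_tendsto_0[of "Suc k"]])
    \<comment> \<open>At 0 the difference quotient only raises the index by one, and every member of
      the family tends to 0.\<close>
    show "\<forall>\<^sub>F h in at 0. flat_exp (Suc k) h = (flat_exp k (0 + h) - flat_exp k 0) / h"
      by (auto simp: eventually_at_filter flat_exp_def)
  qed
  then show ?thesis using equal by (simp add: DERIV_def flat_exp_def)
next
  case greater
  have "((\<lambda>s. exp (- 1 / s) / s ^ k) has_real_derivative
      (exp (- 1 / s) * (1 / s ^ 2) * s ^ k - exp (- 1 / s) * (real k * s ^ (k - 1))) / (s ^ k * s ^ k)) (at s)"
    using greater by (auto intro!: derivative_eq_intros simp: power2_eq_square)
  also have "(exp (- 1 / s) * (1 / s ^ 2) * s ^ k - exp (- 1 / s) * (real k * s ^ (k - 1))) / (s ^ k * s ^ k)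
      = (1 - real k * s) * flat_exp (k + 2) s"
    using greater by (cases k) (auto simp: flat_exp_def field_simps power2_eq_square)
  finally show ?thesis
    by (rule DERIV_cong_ev[THEN iffD1, rotated 3])
      (use greater in \<open>auto simp: flat_exp_def eventually_nhds intro!: exI[of _ "{0<..}"]\<close>)
qed

lemma real_polynomial_function_frechet:
  assumes "real_polynomial_function p"
  shows "(\<forall>z. p differentiable at z) \<and> (\<exists>q. real_polynomial_function q \<and> (\<forall>z. frechet_derivative p (at z) v = q z))"
  using assms
proof induction
  case (linear f)
  then have "(f has_derivative f) (at z)" for z by (rule bounded_linear_imp_has_derivative)
  then have "f differentiable at z" "frechet_derivative f (at z) v = f v" for z
    by (auto simp: differentiable_def dest: frechet_derivative_eqI)
  then show ?case by (auto intro!: exI[of _ "\<lambda>_. f v"])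
next
  case (const c)
  then show ?case by (auto intro!: exI[of _ "\<lambda>_. 0"] simp: frechet_derivative_const)
next
  case (add f g)
  then obtain f' g' where *: "real_polynomial_function f'" "\<And>z. frechet_derivative f (at z) v = f' z"
    "real_polynomial_function g'" "\<And>z. frechet_derivative g (at z) v = g' z" by blast
  have D: "((\<lambda>x. f x + g x) has_derivative (\<lambda>v. frechet_derivative f (at z) v + frechet_derivative g (at z) v)) (at z)" for z
    using add by (intro has_derivative_add has_frechet) auto
  have d: "(\<lambda>x. f x + g x) differentiable at z"
    "frechet_derivative (\<lambda>x. f x + g x) (at z) v = f' z + g' z" for z
    using D[of z] frechet_derivative_eqI[OF D[of z], of v] *(2,4) by (auto simp: differentiable_def)
  then show ?case using * by (auto intro!: exI[of _ "\<lambda>z. f' z + g' z"])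
next
  case (mult f g)
  then obtain f' g' where *: "real_polynomial_function f'" "\<And>z. frechet_derivative f (at z) v = f' z"
    "real_polynomial_function g'" "\<And>z. frechet_derivative g (at z) v = g' z" by blast
  have D: "((\<lambda>x. f x * g x) has_derivative (\<lambda>v. f z * frechet_derivative g (at z) v + frechet_derivative f (at z) v * g z)) (at z)" for z
    using mult by (intro has_derivative_mult has_frechet) auto
  have d: "(\<lambda>x. f x * g x) differentiable at z"
    "frechet_derivative (\<lambda>x. f x * g x) (at z) v = f z * g' z + f' z * g z" for z
    using D[of z] frechet_derivative_eqI[OF D[of z], of v] *(2,4) by (auto simp: differentiable_def)
  then show ?case using * mult by (auto intro!: exI[of _ "\<lambda>z. f z * g' z + f' z * g z"])
qed

text \<open>A polynomial multiple of a single \<open>flat_exp k\<close> suffices for closure under derivatives,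
  because \<open>flat_exp k s = s * flat_exp (Suc k) s\<close> allows all terms to be brought to the same \<open>k\<close>.\<close>

definition bump_family :: "real \<Rightarrow> ('a::euclidean_space \<Rightarrow> real) set" where
  "bump_family e = {\<lambda>z. p z * flat_exp k (e\<^sup>2 - z \<bullet> z) |p k. real_polynomial_function p}"

lemma bump_family_deriv:
  fixes f :: "'a::euclidean_space \<Rightarrow> real"
  assumes "f \<in> bump_family e"
  shows "f differentiable at z" "(\<lambda>z. frechet_derivative f (at z) v) \<in> bump_family e"
proof -
  obtain p k where f: "f = (\<lambda>z. p z * flat_exp k (e\<^sup>2 - z \<bullet> z))" and p: "real_polynomial_function p"
    using assms by (auto simp: bump_family_def)
  obtain p' where p': "real_polynomial_function p'" "\<And>z. frechet_derivative p (at z) v = p' z"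
    using real_polynomial_function_frechet[OF p] by blast
  define s where "s z = e\<^sup>2 - z \<bullet> z" for z :: 'a
  have sd: "(s has_derivative (\<lambda>v. - 2 * (z \<bullet> v))) (at z)" for z
    unfolding s_def by (auto intro!: derivative_eq_intros simp: inner_commute)
  have ed: "((\<lambda>z. flat_exp k (s z)) has_derivative (\<lambda>v. - 2 * (z \<bullet> v) * ((1 - real k * s z) * flat_exp (k + 2) (s z)))) (at z)" for z
    using DERIV_compose_FDERIV[OF flat_exp_deriv sd] by simp
  have fd: "(f has_derivative (\<lambda>v. p z * (- 2 * (z \<bullet> v) * ((1 - real k * s z) * flat_exp (k + 2) (s z)))
      + frechet_derivative p (at z) v * flat_exp k (s z))) (at z)" for z
    unfolding f s_def[symmetric] using real_polynomial_function_frechet[OF p]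
    by (intro has_derivative_mult has_frechet ed) auto
  show "f differentiable at z" using fd by (auto simp: differentiable_def)
  define q where "q z = p z * (- 2 * (z \<bullet> v)) * (1 - real k * s z) + p' z * (s z * s z)" for z
  have "frechet_derivative f (at z) v = q z * flat_exp (k + 2) (s z)" for z
    unfolding frechet_derivative_at[OF fd, symmetric] p'(2) q_def
    using flat_exp_shift[of k "s z"] flat_exp_shift[of "Suc k" "s z"]
    by (simp add: algebra_simps)
  moreover have "real_polynomial_function s"
  proof -
    have "real_polynomial_function (\<lambda>z::'a. \<Sum>b\<in>Basis. (z \<bullet> b) * (z \<bullet> b))"
      by (intro real_polynomial_function_sum real_polynomial_function.intros(4) real_polynomial_function.intros(1)
          bounded_linear_inner_left) auto
    then have "real_polynomial_function (\<lambda>z::'a. z \<bullet> z)" by (simp flip: euclidean_inner)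
    then show ?thesis unfolding s_def by (intro real_polynomial_function_diff) auto
  qed
  then have "real_polynomial_function q"
    unfolding q_def using p p'(1) real_polynomial_function.intros(1)[OF bounded_linear_inner_left]
    by (intro real_polynomial_function.intros(2-4) real_polynomial_function_diff)
  ultimately show "(\<lambda>z. frechet_derivative f (at z) v) \<in> bump_family e"
    by (auto simp: bump_family_def s_def)
qed

lemma bump_family_iter_deriv:
  assumes "f \<in> bump_family e"
  shows "iter_deriv f vs \<in> bump_family e"
  using assms by (induction vs) (auto intro: bump_family_deriv)

text \<open>\<open>\<eta>\<close> is positive on the open ball of radius \<open>e\<close>, which has
  positive volume; its integral is therefore positive and can be normalised.\<close>

lemma bump_exists:
  assumes e: "0 < e"
  obtains \<rho> :: "'a::euclidean_space \<Rightarrow> real" where "Cinf_c UNIV \<rho>" "\<And>z. 0 \<le> \<rho> z" "\<And>z. \<rho> z \<noteq> 0 \<Longrightarrow> norm z \<le> e"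
    "integral\<^sup>L lborel \<rho> = 1"
proof -
  define \<eta> where "\<eta> z = flat_exp 0 (e\<^sup>2 - z \<bullet> z)" for z :: 'a
  have e2: "0 < e\<^sup>2 - z \<bullet> z \<longleftrightarrow> norm z < e" for z :: 'a
    using e abs_le_square_iff[of e "norm z"] by (auto simp: power2_norm_eq_inner[symmetric] not_le[symmetric])
  have pos: "0 < \<eta> z" if "norm z < e" for z using that e2[of z] by (simp add: \<eta>_def flat_exp_def)
  have nn: "0 \<le> \<eta> z" for z by (simp add: \<eta>_def flat_exp_def)
  have zero: "norm z \<le> e" if "\<eta> z \<noteq> 0" for z
    using that e2[of z] by (auto simp: \<eta>_def flat_exp_def split: if_splits)
  have fam: "(\<lambda>z. c * \<eta> z) \<in> bump_family e" for c
    unfolding bump_family_def \<eta>_def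
    by (intro CollectI exI[of _ "\<lambda>_. c"] exI[of _ 0]) auto
  have smooth: "Cinf_c UNIV (\<lambda>z. c * \<eta> z)" for c
    unfolding Cinf_c_def
  proof (intro conjI allI)
    show "iter_deriv (\<lambda>z. c * \<eta> z) vs differentiable at z" for vs z
      by (rule bump_family_deriv(1)[OF bump_family_iter_deriv[OF fam]])
    show "compact (csupport (\<lambda>z. c * \<eta> z))"
      by (rule compact_csupportI[of "cball 0 e" UNIV]) (use zero in auto)
  qed simp
  have "continuous_on UNIV (\<lambda>z. 1 * \<eta> z)"
    using bump_family_deriv(1)[OF fam[of 1]] by (intro differentiable_imp_continuous_on) (auto simp: differentiable_on_def)
  then have "\<eta> \<in> Cc UNIV" by (intro CcI[of _ "cball 0 e"]) (use zero in auto)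
  then have int: "integrable lborel \<eta>" by (rule integrable_lborel_Cc)
  have "integral\<^sup>L lborel \<eta> \<noteq> 0"
  proof
    assume "integral\<^sup>L lborel \<eta> = 0"
    then have AE0: "AE z in lborel. \<eta> z = 0" using integral_nonneg_eq_0_iff_AE[OF int] nn by simp
    have "AE z in lborel. \<eta> z = 0 \<longrightarrow> z \<notin> ball 0 e"
    proof (intro AE_I2 impI notI)
      fix z assume "\<eta> z = 0" "z \<in> ball 0 e"
      then show False using pos[of z] by simp
    qed
    with AE0 have "AE z in lborel. z \<notin> ball (0::'a) e" by (rule AE_mp)
    then have "emeasure lborel (ball (0::'a) e) = 0"
      by (subst (asm) AE_iff_measurable[where N="ball 0 e"]) auto
    then have "measure lborel (ball (0::'a) e) = 0" by (simp add: measure_def)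
    then show False using content_ball_pos[OF e, of "0::'a"] by simp
  qed
  then have "0 < integral\<^sup>L lborel \<eta>" using integral_nonneg_AE[of \<eta> lborel] nn by (simp add: less_le)
  then show thesis
    using nn zero by (intro that[OF smooth[of "1 / integral\<^sup>L lborel \<eta>"]]) auto
qed

section \<open>Smoothing continuously differentiable fields\<close>

lemma Cinf_c_iter_C1c:
  assumes "Cinf_c U f"
  shows "C1c U (iter_deriv f vs)"
proof -
  have d: "iter_deriv f vs differentiable at z" for vs z using assms by (simp add: Cinf_c_def)
  have "continuous_on UNIV (\<lambda>z. frechet_derivative (iter_deriv f vs) (at z) v)" for v
    using d[of "v # vs"] by (intro differentiable_imp_continuous_on) (auto simp: differentiable_on_def)
  moreover have "iter_deriv f vs z = 0" if "z \<notin> csupport f" for z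
    using that
  proof (induction vs arbitrary: z)
    case (Cons v vs)
    have "z \<notin> csupport (iter_deriv f vs)"
    proof -
      have "csupport (iter_deriv f vs) \<subseteq> csupport f"
        unfolding csupport_def[of "iter_deriv f vs"]
        by (rule closure_minimal) (use Cons.IH in \<open>auto simp: csupport_def\<close>)
      then show ?thesis using Cons.prems by blast
    qed
    then show ?case by (simp add: frechet_derivative_zero_outside_csupport)
  qed (simp add: zero_outside_csupport)
  then have "compact (csupport (iter_deriv f vs))" "csupport (iter_deriv f vs) \<subseteq> U"
    using assms compact_csupportI[of "csupport f" U "iter_deriv f vs"] by (auto simp: Cinf_c_def)
  ultimately show ?thesis using d by (simp add: C1c_def)
qed

lemma Cinf_c_C1c: "Cinf_c U f \<Longrightarrow> C1c U f"
  using Cinf_c_iter_C1c[of U f "[]"] by simp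

text \<open>In the convolution with a small bump, derivatives placed on the bump give smoothness of
  all orders, and a derivative placed on \<open>\<phi>\<close> gives an average of nearby values of
  the derivative of \<open>\<phi>\<close>, which is uniformly close by uniform continuity. A radius
  below the distance to the complement keeps the support in \<open>U\<close>.\<close>

lemma C1c_smooth_approx:
  fixes \<phi> :: "'a::euclidean_space \<Rightarrow> 'b::euclidean_space"
  assumes \<phi>: "C1c U \<phi>" and U: "open U" and e: "0 < e"
  shows "\<exists>\<psi>. Cinf_c U \<psi> \<and> (\<forall>v\<in>Basis. \<forall>z. norm (frechet_derivative \<psi> (at z) v - frechet_derivative \<phi> (at z) v) \<le> e)"
proof -
  have \<phi>C: "\<phi> \<in> Cc U" by (rule C1c_Cc[OF \<phi>])
  obtain r where r: "0 < r" "(\<Union>x\<in>csupport \<phi>. cball x r) \<subseteq> U"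
    using compact_subset_open_imp_cball_epsilon_subset[OF CcD(2)[OF \<phi>C] U CcD(3)[OF \<phi>C]] by blast
  have "\<forall>v. \<exists>d>0. \<forall>x y. dist x y < d \<longrightarrow> dist (frechet_derivative \<phi> (at x) v) (frechet_derivative \<phi> (at y) v) < e"
    using Cc_uniformly_continuous[OF C1c_deriv_Cc[OF \<phi>] e] by blast
  then obtain d where d: "\<And>v. 0 < d v"
    "\<And>v x y. dist x y < d v \<Longrightarrow> dist (frechet_derivative \<phi> (at x) v) (frechet_derivative \<phi> (at y) v) < e"
    by metis
  \<comment> \<open>Halving the minimum makes \<open>\<delta> < d v\<close> strict, since the bump
    may be nonzero up to distance \<open>\<delta>\<close> inclusive.\<close>
  define \<delta> where "\<delta> = min r (Min (d ` Basis) / 2)"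
  have "0 < Min (d ` Basis)" using d(1) by (subst Min_gr_iff) auto
  then have \<delta>: "0 < \<delta>" "\<delta> \<le> r" using r by (auto simp: \<delta>_def)
  have \<delta>d: "\<delta> < d v" if "v \<in> Basis" for v
  proof -
    have "Min (d ` Basis) \<le> d v" using that by (intro Min_le) auto
    moreover have "\<delta> \<le> Min (d ` Basis) / 2" unfolding \<delta>_def by (rule min.cobounded2)
    ultimately show ?thesis using \<open>0 < Min (d ` Basis)\<close> by linarith
  qed
  obtain \<rho> :: "'a \<Rightarrow> real" where \<rho>: "Cinf_c UNIV \<rho>" "\<And>z. 0 \<le> \<rho> z" "\<And>z. \<rho> z \<noteq> 0 \<Longrightarrow> norm z \<le> \<delta>"
    "integral\<^sup>L lborel \<rho> = 1"
    using bump_exists[OF \<delta>(1)] by blast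
  have \<rho>C: "\<rho> \<in> Cc UNIV" by (rule C1c_Cc[OF Cinf_c_C1c[OF \<rho>(1)]])
  define \<psi> where "\<psi> z = (\<integral>t. \<rho> (z - t) *\<^sub>R \<phi> t \<partial>lborel)" for z
  have deriv: "((\<lambda>z. \<integral>t. iter_deriv \<rho> vs (z - t) *\<^sub>R \<phi> t \<partial>lborel) has_derivative
      (\<lambda>v. \<integral>t. iter_deriv \<rho> (v # vs) (z - t) *\<^sub>R \<phi> t \<partial>lborel)) (at z)" for vs z
    using convolution_has_derivative[OF bounded_bilinear_scaleR \<phi>C Cinf_c_iter_C1c[OF \<rho>(1)], of vs z] by simp
  have iter: "iter_deriv \<psi> vs = (\<lambda>z. \<integral>t. iter_deriv \<rho> vs (z - t) *\<^sub>R \<phi> t \<partial>lborel)" for vs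
  proof (induction vs)
    case (Cons v vs)
    then show ?case using frechet_derivative_at[OF deriv, symmetric] by simp
  qed (simp add: \<psi>_def fun_eq_iff)
  have "Cinf_c U \<psi>"
    unfolding Cinf_c_def
  proof (intro conjI allI)
    show "iter_deriv \<psi> vs differentiable at z" for vs z
      unfolding iter using deriv by (auto simp: differentiable_def)
    define K where "K = {x + y |x y. x \<in> csupport \<phi> \<and> y \<in> cball 0 \<delta>}"
    have "compact K" unfolding K_def by (intro compact_sums CcD(2)[OF \<phi>C]) simp
    moreover have "K \<subseteq> U"
    proof
      fix z assume "z \<in> K"
      then obtain x y where "z = x + y" "x \<in> csupport \<phi>" "norm y \<le> \<delta>" by (auto simp: K_def)
      then have "z \<in> cball x r" "x \<in> csupport \<phi>" using \<delta>(2) by (auto simp: dist_norm)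
      then show "z \<in> U" using r(2) by blast
    qed
    moreover have "\<psi> z = 0" if z: "z \<notin> K" for z
    proof -
      have "\<rho> (z - t) *\<^sub>R \<phi> t = 0" for t
      proof (rule ccontr)
        assume "\<rho> (z - t) *\<^sub>R \<phi> t \<noteq> 0"
        then have "norm (z - t) \<le> \<delta>" "t \<in> csupport \<phi>" using \<rho>(3) zero_outside_csupport[of t \<phi>] by auto
        then have "t + (z - t) \<in> K" unfolding K_def by (metis (mono_tags, lifting) mem_Collect_eq mem_cball_0)
        then show False using z by simp
      qed
      then show ?thesis unfolding \<psi>_def by (simp only: Bochner_Integration.integral_zero)
    qed
    ultimately show "compact (csupport \<psi>)" "csupport \<psi> \<subseteq> U"
      using compact_csupportI[of K U \<psi>] by auto
  qed
  moreover have "norm (frechet_derivative \<psi> (at z) v - frechet_derivative \<phi> (at z) v) \<le> e" if v: "v \<in> Basis" for v z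
  proof -
    let ?D = "\<lambda>x. frechet_derivative \<phi> (at x) v"
    have "\<psi> z = (\<integral>t. \<rho> t *\<^sub>R \<phi> (z - t) \<partial>lborel)" for z
    proof -
      have "continuous_on UNIV (\<lambda>t. \<rho> t *\<^sub>R \<phi> (z - t))"
        by (intro continuous_on_scaleR CcD(1)[OF \<rho>C] continuous_on_compose2[OF CcD(1)[OF \<phi>C]] continuous_intros) auto
      then show ?thesis
        using lborel_integral_reflect[OF borel_measurable_continuous_onI, of "\<lambda>t. \<rho> t *\<^sub>R \<phi> (z - t)" z]
        by (simp add: \<psi>_def)
    qed
    then have \<psi>eq: "\<psi> = (\<lambda>z. \<integral>t. \<rho> t *\<^sub>R \<phi> (z - t) \<partial>lborel)" by blast
    have flip: "bounded_bilinear (\<lambda>(x::'b) (c::real). c *\<^sub>R x)"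
      by (rule bounded_bilinear.flip[OF bounded_bilinear_scaleR])
    have "(\<psi> has_derivative (\<lambda>v. \<integral>t. \<rho> t *\<^sub>R frechet_derivative \<phi> (at (z - t)) v \<partial>lborel)) (at z)"
      unfolding \<psi>eq by (rule convolution_has_derivative[OF flip \<rho>C \<phi>])
    then have D: "frechet_derivative \<psi> (at z) v = (\<integral>t. \<rho> t *\<^sub>R ?D (z - t) \<partial>lborel)"
      by (simp add: frechet_derivative_at[symmetric])
    have c: "(\<lambda>t. \<rho> t *\<^sub>R ?D (z - t)) \<in> Cc UNIV"
      by (rule Cc_bilinear[OF flip _ \<rho>C])
        (rule continuous_on_compose2[OF CcD(1)[OF C1c_deriv_Cc[OF \<phi>]]], auto intro!: continuous_intros)
    have c2: "(\<lambda>t. \<rho> t *\<^sub>R ?D z) \<in> Cc UNIV"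
      by (rule Cc_bilinear[OF flip _ \<rho>C]) simp
    have i1: "integrable lborel (\<lambda>t. \<rho> t *\<^sub>R ?D (z - t))"
      by (rule integrable_lborel_Cc[OF c])
    have i2: "integrable lborel (\<lambda>t. \<rho> t *\<^sub>R ?D z)"
      by (rule integrable_lborel_Cc[OF c2])
    have \<rho>i: "integrable lborel \<rho>" by (rule integrable_lborel_Cc[OF \<rho>C])
    have "frechet_derivative \<psi> (at z) v - ?D z
        = (\<integral>t. \<rho> t *\<^sub>R ?D (z - t) - \<rho> t *\<^sub>R ?D z \<partial>lborel)"
      using i1 i2 \<rho>i \<rho>(4) by (simp add: D)
    also have "norm \<dots> \<le> (\<integral>t. norm (\<rho> t *\<^sub>R ?D (z - t) - \<rho> t *\<^sub>R ?D z) \<partial>lborel)"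
      by (rule integral_norm_bound)
    also have "\<dots> \<le> (\<integral>t. e * \<rho> t \<partial>lborel)"
    proof (rule integral_mono)
      show "integrable lborel (\<lambda>t. norm (\<rho> t *\<^sub>R ?D (z - t) - \<rho> t *\<^sub>R ?D z))"
        by (rule integrable_norm[OF Bochner_Integration.integrable_diff[OF i1 i2]])
      show "integrable lborel (\<lambda>t. e * \<rho> t)" using \<rho>i by simp
      fix t
      show "norm (\<rho> t *\<^sub>R ?D (z - t) - \<rho> t *\<^sub>R ?D z) \<le> e * \<rho> t"
      proof (cases "\<rho> t = 0")
        case False
        then have "dist (z - t) z < d v" using \<rho>(3)[OF False] \<delta>d[OF v] by (simp add: dist_norm)
        then have "norm (?D (z - t) - ?D z) \<le> e"
          using d(2)[of "z - t" z v] by (simp add: dist_norm)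
        then have "\<rho> t * norm (?D (z - t) - ?D z) \<le> \<rho> t * e"
          by (rule mult_left_mono[OF _ \<rho>(2)])
        then show ?thesis using \<rho>(2)[of t] by (simp add: scaleR_diff_right[symmetric] mult.commute)
      qed simp
    qed
    also have "\<dots> = e" using \<rho>(4) by simp
    finally show ?thesis .
  qed
  ultimately show ?thesis by blast
qed

section \<open>Weak duality\<close>

lemma grad_y_nth: "grad_y \<phi> z $ i = frechet_derivative \<phi> (at z) (0, axis i 1)"
  by (simp add: grad_y_def vec_eq_iff)

lemma div_x_Cc:
  assumes "C1c U \<phi>"
  shows "div_x \<phi> \<in> Cc U"
  unfolding div_x_def
proof (rule Cc_sum)
  fix j
  have D: "(\<lambda>z. frechet_derivative \<phi> (at z) (axis j 1, 0)) \<in> Cc U" by (rule C1c_deriv_Cc[OF assms])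
  show "(\<lambda>z. frechet_derivative \<phi> (at z) (axis j 1, 0) $ j) \<in> Cc U"
    by (rule Cc_compose[OF D]) (auto intro!: continuous_on_component CcD(1)[OF D])
qed

lemma grad_y_Cc:
  assumes "C1c U \<phi>"
  shows "grad_y \<phi> \<in> Cc U"
proof (rule CcI[of _ "csupport \<phi>"])
  show "continuous_on UNIV (grad_y \<phi>)"
    unfolding grad_y_def
    by (intro continuous_on_vec_lambda continuous_on_component CcD(1)[OF C1c_deriv_Cc[OF assms]])
  show "grad_y \<phi> z = 0" if "z \<notin> csupport \<phi>" for z
    using that by (simp add: vec_eq_iff grad_y_nth frechet_derivative_zero_outside_csupport)
qed (use assms in \<open>auto simp: C1c_def\<close>)

lemma C1c_linear_combination:
  fixes \<phi> \<psi> :: "'a::euclidean_space \<Rightarrow> 'b::euclidean_space"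
  assumes \<phi>: "C1c U \<phi>" and \<psi>: "C1c U \<psi>"
  shows "C1c U (\<lambda>z. a *\<^sub>R \<phi> z + b *\<^sub>R \<psi> z)"
    "frechet_derivative (\<lambda>z. a *\<^sub>R \<phi> z + b *\<^sub>R \<psi> z) (at z) v
      = a *\<^sub>R frechet_derivative \<phi> (at z) v + b *\<^sub>R frechet_derivative \<psi> (at z) v"
proof -
  let ?f = "\<lambda>z. a *\<^sub>R \<phi> z + b *\<^sub>R \<psi> z"
  have D: "(?f has_derivative (\<lambda>v. a *\<^sub>R frechet_derivative \<phi> (at z) v + b *\<^sub>R frechet_derivative \<psi> (at z) v)) (at z)" for z
    by (intro has_derivative_add has_derivative_scaleR_right C1c_has_derivative[OF \<phi>] C1c_has_derivative[OF \<psi>])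
  show E: "frechet_derivative ?f (at z) v = a *\<^sub>R frechet_derivative \<phi> (at z) v + b *\<^sub>R frechet_derivative \<psi> (at z) v" for z v
    by (rule frechet_derivative_eqI[OF D])
  have "?f \<in> Cc U"
    by (rule Cc_combine[OF C1c_Cc[OF \<phi>] C1c_Cc[OF \<psi>]])
      (auto intro!: continuous_intros CcD(1)[OF C1c_Cc[OF \<phi>]] CcD(1)[OF C1c_Cc[OF \<psi>]])
  moreover have "continuous_on UNIV (\<lambda>z. frechet_derivative ?f (at z) v)" for v
    unfolding E by (intro continuous_intros CcD(1)[OF C1c_deriv_Cc[OF \<phi>]] CcD(1)[OF C1c_deriv_Cc[OF \<psi>]])
  ultimately show "C1c U ?f"
    using D by (auto simp: C1c_def Cc_def differentiable_def)
qed

lemma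
  assumes "C1c U \<phi>" "C1c U \<psi>"
  shows div_x_linear: "div_x (\<lambda>z. a *\<^sub>R \<phi> z + b *\<^sub>R \<psi> z) z = a * div_x \<phi> z + b * div_x \<psi> z"
    and grad_y_linear: "grad_y (\<lambda>z. a *\<^sub>R \<phi> z + b *\<^sub>R \<psi> z) z = a *\<^sub>R grad_y \<phi> z + b *\<^sub>R grad_y \<psi> z"
  by (simp_all add: div_x_def grad_y_def vec_eq_iff C1c_linear_combination(2)[OF assms]
      sum.distrib sum_distrib_left)

lemma C1c_zero: "C1c U (\<lambda>_. 0)"
  by (simp add: C1c_def csupport_def frechet_derivative_const)

lemma div_x_zero: "div_x (\<lambda>_. 0) = (\<lambda>_. 0)" and grad_y_zero: "grad_y (\<lambda>_. 0) = (\<lambda>_. 0)"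
  by (simp_all add: fun_eq_iff div_x_def grad_y_def vec_eq_iff frechet_derivative_const)

lemma
  assumes "C1c U \<phi>"
  shows C1c_scale: "C1c U (\<lambda>z. a *\<^sub>R \<phi> z)"
    and div_x_scale: "div_x (\<lambda>z. a *\<^sub>R \<phi> z) z = a * div_x \<phi> z"
    and grad_y_scale: "grad_y (\<lambda>z. a *\<^sub>R \<phi> z) z = a *\<^sub>R grad_y \<phi> z"
  using C1c_linear_combination(1)[OF assms C1c_zero, of a 0] div_x_linear[OF assms C1c_zero, of a 0 z]
    grad_y_linear[OF assms C1c_zero, of a 0 z]
  by simp_all

lemma integrable_bcontfun_inner:
  fixes f v :: "'a::euclidean_space \<Rightarrow> 'b::euclidean_space"
  assumes f: "f \<in> bcontfun" and v: "integrable M v" and M: "sets M = sets borel"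
  shows "integrable M (\<lambda>z. f z \<bullet> v z)"
proof -
  obtain B where B: "\<And>x. norm (f x) \<le> B"
    using f by (auto simp: bcontfun_def bounded_iff)
  have fm: "f \<in> borel_measurable M"
    unfolding measurable_cong_sets[OF M refl]
    using f by (intro borel_measurable_continuous_onI) (simp add: bcontfun_def)
  show ?thesis
  proof (rule Bochner_Integration.integrable_bound)
    show "integrable M (\<lambda>z. B * norm (v z))" using v by auto
    show "(\<lambda>z. f z \<bullet> v z) \<in> borel_measurable M"
      by (rule borel_measurable_inner[OF fm borel_measurable_integrable[OF v]])
    show "AE z in M. norm (f z \<bullet> v z) \<le> norm (B * norm (v z))"
    proof (rule AE_I2)
      fix z
      have "norm (f z \<bullet> v z) \<le> norm (f z) * norm (v z)" using Cauchy_Schwarz_ineq2[of "f z" "v z"] by simp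
      also have "\<dots> \<le> B * norm (v z)" by (rule mult_right_mono[OF B]) simp
      also have "\<dots> \<le> norm (B * norm (v z))" by simp
      finally show "norm (f z \<bullet> v z) \<le> norm (B * norm (v z))" .
    qed
  qed
qed

lemma inner_integral_diff_bound:
  fixes f g v :: "'a::euclidean_space \<Rightarrow> 'b::euclidean_space"
  assumes f: "f \<in> bcontfun" and g: "g \<in> bcontfun" and v: "integrable M v" and M: "sets M = sets borel"
    and C: "\<And>z. norm (f z - g z) \<le> C"
  shows "\<bar>(\<integral>z. f z \<bullet> v z \<partial>M) - (\<integral>z. g z \<bullet> v z \<partial>M)\<bar> \<le> C * (\<integral>z. norm (v z) \<partial>M)"
proof -
  have i: "integrable M (\<lambda>z. f z \<bullet> v z)" "integrable M (\<lambda>z. g z \<bullet> v z)"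
    by (rule integrable_bcontfun_inner[OF f v M], rule integrable_bcontfun_inner[OF g v M])
  have "norm (\<integral>z. f z \<bullet> v z - g z \<bullet> v z \<partial>M) \<le> (\<integral>z. norm (f z \<bullet> v z - g z \<bullet> v z) \<partial>M)"
    by (rule integral_norm_bound)
  also have "\<dots> \<le> (\<integral>z. C * norm (v z) \<partial>M)"
  proof (rule integral_mono)
    fix z
    have "norm (f z \<bullet> v z - g z \<bullet> v z) \<le> norm (f z - g z) * norm (v z)"
      using Cauchy_Schwarz_ineq2[of "f z - g z" "v z"] by (simp add: inner_diff_left)
    also have "\<dots> \<le> C * norm (v z)" by (rule mult_right_mono[OF C]) simp
    finally show "norm (f z \<bullet> v z - g z \<bullet> v z) \<le> C * norm (v z)" .
  qed (use i v in auto)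
  finally show ?thesis using i by simp
qed

text \<open>The left-hand side involves only first derivatives of the test field, integrated against
  finite measures and integrable densities. It is therefore continuous under uniform convergence of
  first derivatives and vanishes on the smooth fields approximating \<open>\<phi>\<close>.\<close>

lemma continuity_eq_C1c:
  fixes \<mu> \<nu> :: "('d::finite, 'q::finite) pt measure"
  assumes \<mu>: "sets \<mu> = sets borel" "finite_measure \<mu>" and \<nu>: "sets \<nu> = sets borel"
    and v: "integrable \<mu> v" and h: "integrable \<nu> h" and \<Omega>: "open \<Omega>"
    and eq: "continuity_eq \<Omega> \<mu> v \<nu> h" and \<phi>: "C1c (\<Omega> \<times> UNIV) \<phi>"
  shows "(\<integral>z. div_x \<phi> z \<partial>\<mu>) + (\<integral>z. grad_y \<phi> z \<bullet> v z \<partial>\<mu>) + (\<integral>z. grad_y \<phi> z \<bullet> h z \<partial>\<nu>) = 0"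
proof -
  interpret finite_measure \<mu> by fact
  define S where "S \<phi> = (\<integral>z. div_x \<phi> z \<partial>\<mu>) + (\<integral>z. grad_y \<phi> z \<bullet> v z \<partial>\<mu>) + (\<integral>z. grad_y \<phi> z \<bullet> h z \<partial>\<nu>)" for \<phi>
  \<comment> \<open>\<open>Q\<close> is the total error per unit of \<open>e\<close>: masses and L1
    norms, with dimension factors because the divergence and the rows of the gradient are estimated
    termwise.\<close>
  define Q where "Q = real CARD('d) * (\<integral>z. norm (1::real) \<partial>\<mu>) + real CARD('q) * (\<integral>z. norm (v z) \<partial>\<mu>)
    + real CARD('q) * (\<integral>z. norm (h z) \<partial>\<nu>)"
  have Q0: "0 \<le> Q" unfolding Q_def by (intro add_nonneg_nonneg mult_nonneg_nonneg) auto
  have U: "open (\<Omega> \<times> (UNIV :: (real^'q) set))" using \<Omega> by (rule open_Times[OF _ open_UNIV])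
  have close: "\<bar>S \<phi>\<bar> \<le> e * Q" if e: "0 < e" for e
  proof -
    obtain \<psi> where \<psi>: "Cinf_c (\<Omega> \<times> UNIV) \<psi>"
      "\<And>w z. w \<in> Basis \<Longrightarrow> norm (frechet_derivative \<psi> (at z) w - frechet_derivative \<phi> (at z) w) \<le> e"
      using C1c_smooth_approx[OF \<phi> U e] by blast
    have \<psi>1: "C1c (\<Omega> \<times> UNIV) \<psi>" by (rule Cinf_c_C1c[OF \<psi>(1)])
    have S0: "S \<psi> = 0" using eq \<psi>(1) by (simp add: continuity_eq_def S_def)
    have bx: "(axis j 1, 0) \<in> (Basis :: ('d, 'q) pt set)" and bY: "(0, axis i 1) \<in> (Basis :: ('d, 'q) pt set)"
      for j :: 'd and i :: 'q
      by (auto simp: Basis_prod_def axis_in_Basis_iff)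
    have dv: "norm (div_x \<phi> z - div_x \<psi> z) \<le> e * real CARD('d)" for z
    proof -
      let ?D = "\<lambda>\<phi> j. frechet_derivative \<phi> (at z) (axis j 1, 0)"
      have "norm (div_x \<phi> z - div_x \<psi> z) \<le> (\<Sum>j\<in>UNIV. norm (?D \<phi> j $ j - ?D \<psi> j $ j))"
        unfolding div_x_def sum_subtractf[symmetric] by (rule norm_sum)
      also have "\<dots> \<le> (\<Sum>j\<in>(UNIV::'d set). e)"
      proof (rule sum_mono)
        fix j :: 'd
        have "norm (?D \<phi> j $ j - ?D \<psi> j $ j)
            \<le> norm (?D \<phi> j - ?D \<psi> j)"
          using component_le_norm_cart[of "?D \<phi> j - ?D \<psi> j" j]
          by simp
        also have "\<dots> \<le> e" using \<psi>(2)[OF bx[of j], of z] by (simp add: norm_minus_commute)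
        finally show "norm (?D \<phi> j $ j - ?D \<psi> j $ j) \<le> e" .
      qed
      also have "\<dots> = e * real CARD('d)" by simp
      finally show ?thesis .
    qed
    have gr: "norm (grad_y \<phi> z - grad_y \<psi> z) \<le> e * real CARD('q)" for z
    proof -
      have "norm (grad_y \<phi> z - grad_y \<psi> z) \<le> (\<Sum>i\<in>UNIV. norm ((grad_y \<phi> z - grad_y \<psi> z) $ i))"
        unfolding norm_vec_def by (rule L2_set_le_sum) simp
      also have "\<dots> \<le> (\<Sum>i\<in>(UNIV::'q set). e)"
        using \<psi>(2)[OF bY, of z] by (intro sum_mono) (simp add: grad_y_nth norm_minus_commute)
      also have "\<dots> = e * real CARD('q)" by simp
      finally show ?thesis .
    qed
    \<comment> \<open>The divergence is paired with the constant 1 so that the same estimate covers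
      all three integrals.\<close>
    have 1: "\<bar>(\<integral>z. div_x \<phi> z \<bullet> 1 \<partial>\<mu>) - (\<integral>z. div_x \<psi> z \<bullet> 1 \<partial>\<mu>)\<bar> \<le> e * real CARD('d) * (\<integral>z. norm (1::real) \<partial>\<mu>)"
      by (rule inner_integral_diff_bound[OF Cc_bcontfun[OF div_x_Cc[OF \<phi>]] Cc_bcontfun[OF div_x_Cc[OF \<psi>1]] _ \<mu>(1) dv]) simp
    have 2: "\<bar>(\<integral>z. grad_y \<phi> z \<bullet> v z \<partial>\<mu>) - (\<integral>z. grad_y \<psi> z \<bullet> v z \<partial>\<mu>)\<bar> \<le> e * real CARD('q) * (\<integral>z. norm (v z) \<partial>\<mu>)"
      by (rule inner_integral_diff_bound[OF Cc_bcontfun[OF grad_y_Cc[OF \<phi>]] Cc_bcontfun[OF grad_y_Cc[OF \<psi>1]] v \<mu>(1) gr])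
    have 3: "\<bar>(\<integral>z. grad_y \<phi> z \<bullet> h z \<partial>\<nu>) - (\<integral>z. grad_y \<psi> z \<bullet> h z \<partial>\<nu>)\<bar> \<le> e * real CARD('q) * (\<integral>z. norm (h z) \<partial>\<nu>)"
      by (rule inner_integral_diff_bound[OF Cc_bcontfun[OF grad_y_Cc[OF \<phi>]] Cc_bcontfun[OF grad_y_Cc[OF \<psi>1]] h \<nu> gr])
    have "\<bar>S \<phi> - S \<psi>\<bar> \<le> e * real CARD('d) * (\<integral>z. norm (1::real) \<partial>\<mu>) + e * real CARD('q) * (\<integral>z. norm (v z) \<partial>\<mu>)
        + e * real CARD('q) * (\<integral>z. norm (h z) \<partial>\<nu>)"
      unfolding S_def using 1 2 3 by (simp only: inner_real_def mult_1_right)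
    also have "\<dots> = e * Q" by (simp add: Q_def algebra_simps)
    finally show ?thesis using S0 by simp
  qed
  have "\<bar>S \<phi>\<bar> \<le> 0"
  proof (rule field_le_epsilon)
    fix e :: real assume e: "0 < e"
    have "e / (Q + 1) * Q \<le> e" using e Q0 by (simp add: pos_divide_le_eq algebra_simps)
    then show "\<bar>S \<phi>\<bar> \<le> 0 + e" using close[of "e / (Q + 1)"] e Q0 by simp
  qed
  then show ?thesis by (simp add: S_def)
qed

section \<open>Extended real integrals and the duality inequality\<close>

lemma ereal_integral_real:
  assumes "integrable M g"
  shows "ereal_integral M (\<lambda>z. ereal (g z)) = ereal (integral\<^sup>L M g)"
    "(\<integral>\<^sup>+z. ennreal (g z) \<partial>M) < \<infinity>" "(\<integral>\<^sup>+z. ennreal (- g z) \<partial>M) < \<infinity>"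
proof -
  show f: "(\<integral>\<^sup>+z. ennreal (g z) \<partial>M) < \<infinity>" "(\<integral>\<^sup>+z. ennreal (- g z) \<partial>M) < \<infinity>"
    using assms by (auto simp: real_integrable_def less_top)
  have e: "enn2ereal x = ereal (enn2real x)" if "x < \<infinity>" for x
    using that by (cases x) (auto simp: enn2ereal_ennreal)
  show "ereal_integral M (\<lambda>z. ereal (g z)) = ereal (integral\<^sup>L M g)"
    using real_lebesgue_integral_def[OF assms] e[OF f(1)] e[OF f(2)]
    by (simp add: ereal_integral_def e2ennreal_ereal)
qed

text \<open>The nonnegative integrals are monotone for arbitrary functions, and so is extended real
  subtraction, where \<open>\<infinity> - \<infinity> = \<infinity>\<close>; the Legendre term can
  thus be compared as it stands.\<close>

lemma ereal_integral_mono: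
  assumes "\<And>z. f z \<le> g z"
  shows "ereal_integral M f \<le> ereal_integral M g"
  unfolding ereal_integral_def
  by (intro ereal_minus_mono; (subst less_eq_ennreal.rep_eq[symmetric])?)
    (auto intro!: nn_integral_mono e2ennreal_mono assms)

lemma integral_le_enn2real:
  assumes "AE z in M. ennreal (f z) \<le> g z" "(\<integral>\<^sup>+z. g z \<partial>M) < \<infinity>" "integrable M f"
  shows "integral\<^sup>L M f \<le> enn2real (\<integral>\<^sup>+z. g z \<partial>M)"
proof -
  have "integral\<^sup>L M f \<le> enn2real (\<integral>\<^sup>+z. ennreal (f z) \<partial>M)"
    using real_lebesgue_integral_def[OF assms(3)] by simp
  also have "\<dots> \<le> enn2real (\<integral>\<^sup>+z. g z \<partial>M)"
    using assms(1,2) by (intro enn2real_mono nn_integral_mono_AE) auto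
  finally show ?thesis .
qed

text \<open>The absolutely continuous part is handled by \<open>legendre_ge\<close> at
  \<open>v z\<close>. On the singular part admissibility of \<open>\<phi>\<close> enters: a finite
  Legendre transform provides an affine minorant with slope \<open>grad_y \<phi> z\<close>, so
  \<open>grad_y \<phi> z \<bullet> h z\<close> is one of the terms in the supremum giving the
  recession function.\<close>

lemma weak_duality:
  fixes W :: "real^'d::finite^'q::finite \<Rightarrow> real"
  assumes \<Omega>: "open \<Omega>" and W: "convex_on UNIV W" "\<And>v. 0 \<le> W v"
    and \<mu>: "sets \<mu> = sets borel" "finite_measure \<mu>"
    and ok: "decomp_ok \<Omega> \<mu> v \<nu> h" and eq: "continuity_eq \<Omega> \<mu> v \<nu> h"
    and \<phi>: "\<phi> \<in> dual_admissible W \<Omega>"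
  shows "- ereal_integral \<mu> (\<lambda>z. ereal (div_x \<phi> z) + legendre W (grad_y \<phi> z)) \<le> enn2ereal (BW W \<mu> v \<nu> h)"
proof (cases "BW W \<mu> v \<nu> h = \<infinity>")
  case False
  have \<phi>1: "C1c (\<Omega> \<times> UNIV) \<phi>" and \<phi>W: "\<And>z. z \<in> \<Omega> \<times> UNIV \<Longrightarrow> legendre W (grad_y \<phi> z) < \<infinity>"
    using \<phi> by (auto simp: dual_admissible_def)
  have v: "integrable \<mu> v" and \<nu>: "sets \<nu> = sets borel" "finite_measure \<nu>"
    and \<nu>U: "emeasure \<nu> (UNIV - \<Omega> \<times> UNIV) = 0" and hm: "h \<in> borel_measurable borel" and h1: "AE z in \<nu>. norm (h z) = 1"
    using ok by (auto simp: decomp_ok_def)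
  interpret \<nu>: finite_measure \<nu> by fact
  have hi: "integrable \<nu> h"
  proof (rule \<nu>.integrable_const_bound[of _ 1])
    show "AE z in \<nu>. norm (h z) \<le> 1" using h1 by (rule AE_mp) (intro AE_I2, simp)
    show "h \<in> borel_measurable \<nu>" using hm by (simp add: measurable_cong_sets[OF \<nu>(1) refl])
  qed
  define a b where "a = (\<integral>\<^sup>+z. ennreal (W (v z)) \<partial>\<mu>)" and "b = (\<integral>\<^sup>+z. recession W (h z) \<partial>\<nu>)"
  have ab: "a < \<infinity>" "b < \<infinity>" "BW W \<mu> v \<nu> h = a + b"
    using False by (auto simp: BW_def a_def b_def less_top)
  have cW: "continuous_on UNIV W" using convex_on_continuous[OF open_UNIV W(1)] .
  have Wm: "(\<lambda>z. W (v z)) \<in> borel_measurable \<mu>"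
    by (rule measurable_compose[OF borel_measurable_integrable[OF v] borel_measurable_continuous_onI[OF cW]])
  have Wi: "integrable \<mu> (\<lambda>z. W (v z))"
    using ab(1) W(2) by (intro integrableI_nonneg[OF Wm]) (auto simp: a_def)
  have Wa: "a = ennreal (\<integral>z. W (v z) \<partial>\<mu>)"
    unfolding a_def using Wi W(2) by (intro nn_integral_eq_integral) auto
  have di: "integrable \<mu> (div_x \<phi>)" by (rule integrable_Cc[OF div_x_Cc[OF \<phi>1] \<mu>(2,1)])
  have gi: "integrable \<mu> (\<lambda>z. grad_y \<phi> z \<bullet> v z)"
    by (rule integrable_bcontfun_inner[OF Cc_bcontfun[OF grad_y_Cc[OF \<phi>1]] v \<mu>(1)])
  have ghi: "integrable \<nu> (\<lambda>z. grad_y \<phi> z \<bullet> h z)"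
    by (rule integrable_bcontfun_inner[OF Cc_bcontfun[OF grad_y_Cc[OF \<phi>1]] hi \<nu>(1)])
  define g where "g z = div_x \<phi> z + (grad_y \<phi> z \<bullet> v z - W (v z))" for z
  have gint: "integrable \<mu> g" unfolding g_def using di gi Wi by auto
  \<comment> \<open>\<open>g\<close> is an integrable minorant of the dual integrand.\<close>
  have "ereal (integral\<^sup>L \<mu> g) \<le> ereal_integral \<mu> (\<lambda>z. ereal (div_x \<phi> z) + legendre W (grad_y \<phi> z))"
    unfolding ereal_integral_real(1)[OF gint, symmetric] g_def plus_ereal.simps(1)[symmetric]
    by (intro ereal_integral_mono add_left_mono legendre_ge)
  then have "- ereal_integral \<mu> (\<lambda>z. ereal (div_x \<phi> z) + legendre W (grad_y \<phi> z)) \<le> ereal (- integral\<^sup>L \<mu> g)"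
    by (simp add: ereal_uminus_le_reorder)
  also have gI: "integral\<^sup>L \<mu> g = integral\<^sup>L \<mu> (div_x \<phi>) + ((\<integral>z. grad_y \<phi> z \<bullet> v z \<partial>\<mu>) - (\<integral>z. W (v z) \<partial>\<mu>))"
    unfolding g_def using di gi Wi by simp
  also have "- \<dots> = (\<integral>z. grad_y \<phi> z \<bullet> h z \<partial>\<nu>) + (\<integral>z. W (v z) \<partial>\<mu>)"
    using continuity_eq_C1c[OF \<mu> \<nu>(1) v hi \<Omega> eq \<phi>1] by linarith
  also have "\<dots> \<le> enn2real b + enn2real a"
  proof (rule add_mono)
    show "(\<integral>z. grad_y \<phi> z \<bullet> h z \<partial>\<nu>) \<le> enn2real b"
      unfolding b_def
    proof (rule integral_le_enn2real[OF _ _ ghi])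
      have "\<Omega> \<times> UNIV \<in> sets (borel :: ('d, 'q) pt measure)"
        using \<Omega> by (intro borel_open open_Times open_UNIV)
      then have "UNIV - \<Omega> \<times> UNIV \<in> sets (borel :: ('d, 'q) pt measure)"
        by (rule sets.Diff[rotated]) simp
      then have "UNIV - \<Omega> \<times> UNIV \<in> null_sets \<nu>"
        using \<nu>U \<nu>(1) by (simp add: null_sets_def)
      then have "AE z in \<nu>. z \<in> \<Omega> \<times> UNIV" by (rule AE_I') auto
      then show "AE z in \<nu>. ennreal (grad_y \<phi> z \<bullet> h z) \<le> recession W (h z)"
      proof (rule AE_mp, intro AE_I2 impI)
        fix z assume "z \<in> \<Omega> \<times> (UNIV :: (real^'q) set)"
        then obtain c where c: "(grad_y \<phi> z, c) \<in> affine_minorants W"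
          using legendre_finiteD[OF \<phi>W] by blast
        show "ennreal (grad_y \<phi> z \<bullet> h z) \<le> recession W (h z)"
          unfolding recession_eq_SUP[OF W] by (rule SUP_upper2[OF c]) simp
      qed
    qed (use ab in \<open>simp add: b_def\<close>)
    show "(\<integral>z. W (v z) \<partial>\<mu>) \<le> enn2real a"
      unfolding Wa using W(2) by (simp add: integral_nonneg_AE)
  qed
  also have "ereal (enn2real b + enn2real a) = enn2ereal (a + b)"
  proof -
    have "a + b = ennreal (enn2real b + enn2real a)" using ab by (simp add: ennreal_plus add.commute)
    then show ?thesis by (simp only: enn2ereal_ennreal add_nonneg_nonneg enn2real_nonneg)
  qed
  finally show ?thesis by (simp add: ab(3))
qed simp

section \<open>Strong duality\<close>

text \<open>The set \<open>C\<close> mixes free fields \<open>\<psi>\<close>, paying for the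
  Legendre transform, with gradients \<open>grad_y \<phi>\<close>, paying through the divergence.
  Gradients may be scaled by any real number, which forces an equality on them; the free fields
  contain a ball of bounded cost, which forces boundedness.\<close>

lemma dual_functional:
  fixes W :: "real^'d::finite^'q::finite \<Rightarrow> real"
  assumes W: "assumptionB W" and \<mu>: "sets \<mu> = sets borel" "finite_measure \<mu>"
    and D: "\<And>\<phi>. \<phi> \<in> dual_admissible W \<Omega> \<Longrightarrow>
      - ereal_integral \<mu> (\<lambda>z. ereal (div_x \<phi> z) + legendre W (grad_y \<phi> z)) \<le> ereal D"
  obtains L :: "(('d, 'q) pt \<Rightarrow>\<^sub>C (real^'d^'q)) \<Rightarrow> real" and B where "linear L" "\<And>\<psi>. L \<psi> \<le> B * norm \<psi>"
    "\<And>\<phi>. C1c (\<Omega> \<times> UNIV) \<phi> \<Longrightarrow> L (Bcontfun (grad_y \<phi>)) = - integral\<^sup>L \<mu> (div_x \<phi>)"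
    "\<And>\<psi> c. integrable \<mu> c \<Longrightarrow> (\<And>z. (apply_bcontfun \<psi> z, c z) \<in> affine_minorants W) \<Longrightarrow> L \<psi> \<le> integral\<^sup>L \<mu> c + D"
proof -
  let ?A = "affine_minorants W" and ?I = "\<lambda>f. integral\<^sup>L \<mu> f"
  interpret finite_measure \<mu> by fact
  define U where "U = \<Omega> \<times> (UNIV :: (real^'q) set)"
  have W0: "(0, 0) \<in> ?A" using W by (intro affine_minorants_zero) (simp add: assumptionB_def)
  obtain \<delta> K where \<delta>: "0 < \<delta>" "\<And>r. norm r \<le> \<delta> \<Longrightarrow> (r, K) \<in> ?A"
    using assumptionB_ball[OF W] by blast
  define gy :: "(('d, 'q) pt \<Rightarrow> real^'d) \<Rightarrow> (('d, 'q) pt \<Rightarrow>\<^sub>C (real^'d^'q))" where "gy \<phi> = Bcontfun (grad_y \<phi>)" for \<phi>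
  have gy: "apply_bcontfun (gy \<phi>) = grad_y \<phi>" if "C1c U \<phi>" for \<phi>
    unfolding gy_def by (rule Bcontfun_inverse[OF Cc_bcontfun[OF grad_y_Cc[OF that]]])
  have gy_lin: "gy (\<lambda>z. a *\<^sub>R \<phi> z + b *\<^sub>R \<psi> z) = a *\<^sub>R gy \<phi> + b *\<^sub>R gy \<psi>" if "C1c U \<phi>" "C1c U \<psi>" for a b \<phi> \<psi>
    by (rule bcontfun_eqI) (simp add: gy that C1c_linear_combination(1)[OF that] grad_y_linear[OF that])
  have gy_scale: "gy (\<lambda>z. a *\<^sub>R \<phi> z) = a *\<^sub>R gy \<phi>" if "C1c U \<phi>" for a \<phi>
    by (rule bcontfun_eqI) (simp add: gy that C1c_scale[OF that] grad_y_scale[OF that])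
  have gy_zero: "gy (\<lambda>_. 0) = 0"
    by (rule bcontfun_eqI) (simp add: gy C1c_zero grad_y_zero)
  have di: "integrable \<mu> (div_x \<phi>)" if "C1c U \<phi>" for \<phi>
    by (rule integrable_Cc[OF div_x_Cc[OF that] \<mu>(2,1)])
  define C where "C = {(\<psi> + gy \<phi>, ?I c + D - ?I (div_x \<phi>)) |\<psi> \<phi> c.
    C1c U \<phi> \<and> integrable \<mu> c \<and> (\<forall>z. (apply_bcontfun \<psi> z, c z) \<in> ?A)}"
  have CI: "(\<psi> + gy \<phi>, ?I c + D - ?I (div_x \<phi>)) \<in> C"
    if "C1c U \<phi>" "integrable \<mu> c" "\<And>z. (apply_bcontfun \<psi> z, c z) \<in> ?A" for \<psi> \<phi> c
    unfolding C_def using that by blast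
  have CI0: "(\<psi>, ?I c + D) \<in> C"
    if "integrable \<mu> c" "\<And>z. (apply_bcontfun \<psi> z, c z) \<in> ?A" for \<psi> c
    using CI[OF C1c_zero that] by (simp add: gy_zero div_x_zero)
  have "convex C"
  proof (rule convexI)
    fix x y and s t :: real assume x: "x \<in> C" and y: "y \<in> C" and st: "0 \<le> s" "0 \<le> t" "s + t = 1"
    obtain \<psi>1 \<phi>1 c1 where 1: "x = (\<psi>1 + gy \<phi>1, ?I c1 + D - ?I (div_x \<phi>1))" "C1c U \<phi>1"
      "integrable \<mu> c1" "\<And>z. (apply_bcontfun \<psi>1 z, c1 z) \<in> ?A" using x unfolding C_def by blast
    obtain \<psi>2 \<phi>2 c2 where 2: "y = (\<psi>2 + gy \<phi>2, ?I c2 + D - ?I (div_x \<phi>2))" "C1c U \<phi>2"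
      "integrable \<mu> c2" "\<And>z. (apply_bcontfun \<psi>2 z, c2 z) \<in> ?A" using y unfolding C_def by blast
    let ?\<phi> = "\<lambda>z. s *\<^sub>R \<phi>1 z + t *\<^sub>R \<phi>2 z" and ?c = "\<lambda>z. s * c1 z + t * c2 z" and ?\<psi> = "s *\<^sub>R \<psi>1 + t *\<^sub>R \<psi>2"
    have mem: "(?\<psi> + gy ?\<phi>, ?I ?c + D - ?I (div_x ?\<phi>)) \<in> C"
    proof (rule CI)
      show "C1c U ?\<phi>" by (rule C1c_linear_combination(1)[OF 1(2) 2(2)])
      show "integrable \<mu> ?c" using 1(3) 2(3) by auto
      fix z
      have "s *\<^sub>R (\<psi>1 z, c1 z) + t *\<^sub>R (\<psi>2 z, c2 z) \<in> ?A"
        by (rule convexD[OF convex_affine_minorants 1(4) 2(4) st])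
      then show "(apply_bcontfun ?\<psi> z, ?c z) \<in> ?A" by simp
    qed
    have I1: "?I ?c = s * ?I c1 + t * ?I c2" using 1(3) 2(3) by simp
    have I2: "?I (div_x ?\<phi>) = s * ?I (div_x \<phi>1) + t * ?I (div_x \<phi>2)"
      using di[OF 1(2)] di[OF 2(2)] by (simp add: div_x_linear[OF 1(2) 2(2), abs_def])
    have "s *\<^sub>R x + t *\<^sub>R y = (?\<psi> + gy ?\<phi>, ?I ?c + D - ?I (div_x ?\<phi>))"
    proof -
      have "s * D + t * D = D" using st(3) by (simp flip: distrib_right)
      then have "s * (?I c1 + D - ?I (div_x \<phi>1)) + t * (?I c2 + D - ?I (div_x \<phi>2))
          = ?I ?c + D - ?I (div_x ?\<phi>)"
        unfolding I1 I2 right_diff_distrib distrib_left by linarith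
      then show ?thesis by (simp add: 1(1) 2(1) gy_lin[OF 1(2) 2(2)] scaleR_add_right)
    qed
    then show "s *\<^sub>R x + t *\<^sub>R y \<in> C" using mem by simp
  qed
  moreover have "\<exists>t>0. \<exists>a. (t *\<^sub>R \<psi>, a) \<in> C" for \<psi>
  proof -
    \<comment> \<open>The scaling puts \<open>\<psi>\<close> into the ball of radius
      \<open>\<delta>\<close>; adding 1 covers \<open>\<psi> = 0\<close>.\<close>
    define t where "t = \<delta> / (norm \<psi> + 1)"
    have n1: "0 < norm \<psi> + 1" by (simp add: add_nonneg_pos)
    then have t: "0 < t" using \<delta>(1) by (simp add: t_def)
    have "(apply_bcontfun (t *\<^sub>R \<psi>) z, K) \<in> ?A" for z
    proof (rule \<delta>(2))
      have "norm (apply_bcontfun (t *\<^sub>R \<psi>) z) \<le> norm (t *\<^sub>R \<psi>)" by (rule norm_bounded)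
      also have "\<dots> = \<delta> * norm \<psi> / (norm \<psi> + 1)" using t by (simp add: t_def abs_of_pos n1 \<delta>(1))
      also have "\<dots> \<le> \<delta>" using n1 \<delta>(1) by (simp add: pos_divide_le_eq)
      finally show "norm (apply_bcontfun (t *\<^sub>R \<psi>) z) \<le> \<delta>" .
    qed
    then show ?thesis using CI0[of "\<lambda>_. K" "t *\<^sub>R \<psi>"] t by auto
  qed
  moreover have "0 \<le> a" if aC: "(0, a) \<in> C" for a
  proof -
    obtain \<psi> \<phi> c where p: "0 = \<psi> + gy \<phi>" "a = ?I c + D - ?I (div_x \<phi>)" "C1c U \<phi>"
      "integrable \<mu> c" "\<And>z. (apply_bcontfun \<psi> z, c z) \<in> ?A" using aC unfolding C_def by blast
    \<comment> \<open>A point over 0 means \<open>\<psi> = - grad_y \<phi>\<close>, the gradient of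
      \<open>- \<phi>\<close>; hence \<open>- \<phi>\<close> is a competitor in the dual problem and
      the bound by \<open>D\<close> applies to it.\<close>
    define \<phi>' where "\<phi>' = (\<lambda>z. (- 1) *\<^sub>R \<phi> z)"
    have \<phi>': "C1c U \<phi>'" unfolding \<phi>'_def by (rule C1c_scale[OF p(3)])
    have "\<psi> = - gy \<phi>" using p(1) by (metis add.commute eq_neg_iff_add_eq_0)
    then have "\<psi> = gy \<phi>'" unfolding \<phi>'_def by (simp only: gy_scale[OF p(3)]) simp
    then have A: "(grad_y \<phi>' z, c z) \<in> ?A" for z using p(5)[of z] gy[OF \<phi>'] by simp
    then have le: "legendre W (grad_y \<phi>' z) \<le> ereal (c z)" for z by (simp add: legendre_le_iff)
    have "legendre W (grad_y \<phi>' z) < \<infinity>" for z by (rule le_less_trans[OF le]) simp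
    then have adm: "\<phi>' \<in> dual_admissible W \<Omega>" using \<phi>' by (simp add: dual_admissible_def U_def)
    have i: "integrable \<mu> (\<lambda>z. div_x \<phi>' z + c z)" using di[OF \<phi>'] p(4) by auto
    have "ereal_integral \<mu> (\<lambda>z. ereal (div_x \<phi>' z) + legendre W (grad_y \<phi>' z)) \<le> ereal (\<integral>z. div_x \<phi>' z + c z \<partial>\<mu>)"
      unfolding ereal_integral_real(1)[OF i, symmetric] plus_ereal.simps(1)[symmetric]
      by (intro ereal_integral_mono add_left_mono le)
    then have "- ereal (\<integral>z. div_x \<phi>' z + c z \<partial>\<mu>)
        \<le> - ereal_integral \<mu> (\<lambda>z. ereal (div_x \<phi>' z) + legendre W (grad_y \<phi>' z))"
      by (simp only: ereal_minus_le_minus)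
    also have "\<dots> \<le> ereal D" by (rule D[OF adm])
    finally have "- (\<integral>z. div_x \<phi>' z + c z \<partial>\<mu>) \<le> D" by simp
    moreover have "?I (div_x \<phi>') = - ?I (div_x \<phi>)"
      unfolding \<phi>'_def by (simp only: div_x_scale[OF p(3), abs_def] mult_minus1 Bochner_Integration.integral_minus)
    ultimately show ?thesis using di[OF \<phi>'] p(4) by (simp add: p(2))
  qed
  ultimately obtain L where L: "linear L" "\<And>x a. (x, a) \<in> C \<Longrightarrow> L x \<le> a"
    using linear_minorant_convex_set[of C] by blast
  have cost: "L \<psi> \<le> ?I c + D"
    if "integrable \<mu> c" "\<And>z. (apply_bcontfun \<psi> z, c z) \<in> ?A" for \<psi> c
    by (rule L(2)[OF CI0[OF that]])
  have ext: "L (gy \<phi>) = - ?I (div_x \<phi>)" if \<phi>: "C1c U \<phi>" for \<phi>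
  proof -
    define X where "X = L (gy \<phi>) + ?I (div_x \<phi>)"
    have "t * X \<le> D" for t
    proof -
      have "L (0 + gy (\<lambda>z. t *\<^sub>R \<phi> z)) \<le> ?I (\<lambda>_. 0) + D - ?I (div_x (\<lambda>z. t *\<^sub>R \<phi> z))"
        by (rule L(2)[OF CI[OF C1c_scale[OF \<phi>]]]) (use W0 in auto)
      then have "t * L (gy \<phi>) \<le> D - t * ?I (div_x \<phi>)"
        by (simp add: gy_scale[OF \<phi>] linear_scale[OF L(1)] div_x_scale[OF \<phi>, abs_def])
      then show ?thesis by (simp add: X_def algebra_simps)
    qed
    \<comment> \<open>If \<open>X\<close> were nonzero, this multiple would give
      \<open>D + 1 \<le> D\<close>.\<close>
    from this[of "(D + 1) / X"] have "X = 0" by (cases "X = 0") auto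
    then show ?thesis by (simp add: X_def)
  qed
  \<comment> \<open>The cost bound for fields of norm \<open>\<delta>\<close> with constant
    \<open>c = K\<close>, divided by \<open>\<delta>\<close>.\<close>
  define B where "B = (K * measure \<mu> (space \<mu>) + D) / \<delta>"
  have "L \<psi> \<le> B * norm \<psi>" for \<psi>
  proof (cases "\<psi> = 0")
    case True
    then show ?thesis by (simp add: linear_0[OF L(1)])
  next
    case False
    then have n: "0 < norm \<psi>" by simp
    define s where "s = \<delta> / norm \<psi>"
    have s: "0 < s" using n \<delta>(1) by (simp add: s_def)
    have "L (s *\<^sub>R \<psi>) \<le> ?I (\<lambda>_. K) + D"
    proof (rule cost)
      fix z
      have "norm (apply_bcontfun (s *\<^sub>R \<psi>) z) \<le> norm (s *\<^sub>R \<psi>)" by (rule norm_bounded)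
      also have "\<dots> = \<delta>" using \<delta>(1) n by (simp add: s_def)
      finally show "(apply_bcontfun (s *\<^sub>R \<psi>) z, K) \<in> ?A" by (rule \<delta>(2))
    qed simp
    then have "s * L \<psi> \<le> K * measure \<mu> (space \<mu>) + D" by (simp add: linear_scale[OF L(1)] mult.commute)
    then have "\<delta> * L \<psi> \<le> (K * measure \<mu> (space \<mu>) + D) * norm \<psi>" using n by (simp add: s_def pos_divide_le_eq)
    then show ?thesis using \<delta>(1) by (simp add: B_def pos_le_divide_eq mult.commute)
  qed
  then show thesis
    using that[OF L(1)] ext cost unfolding U_def gy_def by blast
qed

text \<open>The measure \<open>H T\<close> is the optimal flux. Where \<open>k > 0\<close> it equals
  \<open>v \<mu>\<close> with \<open>v = H / k\<close>; where \<open>k = 0\<close> it is singular to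
  \<open>\<mu>\<close>, with total variation \<open>norm H\<close> times \<open>T\<close> and
  direction \<open>H / norm H\<close>.\<close>

lemma strong_duality:
  fixes W :: "real^'d::finite^'q::finite \<Rightarrow> real"
  assumes \<Omega>: "open \<Omega>" and W: "assumptionB W"
    and \<mu>: "sets \<mu> = sets borel" "finite_measure \<mu>" "emeasure \<mu> (- (\<Omega> \<times> UNIV)) = 0"
    and D: "\<And>\<phi>. \<phi> \<in> dual_admissible W \<Omega> \<Longrightarrow>
      - ereal_integral \<mu> (\<lambda>z. ereal (div_x \<phi> z) + legendre W (grad_y \<phi> z)) \<le> ereal D"
  shows "\<exists>v \<nu> h. decomp_ok \<Omega> \<mu> v \<nu> h \<and> continuity_eq \<Omega> \<mu> v \<nu> h \<and> BW W \<mu> v \<nu> h \<le> ennreal D"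
proof -
  define U where "U = \<Omega> \<times> (UNIV :: (real^'q) set)"
  have U: "open U" unfolding U_def using \<Omega> by (rule open_Times[OF _ open_UNIV])
  have Wc: "convex_on UNIV W" and Wn: "\<And>v. 0 \<le> W v" using W by (auto simp: assumptionB_def)
  have cW: "continuous_on UNIV W" using convex_on_continuous[OF open_UNIV Wc] .
  obtain L :: "(('d, 'q) pt \<Rightarrow>\<^sub>C (real^'d^'q)) \<Rightarrow> real" and B where L: "linear L" "\<And>\<psi>. L \<psi> \<le> B * norm \<psi>"
    "\<And>\<phi>. C1c U \<phi> \<Longrightarrow> L (Bcontfun (grad_y \<phi>)) = - integral\<^sup>L \<mu> (div_x \<phi>)"
    "\<And>\<psi> c. integrable \<mu> c \<Longrightarrow> (\<And>z. (apply_bcontfun \<psi> z, c z) \<in> affine_minorants W) \<Longrightarrow> L \<psi> \<le> integral\<^sup>L \<mu> c + D"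
    unfolding U_def using dual_functional[OF W \<mu>(1,2) D] by blast
  obtain T k H where T: "sets T = sets borel" "finite_measure T" "emeasure T (- U) = 0"
    and k: "k \<in> borel_measurable borel" "\<And>z. 0 \<le> k z" "integrable T k" and \<mu>T: "\<mu> = density T (\<lambda>z. ennreal (k z))"
    and H: "H \<in> borel_measurable borel" "integrable T H"
    and rep: "\<And>\<psi>. apply_bcontfun \<psi> \<in> Cc U \<Longrightarrow> L \<psi> = (\<integral>z. \<psi> z \<bullet> H z \<partial>T)"
    by (rule riesz_vector[OF U L(1,2) \<mu>[folded U_def]]) (rule that)
  have mT: "f \<in> borel_measurable T \<longleftrightarrow> f \<in> borel_measurable borel"
    for f :: "('d, 'q) pt \<Rightarrow> 'b::topological_space"
    by (simp add: measurable_cong_sets[OF T(1) refl])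
  have kT: "k \<in> borel_measurable T" using k(1) by (simp add: mT)
  obtain s :: "nat \<Rightarrow> (real^'d^'q) \<times> real" where s: "s 0 = (0, 0)" "range s \<subseteq> affine_minorants W"
    "affine_minorants W \<subseteq> closure (range s)"
    using countable_affine_minorants[of W, OF Wn] by blast
  have SUPs: "(SUP p\<in>affine_minorants W. ennreal (f p)) = (SUP i. ennreal (f (s i)))"
    if "continuous_on UNIV f" for f
    using SUP_ennreal_dense[OF that s(2,3)] by (simp add: image_image)
  define G where "G i z = fst (s i) \<bullet> H z - k z * snd (s i)" for i z
  have Gint: "integrable T (G i)" for i
    unfolding G_def using H(2) k(3) by auto
  have Gm: "G i \<in> borel_measurable borel" for i
    unfolding G_def using H(1) k(1) by measurable
  have main: "(\<integral>\<^sup>+z. (SUP i. ennreal (G i z)) \<partial>T) \<le> ennreal D"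
  proof (rule nn_integral_SUP_le_of_Cc[OF T U Gm Gint])
    show "G 0 z = 0" for z by (simp add: G_def s)
  next
    fix n and \<theta> :: "nat \<Rightarrow> ('d, 'q) pt \<Rightarrow> real"
    assume \<theta>: "\<And>i. i < n \<Longrightarrow> \<theta> i \<in> Cc U" "\<And>i z. i < n \<Longrightarrow> 0 \<le> \<theta> i z" "\<And>z. (\<Sum>i<n. \<theta> i z) \<le> 1"
    define \<psi> where "\<psi> z = (\<Sum>i<n. \<theta> i z *\<^sub>R fst (s i))" for z
    define c where "c z = (\<Sum>i<n. \<theta> i z * snd (s i))" for z
    have \<psi>C: "\<psi> \<in> Cc U"
    proof (rule CcI[of _ "\<Union>i<n. csupport (\<theta> i)"])
      show "continuous_on UNIV \<psi>"
        unfolding \<psi>_def using CcD(1)[OF \<theta>(1)] by (intro continuous_on_sum continuous_on_scaleR continuous_on_const) auto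
      show "compact (\<Union>i<n. csupport (\<theta> i))" using CcD(2)[OF \<theta>(1)] by (intro compact_UN) auto
      show "(\<Union>i<n. csupport (\<theta> i)) \<subseteq> U" using CcD(3)[OF \<theta>(1)] by auto
      show "\<psi> z = 0" if "z \<notin> (\<Union>i<n. csupport (\<theta> i))" for z
        unfolding \<psi>_def using that by (intro sum.neutral) (auto simp: zero_outside_csupport)
    qed
    have \<psi>a: "apply_bcontfun (Bcontfun \<psi>) = \<psi>" by (rule Bcontfun_inverse[OF Cc_bcontfun[OF \<psi>C]])
    have cC: "c \<in> Cc U"
      unfolding c_def mult.commute[of "\<theta> _ _"] using \<theta>(1) by (intro Cc_sum Cc_scale) auto
    have Aff: "(\<psi> z, c z) \<in> affine_minorants W" for z
    proof -
      \<comment> \<open>The weight missing from 1 is given to the pair \<open>(0, 0)\<close>, which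
        turns the sum into a convex combination without changing its value.\<close>
      define a where "a i = (if i < n then \<theta> i z else 1 - (\<Sum>i<n. \<theta> i z))" for i
      define y where "y i = (if i < n then s i else (0, 0))" for i
      have "(\<Sum>i\<in>insert n {..<n}. a i *\<^sub>R y i) \<in> affine_minorants W"
      proof (rule convex_sum[OF _ convex_affine_minorants])
        show "(\<Sum>i\<in>insert n {..<n}. a i) = 1" by (simp add: a_def)
        show "0 \<le> a i" if "i \<in> insert n {..<n}" for i using \<theta>(2)[of i z] \<theta>(3)[of z] by (simp add: a_def)
        show "y i \<in> affine_minorants W" if "i \<in> insert n {..<n}" for i
          using s(2) affine_minorants_zero[of W, OF Wn] by (auto simp: y_def)
      qed simp
      moreover have "(\<Sum>i\<in>insert n {..<n}. a i *\<^sub>R y i) = (\<Sum>i<n. \<theta> i z *\<^sub>R s i)"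
        by (simp add: a_def y_def zero_prod_def[symmetric])
      moreover have "(\<Sum>i<n. \<theta> i z *\<^sub>R s i) = (\<psi> z, c z)"
        by (simp add: \<psi>_def c_def prod_eq_iff fst_sum snd_sum)
      ultimately show ?thesis by simp
    qed
    have ci: "integrable \<mu> c" by (rule integrable_Cc[OF cC \<mu>(2,1)])
    have "L (Bcontfun \<psi>) \<le> integral\<^sup>L \<mu> c + D"
      by (rule L(4)[OF ci]) (simp add: \<psi>a Aff)
    moreover have "L (Bcontfun \<psi>) = (\<integral>z. \<psi> z \<bullet> H z \<partial>T)" using rep[of "Bcontfun \<psi>"] \<psi>C by (simp add: \<psi>a)
    moreover have cm: "c \<in> borel_measurable T" unfolding mT by (rule borel_measurable_continuous_onI[OF CcD(1)[OF cC]])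
    have "integral\<^sup>L \<mu> c = (\<integral>z. k z * c z \<partial>T)"
      unfolding \<mu>T using cm kT k(2) by (subst integral_density) auto
    moreover have "integrable T (\<lambda>z. k z * c z)"
      using ci unfolding \<mu>T using cm kT k(2) by (subst (asm) integrable_density) auto
    moreover have "integrable T (\<lambda>z. \<psi> z \<bullet> H z)"
      by (rule integrable_bcontfun_inner[OF Cc_bcontfun[OF \<psi>C] H(2) T(1)])
    ultimately have "(\<integral>z. \<psi> z \<bullet> H z - k z * c z \<partial>T) \<le> D" by simp
    also have "(\<lambda>z. \<psi> z \<bullet> H z - k z * c z) = (\<lambda>z. \<Sum>i<n. \<theta> i z * G i z)"
      by (auto simp: \<psi>_def c_def G_def inner_sum_left sum_distrib_left sum_subtractf algebra_simps)
    also have "(\<integral>z. (\<Sum>i<n. \<theta> i z * G i z) \<partial>T) = (\<Sum>i<n. \<integral>z. \<theta> i z * G i z \<partial>T)"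
    proof (rule Bochner_Integration.integral_sum)
      fix i assume "i \<in> {..<n}"
      then show "integrable T (\<lambda>z. \<theta> i z * G i z)"
        using integrable_bcontfun_inner[OF Cc_bcontfun[OF \<theta>(1)] Gint T(1), of i i] by simp
    qed
    finally show "(\<Sum>i<n. \<integral>z. \<theta> i z * G i z \<partial>T) \<le> D" .
  qed
  \<comment> \<open>Division by zero gives 0, so \<open>v\<close> vanishes where \<open>k\<close>
    does and \<open>h\<close> where \<open>H\<close> does; the decomposition \<open>kv\<close> then
    holds at every point.\<close>
  define v where "v z = (1 / k z) *\<^sub>R H z" for z
  define w where "w z = (if k z = 0 then norm (H z) else 0)" for z
  define \<nu> where "\<nu> = density T (\<lambda>z. ennreal (w z))"
  define h where "h z = (1 / norm (H z)) *\<^sub>R H z" for z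
  have vm: "v \<in> borel_measurable borel" unfolding v_def using H(1) k(1) by measurable
  have wm: "w \<in> borel_measurable borel" unfolding w_def using H(1) k(1) by measurable
  have hm: "h \<in> borel_measurable borel" unfolding h_def using H(1) by measurable
  have w0: "0 \<le> w z" for z by (simp add: w_def)
  note mTs = vm[folded mT] wm[folded mT] hm[folded mT]
  have wi: "integrable T w"
    by (rule Bochner_Integration.integrable_bound[OF integrable_norm[OF H(2)] mTs(2)]) (auto simp: w_def)
  have s\<nu>: "sets \<nu> = sets borel" by (simp add: \<nu>_def T)
  have em\<nu>: "emeasure \<nu> A = (\<integral>\<^sup>+z. ennreal (w z) * indicator A z \<partial>T)" if "A \<in> sets borel" for A
    unfolding \<nu>_def using that mTs T(1) by (subst emeasure_density) auto
  have em\<mu>: "emeasure \<mu> A = (\<integral>\<^sup>+z. ennreal (k z) * indicator A z \<partial>T)" if "A \<in> sets borel" for A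
    unfolding \<mu>T using that kT T(1) by (subst emeasure_density) auto
  have f\<nu>: "finite_measure \<nu>"
  proof (rule finite_measureI)
    have "space \<nu> = UNIV" using sets_eq_imp_space_eq[OF s\<nu>] by simp
    then have "emeasure \<nu> (space \<nu>) = (\<integral>\<^sup>+z. ennreal (w z) \<partial>T)" using em\<nu>[of UNIV] by simp
    also have "\<dots> = ennreal (integral\<^sup>L T w)" by (rule nn_integral_eq_integral[OF wi]) (simp add: w0)
    finally show "emeasure \<nu> (space \<nu>) \<noteq> \<infinity>" by simp
  qed
  have kv: "k z *\<^sub>R v z + w z *\<^sub>R h z = H z" for z
    by (simp add: v_def w_def h_def)
  have kvi: "integrable T (\<lambda>z. k z *\<^sub>R v z)"
  proof (rule Bochner_Integration.integrable_bound[OF H(2)])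
    show "(\<lambda>z. k z *\<^sub>R v z) \<in> borel_measurable T" using kT mTs(1) by measurable
    show "AE z in T. norm (k z *\<^sub>R v z) \<le> norm (H z)" by (auto simp: v_def)
  qed
  have whi: "integrable T (\<lambda>z. w z *\<^sub>R h z)"
  proof (rule Bochner_Integration.integrable_bound[OF H(2)])
    show "(\<lambda>z. w z *\<^sub>R h z) \<in> borel_measurable T" using mTs by measurable
    show "AE z in T. norm (w z *\<^sub>R h z) \<le> norm (H z)" by (auto simp: w_def h_def)
  qed
  have "decomp_ok \<Omega> \<mu> v \<nu> h"
    unfolding decomp_ok_def
  proof (intro conjI)
    show "integrable \<mu> v"
      unfolding \<mu>T using kT mTs(1) k(2) kvi by (subst integrable_density) auto
    have Ub: "UNIV - \<Omega> \<times> UNIV \<in> sets (borel :: ('d, 'q) pt measure)"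
      using U unfolding U_def by (intro sets.Diff borel_open) auto
    have "- U \<in> null_sets T" using T U by (auto simp: null_sets_def)
    then have "AE z in T. z \<in> U" by (rule AE_I') auto
    then have "AE z in T. ennreal (w z) * indicator (UNIV - \<Omega> \<times> UNIV) z = 0"
      by (rule AE_mp) (intro AE_I2, simp add: U_def split: split_indicator)
    then show "emeasure \<nu> (UNIV - \<Omega> \<times> UNIV) = 0"
      unfolding em\<nu>[OF Ub] by (subst nn_integral_cong_AE) auto
    \<comment> \<open>This set witnesses singularity: \<open>\<mu>\<close> has density 0 on it, and
      the density \<open>w\<close> of \<open>\<nu>\<close> is 0 off it.\<close>
    have Nb: "{z. k z = 0} \<in> sets borel" using k(1) by measurable
    show "\<exists>N\<in>sets borel. emeasure \<mu> N = 0 \<and> emeasure \<nu> (UNIV - N) = 0"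
    proof (intro bexI[OF _ Nb] conjI)
      have "emeasure \<mu> {z. k z = 0} = (\<integral>\<^sup>+z. 0 \<partial>T)"
        unfolding em\<mu>[OF Nb] by (intro nn_integral_cong) (simp split: split_indicator)
      then show "emeasure \<mu> {z. k z = 0} = 0" by simp
      have Nc: "UNIV - {z. k z = 0} \<in> sets borel" using Nb by (intro sets.Diff) auto
      have "emeasure \<nu> (UNIV - {z. k z = 0}) = (\<integral>\<^sup>+z. 0 \<partial>T)"
        unfolding em\<nu>[OF Nc] by (intro nn_integral_cong) (simp add: w_def split: split_indicator)
      then show "emeasure \<nu> (UNIV - {z. k z = 0}) = 0" by simp
    qed
    have "AE z in T. 0 < ennreal (w z) \<longrightarrow> norm (h z) = 1"
      by (intro AE_I2) (simp add: w_def h_def)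
    then show "AE z in \<nu>. norm (h z) = 1"
      unfolding \<nu>_def using mTs(2) by (subst AE_density) auto
  qed (fact s\<nu> f\<nu> hm)+
  moreover have "continuity_eq \<Omega> \<mu> v \<nu> h"
    unfolding continuity_eq_def
  proof (intro allI impI)
    fix \<phi> :: "('d, 'q) pt \<Rightarrow> real^'d" assume "Cinf_c (\<Omega> \<times> UNIV) \<phi>"
    then have \<phi>: "C1c U \<phi>" unfolding U_def by (rule Cinf_c_C1c)
    have gC: "grad_y \<phi> \<in> Cc U" by (rule grad_y_Cc[OF \<phi>])
    have ga: "apply_bcontfun (Bcontfun (grad_y \<phi>)) = grad_y \<phi>" by (rule Bcontfun_inverse[OF Cc_bcontfun[OF gC]])
    have gm: "grad_y \<phi> \<in> borel_measurable T" unfolding mT by (rule borel_measurable_continuous_onI[OF CcD(1)[OF gC]])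
    have "(\<integral>z. grad_y \<phi> z \<bullet> v z \<partial>\<mu>) = (\<integral>z. grad_y \<phi> z \<bullet> (k z *\<^sub>R v z) \<partial>T)"
      unfolding \<mu>T using kT mTs(1) gm k(2) by (subst integral_density) auto
    moreover have "(\<integral>z. grad_y \<phi> z \<bullet> h z \<partial>\<nu>) = (\<integral>z. grad_y \<phi> z \<bullet> (w z *\<^sub>R h z) \<partial>T)"
      unfolding \<nu>_def using mTs(2,3) gm w0 by (subst integral_density) auto
    moreover have "(\<integral>z. grad_y \<phi> z \<bullet> (k z *\<^sub>R v z) \<partial>T) + (\<integral>z. grad_y \<phi> z \<bullet> (w z *\<^sub>R h z) \<partial>T) = (\<integral>z. grad_y \<phi> z \<bullet> H z \<partial>T)"
      unfolding kv[symmetric] inner_add_right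
      by (rule Bochner_Integration.integral_add[symmetric])
        (rule integrable_bcontfun_inner[OF Cc_bcontfun[OF gC] kvi T(1)], rule integrable_bcontfun_inner[OF Cc_bcontfun[OF gC] whi T(1)])
    moreover have "(\<integral>z. grad_y \<phi> z \<bullet> H z \<partial>T) = - integral\<^sup>L \<mu> (div_x \<phi>)"
      using rep[of "Bcontfun (grad_y \<phi>)"] gC L(3)[OF \<phi>] by (simp add: ga)
    ultimately show "(\<integral>z. div_x \<phi> z \<partial>\<mu>) + (\<integral>z. grad_y \<phi> z \<bullet> v z \<partial>\<mu>) + (\<integral>z. grad_y \<phi> z \<bullet> h z \<partial>\<nu>) = 0"
      by simp
  qed
  moreover have "BW W \<mu> v \<nu> h \<le> ennreal D"
  proof -
    \<comment> \<open>Reduction to a countable supremum makes the recession integrand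
      measurable.\<close>
    have rec: "recession W r = (SUP i. ennreal (fst (s i) \<bullet> r))" for r
      unfolding recession_eq_SUP[OF Wc Wn] by (rule SUPs) (intro continuous_intros)
    have rm: "(\<lambda>z. recession W (h z)) \<in> borel_measurable T"
      unfolding rec using mTs(3) by measurable
    have Wm: "(\<lambda>z. ennreal (W (v z))) \<in> borel_measurable T"
      using measurable_compose[OF mTs(1) borel_measurable_continuous_onI[OF cW]] by measurable
    have "BW W \<mu> v \<nu> h = (\<integral>\<^sup>+z. ennreal (k z) * ennreal (W (v z)) \<partial>T) + (\<integral>\<^sup>+z. ennreal (w z) * recession W (h z) \<partial>T)"
      unfolding BW_def unfolding \<mu>T \<nu>_def using kT mTs(2) Wm rm by (simp add: nn_integral_density)
    also have "\<dots> = (\<integral>\<^sup>+z. ennreal (k z) * ennreal (W (v z)) + ennreal (w z) * recession W (h z) \<partial>T)"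
      using kT mTs(2) Wm rm by (intro nn_integral_add[symmetric] borel_measurable_times_ennreal) auto
    also have "\<dots> \<le> (\<integral>\<^sup>+z. (SUP i. ennreal (G i z)) \<partial>T)"
    proof (rule nn_integral_mono)
      fix z
      have c: "continuous_on UNIV (\<lambda>p. fst p \<bullet> H z - k z * snd p)" by (intro continuous_intros)
      \<comment> \<open>At each point only one of the two terms survives: the perspective of
        \<open>W\<close> if \<open>k z > 0\<close>, and \<open>norm (H z)\<close> times the
        recession function in the direction of \<open>H z\<close> if \<open>k z = 0\<close>.\<close>
      have "ennreal (k z) * ennreal (W (v z)) + ennreal (w z) * recession W (h z)
          \<le> (SUP p\<in>affine_minorants W. ennreal (fst p \<bullet> H z - k z * snd p))"
      proof (cases "k z = 0")
        case False
        then have kz: "0 < k z" using k(2)[of z] by simp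
        have "ennreal (k z) * ennreal (W (v z)) = ennreal (k z * W ((1 / k z) *\<^sub>R H z))"
          using k(2)[of z] by (simp add: v_def ennreal_mult')
        then show ?thesis using perspective_eq_SUP[OF Wc kz, of "H z"] False by (simp add: w_def)
      next
        case True
        show ?thesis
        proof (cases "H z = 0")
          case False
          then show ?thesis
            using True scaled_recession_eq_SUP[OF Wc Wn, of "norm (H z)" "H z"] by (simp add: w_def h_def)
        qed (use True in \<open>simp add: w_def\<close>)
      qed
      also have "\<dots> = (SUP i. ennreal (G i z))" unfolding G_def by (rule SUPs[OF c])
      finally show "ennreal (k z) * ennreal (W (v z)) + ennreal (w z) * recession W (h z) \<le> (SUP i. ennreal (G i z))" .
    qed
    also have "\<dots> \<le> ennreal D" by (rule main)
    finally show ?thesis .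
  qed
  ultimately show ?thesis by blast
qed

theorem mainTheorem3:
  fixes W :: "real^'d::finite^'q::finite \<Rightarrow> real"
    and \<Omega> :: "(real^'d) set"
    and \<mu> :: "(('d,'q) pt) measure"
  assumes "open \<Omega>" and "bounded \<Omega>"
    and "assumptionB W"
    and "\<mu> \<in> marginal_measures \<Omega>"
  shows "enn2ereal (T_Eul W \<Omega> \<mu>) = dual_value W \<Omega> \<mu>"
proof (rule antisym)
  have \<mu>: "sets \<mu> = sets borel" "finite_measure \<mu>"
    and marg: "\<And>A. A \<in> sets borel \<Longrightarrow> emeasure \<mu> (A \<times> UNIV) = emeasure lborel (A \<inter> \<Omega>)"
    using assms(4) by (auto simp: marginal_measures_def)
  \<comment> \<open>The marginal condition on the complement of \<open>\<Omega>\<close> shows that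
    \<open>\<mu>\<close> is concentrated on the product.\<close>
  have "- (\<Omega> \<times> UNIV) = (- \<Omega>) \<times> (UNIV :: (real^'q) set)" by auto
  then have \<mu>U: "emeasure \<mu> (- (\<Omega> \<times> UNIV)) = 0" using marg[of "- \<Omega>"] assms(1) by simp
  have Wc: "convex_on UNIV W" and Wn: "\<And>v. 0 \<le> W v" using assms(3) by (auto simp: assumptionB_def)
  show "dual_value W \<Omega> \<mu> \<le> enn2ereal (T_Eul W \<Omega> \<mu>)"
    unfolding dual_value_def
  proof (rule SUP_least)
    fix \<phi> assume \<phi>: "\<phi> \<in> dual_admissible W \<Omega>"
    let ?x = "- ereal_integral \<mu> (\<lambda>z. ereal (div_x \<phi> z) + legendre W (grad_y \<phi> z))"
    \<comment> \<open>A single dual term may be negative; cutting it at 0 loses nothing against the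
      nonnegative primal value and allows the infimum to be taken in \<open>ennreal\<close>.\<close>
    have "e2ennreal ?x \<le> T_Eul W \<Omega> \<mu>"
      unfolding T_Eul_def
    proof (rule INF_greatest, clarify)
      fix v \<nu> h assume "decomp_ok \<Omega> \<mu> v \<nu> h" "continuity_eq \<Omega> \<mu> v \<nu> h"
      from e2ennreal_mono[OF weak_duality[OF assms(1) Wc Wn \<mu> this \<phi>]]
      show "e2ennreal ?x \<le> BW W \<mu> v \<nu> h" by simp
    qed
    then have "enn2ereal (e2ennreal ?x) \<le> enn2ereal (T_Eul W \<Omega> \<mu>)" by (simp add: less_eq_ennreal.rep_eq)
    moreover have "?x \<le> enn2ereal (e2ennreal ?x)"
      by (cases "0 \<le> ?x") (auto simp: enn2ereal_e2ennreal intro: order_trans[OF _ enn2ereal_nonneg])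
    ultimately show "?x \<le> enn2ereal (T_Eul W \<Omega> \<mu>)" by (rule order_trans[rotated])
  qed
  show "enn2ereal (T_Eul W \<Omega> \<mu>) \<le> dual_value W \<Omega> \<mu>"
  proof (cases "dual_value W \<Omega> \<mu> = \<infinity>")
    case False
    have upper: "- ereal_integral \<mu> (\<lambda>z. ereal (div_x \<phi> z) + legendre W (grad_y \<phi> z)) \<le> dual_value W \<Omega> \<mu>"
      if "\<phi> \<in> dual_admissible W \<Omega>" for \<phi>
      unfolding dual_value_def by (rule SUP_upper[OF that])
    have l0: "legendre W 0 \<le> ereal 0"
      unfolding legendre_le_iff by (rule affine_minorants_zero[OF Wn])
    \<comment> \<open>The zero field shows that the dual value is nonnegative, so it is a real
      number \<open>D\<close> unless it is \<open>\<infinity>\<close>, and \<open>ennreal D\<close>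
      does not truncate it.\<close>
    have "(\<lambda>_. 0) \<in> dual_admissible W \<Omega>"
      using le_less_trans[OF l0, of \<infinity>] by (simp add: dual_admissible_def C1c_zero grad_y_zero)
    note up0 = upper[OF this]
    have "ereal_integral \<mu> (\<lambda>z. ereal (div_x (\<lambda>_. 0) z) + legendre W (grad_y (\<lambda>_. 0) z)) \<le> ereal 0"
    proof -
      have "ereal_integral \<mu> (\<lambda>z. ereal (div_x (\<lambda>_. 0) z) + legendre W (grad_y (\<lambda>_. 0) z)) \<le> ereal_integral \<mu> (\<lambda>z. ereal 0)"
        using l0 by (intro ereal_integral_mono) (simp add: div_x_zero grad_y_zero)
      also have "\<dots> = ereal 0" using ereal_integral_real(1)[of \<mu> "\<lambda>_. 0"] by simp
      finally show ?thesis .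
    qed
    then have "- ereal 0 \<le> - ereal_integral \<mu> (\<lambda>z. ereal (div_x (\<lambda>_. 0) z) + legendre W (grad_y (\<lambda>_. 0) z))"
      by (simp only: ereal_minus_le_minus)
    from order_trans[OF this up0] have "0 \<le> dual_value W \<Omega> \<mu>" by (simp add: zero_ereal_def)
    then obtain D where D: "dual_value W \<Omega> \<mu> = ereal D" "0 \<le> D"
      using False by (cases "dual_value W \<Omega> \<mu>") auto
    obtain v \<nu> h where vh: "decomp_ok \<Omega> \<mu> v \<nu> h" "continuity_eq \<Omega> \<mu> v \<nu> h" "BW W \<mu> v \<nu> h \<le> ennreal D"
      using strong_duality[OF assms(1,3) \<mu> \<mu>U upper[unfolded D(1)]] by blast
    have "T_Eul W \<Omega> \<mu> \<le> BW W \<mu> v \<nu> h"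
      unfolding T_Eul_def using vh(1,2) by (intro INF_lower2[of "(v, \<nu>, h)"]) auto
    then have "T_Eul W \<Omega> \<mu> \<le> ennreal D" using vh(3) by (rule order_trans)
    then have "enn2ereal (T_Eul W \<Omega> \<mu>) \<le> enn2ereal (ennreal D)" by (simp add: less_eq_ennreal.rep_eq)
    then show ?thesis using D by (simp add: enn2ereal_ennreal)
  qed simp
qed

end
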